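(* Let $K$ be a field, $S=K[x_1,\dots,x_m,y_1,\dots,y_n]$ the standard bigraded polynomial ring, $Q=(y_1,\dots,y_n)$, and let $R=S/fS$ be a hypersurface ring, where $f\in S$ is a bihomogeneous form of degree $(a,b)$, and let $n\ge 1$. Then $H^{n-1}_Q(R)$ is an Artinian $S$-module if and only if $m=0$.
   Context: The bigrading on $S$ is given by $\deg x_i=(1,0)$ and $\deg y_j=(0,1)$; $m=0$ is allowed (then $S=K[y_1,\dots,y_n]$). $H^i_Q$ denotes the $i$-th local cohomology functor with support in $Q$.
   Formalization: The form f is taken to be nonzero of degree (a,b) with b ≥ 1; for b = 0 and m ≥ 1 the claim fails, e.g. f = x_1 gives H^{n-1}_Q(R) = 0, which is Artinian although m > 0. *)

theory Defs
  imports "HOL-Algebra.Module" "HOL-Algebra.Ideal_Product" "HOL-Library.Poly_Mapping"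
begin

section \<open>Modules over a commutative ring\<close>

text \<open>
  A module record extends a ring record, but the locale \<^locale>\<open>module\<close> does not look at the
  fields \<^const>\<open>mult\<close> and \<^const>\<open>one\<close> of the module; they are left unspecified in quotients.
\<close>

definition mod_hom ::
  "('r, 'x) ring_scheme \<Rightarrow> ('r, 'a, 'y) module_scheme \<Rightarrow> ('r, 'b, 'z) module_scheme \<Rightarrow> ('a \<Rightarrow> 'b) set"
  where "mod_hom R M N =
    {h \<in> hom (add_monoid M) (add_monoid N).
       \<forall>r\<in>carrier R. \<forall>x\<in>carrier M. h (r \<odot>\<^bsub>M\<^esub> x) = r \<odot>\<^bsub>N\<^esub> h x}"

definition regular_module :: "'r ring \<Rightarrow> ('r, 'r) module"
  where "regular_module R = ring.extend R \<lparr>smult = mult R\<rparr>"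

definition quotient_module :: "('r, 'a) module \<Rightarrow> 'a set \<Rightarrow> ('r, 'a set) module"
  where "quotient_module M N =
    \<lparr>carrier = a_rcosets\<^bsub>M\<^esub> N, mult = undefined, one = undefined,
     zero = N, add = set_add M,
     smult = (\<lambda>r X. \<Union>x\<in>X. N +>\<^bsub>M\<^esub> (r \<odot>\<^bsub>M\<^esub> x))\<rparr>"

definition artinian_module :: "'r ring \<Rightarrow> ('r, 'a) module \<Rightarrow> bool"
  where "artinian_module R M \<longleftrightarrow> module R M \<and>
    (\<forall>N :: nat \<Rightarrow> 'a set.
       (\<forall>i. submodule (N i) R M) \<and> (\<forall>i. N (Suc i) \<subseteq> N i) \<longrightarrow> (\<exists>k. \<forall>i\<ge>k. N i = N k))"


section \<open>Local cohomology as a right derived functor\<close>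

text \<open>
  The extension property cannot range over modules on all types. The test modules
  \<open>A\<close> and \<open>B\<close> live on the element type of the ring \<open>R\<close> itself; since these include
  \<open>R\<close> and all its ideals, Baer's criterion shows that nothing is lost.
\<close>

definition injective_module :: "'r ring \<Rightarrow> ('r, 'a) module \<Rightarrow> bool"
  where "injective_module R E \<longleftrightarrow> module R E \<and>
    (\<forall>(A :: ('r, 'r) module) (B :: ('r, 'r) module) u g.
       module R A \<and> module R B \<and> u \<in> mod_hom R A B \<and> inj_on u (carrier A) \<and> g \<in> mod_hom R A E
       \<longrightarrow> (\<exists>h\<in>mod_hom R B E. \<forall>x\<in>carrier A. h (u x) = g x))"

text \<open>
  \<open>0 \<rightarrow> N \<rightarrow> E 0 \<rightarrow> E 1 \<rightarrow> \<dots>\<close> is exact, with augmentation \<open>\<epsilon>\<close>, differentials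
  \<open>d i : E i \<rightarrow> E (i + 1)\<close> and all \<open>E i\<close> injective.
\<close>

definition injective_resolution ::
  "'r ring \<Rightarrow> ('r, 'a) module \<Rightarrow> (nat \<Rightarrow> ('r, 'e) module) \<Rightarrow> (nat \<Rightarrow> 'e \<Rightarrow> 'e) \<Rightarrow> ('a \<Rightarrow> 'e) \<Rightarrow> bool"
  where "injective_resolution R N E d \<epsilon> \<longleftrightarrow>
    module R N \<and> (\<forall>i. injective_module R (E i)) \<and>
    \<epsilon> \<in> mod_hom R N (E 0) \<and> (\<forall>i. d i \<in> mod_hom R (E i) (E (Suc i))) \<and>
    inj_on \<epsilon> (carrier N) \<and>
    \<epsilon> ` carrier N = a_kernel (E 0) (E 1) (d 0) \<and>
    (\<forall>i. d i ` carrier (E i) = a_kernel (E (Suc i)) (E (Suc (Suc i))) (d (Suc i)))"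

text \<open>\<open>\<Gamma>\<^sub>Q(M)\<close>: the elements annihilated by some power of \<open>Q\<close>.\<close>

definition torsion_part :: "'r ring \<Rightarrow> 'r set \<Rightarrow> ('r, 'a) module \<Rightarrow> 'a set"
  where "torsion_part R Q M =
    {x \<in> carrier M. \<exists>k::nat. \<forall>r \<in> Q [^]\<^bsub>ideals_set R\<^esub> k. r \<odot>\<^bsub>M\<^esub> x = \<zero>\<^bsub>M\<^esub>}"

text \<open>
  The \<open>i\<close>-th cohomology of \<open>\<Gamma>\<^sub>Q(E 0) \<rightarrow> \<Gamma>\<^sub>Q(E 1) \<rightarrow> \<dots>\<close>. This is \<open>H\<^sup>i\<^sub>Q(N)\<close> whenever
  \<open>(E, d)\<close> is an injective resolution of \<open>N\<close>; the choice of resolution matters only up to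
  isomorphism.
\<close>

definition local_cohomology ::
  "'r ring \<Rightarrow> 'r set \<Rightarrow> (nat \<Rightarrow> ('r, 'e) module) \<Rightarrow> (nat \<Rightarrow> 'e \<Rightarrow> 'e) \<Rightarrow> nat \<Rightarrow> ('r, 'e set) module"
  where "local_cohomology R Q E d i =
    quotient_module
      ((E i)\<lparr>carrier := {x \<in> torsion_part R Q (E i). d i x = \<zero>\<^bsub>E (Suc i)\<^esub>}\<rparr>)
      (case i of 0 \<Rightarrow> {\<zero>\<^bsub>E 0\<^esub>} | Suc j \<Rightarrow> d j ` torsion_part R Q (E j))"


section \<open>The standard bigraded polynomial ring\<close>

text \<open>
  Variables are indexed by \<^typ>\<open>nat + nat\<close>: \<open>Inl i\<close> (\<open>i < m\<close>) stands for \<open>x\<^sub>i\<^sub>+\<^sub>1\<close> and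
  \<open>Inr j\<close> (\<open>j < n\<close>) for \<open>y\<^sub>j\<^sub>+\<^sub>1\<close>. Monomials are finitely supported exponent
  functions, polynomials are finitely supported coefficient functions on monomials.
\<close>

type_synonym bimonom = "(nat + nat) \<Rightarrow>\<^sub>0 nat"
type_synonym 'k bipoly = "bimonom \<Rightarrow>\<^sub>0 'k"

definition bipoly_ring :: "nat \<Rightarrow> nat \<Rightarrow> 'k::field bipoly ring"
  where "bipoly_ring m n =
    \<lparr>carrier = {p. \<forall>\<mu>\<in>Poly_Mapping.keys p. Poly_Mapping.keys \<mu> \<subseteq> Inl ` {..<m} \<union> Inr ` {..<n}},
     mult = (*), one = 1, zero = 0, add = (+)\<rparr>"

definition var_y :: "nat \<Rightarrow> 'k::field bipoly"
  where "var_y j = Poly_Mapping.single (Poly_Mapping.single (Inr j) 1) 1"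

definition bidegree :: "nat \<Rightarrow> nat \<Rightarrow> bimonom \<Rightarrow> nat \<times> nat"
  where "bidegree m n \<mu> =
    (\<Sum>i<m. Poly_Mapping.lookup \<mu> (Inl i), \<Sum>j<n. Poly_Mapping.lookup \<mu> (Inr j))"

text \<open>A form is nonzero, so that its bidegree is determined.\<close>

definition bihomogeneous_form :: "nat \<Rightarrow> nat \<Rightarrow> nat \<times> nat \<Rightarrow> 'k::field bipoly \<Rightarrow> bool"
  where "bihomogeneous_form m n ab f \<longleftrightarrow>
    f \<in> carrier (bipoly_ring m n) \<and> f \<noteq> 0 \<and> (\<forall>\<mu>\<in>Poly_Mapping.keys f. bidegree m n \<mu> = ab)"

definition ideal_y :: "nat \<Rightarrow> nat \<Rightarrow> 'k::field bipoly set"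
  where "ideal_y m n = Idl\<^bsub>bipoly_ring m n\<^esub> (var_y ` {..<n})"

text \<open>
  \<open>S/fS\<close> as an \<open>S\<close>-module. If \<open>f\<close> has bidegree \<open>(a, 0)\<close>, it lies in \<open>K[x]\<close>, the \<open>y\<^sub>j\<close> act
  regularly on \<open>S/fS\<close>, and \<open>H\<^sup>n\<^sup>-\<^sup>1\<^sub>Q(S/fS) = 0\<close> for every \<open>m\<close>; a criterion in terms of this
  module therefore has to assume positive \<open>y\<close>-degree.
\<close>

definition hypersurface_module ::
  "nat \<Rightarrow> nat \<Rightarrow> 'k::field bipoly \<Rightarrow> ('k bipoly, 'k bipoly set) module"
  where "hypersurface_module m n f =
    quotient_module (regular_module (bipoly_ring m n)) (PIdl\<^bsub>bipoly_ring m n\<^esub> f)"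

end

theory Submission
  imports Defs
begin

text \<open>
  Multiplication by \<open>f\<close> gives the exact sequence \<open>0 \<rightarrow> S \<rightarrow> S \<rightarrow> R \<rightarrow> 0\<close>, and \<open>H\<^sup>i\<^sub>Q(S)\<close> vanishes
  unless \<open>i = n\<close>, so that \<open>H\<^sup>n\<^sup>-\<^sup>1\<^sub>Q(R)\<close> is the kernel of \<open>f\<close> on \<open>H\<^sup>n\<^sub>Q(S)\<close>, the module of inverse
  polynomials in \<open>y\<close> with coefficients in \<open>K[x]\<close>. Every form of positive \<open>y\<close>-degree kills the
  generator \<open>(y\<^sub>1 \<cdots> y\<^sub>n)\<^sup>-\<^sup>1\<close>, whose annihilator is \<open>Q\<close>; hence \<open>H\<^sup>n\<^sup>-\<^sup>1\<^sub>Q(R)\<close> contains a copy of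
  \<open>S/Q = K[x]\<close> and is not Artinian if \<open>m > 0\<close>. If \<open>m = 0\<close>, that generator spans the socle, and a
  \<open>Q\<close>-torsion module over \<open>K[y]\<close> with a socle of finite dimension is Artinian, by induction on the
  number of variables (\<open>artinian_if_torsion_and_kernel_artinian\<close>).

  Only a resolution \<open>E\<close> of \<open>R\<close> is given, none of \<open>S\<close>, so the long exact sequence is replaced by a
  direct comparison of \<open>E\<close> with the complex \<open>f : S \<rightarrow> S\<close>. For the ideal
  \<open>I = (y\<^sub>1\<^sup>k, \<dots>, y\<^sub>p\<^sup>k)\<close> let \<open>C\<close> be the subcomplex of \<open>E\<close> of the elements killed by \<open>I\<close>. It is
  quasi-isomorphic to \<open>f : S/I \<rightarrow> S/I\<close>, placed in the degrees \<open>p - 1\<close> and \<open>p\<close>, and a map from that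
  complex to \<open>C\<close> is nothing but a pair of elements \<open>u\<close>, \<open>v\<close> with \<open>d u = f v\<close> and \<open>d v = 0\<close>
  (\<open>two_term_model\<close>). The pair is built by induction on \<open>p\<close>: the next power \<open>y\<^sup>k\<close> acts
  surjectively on \<open>C\<close> because the modules of \<open>E\<close> are injective and \<open>y\<^sup>k\<close> is regular modulo \<open>I\<close>
  (\<open>injective_module_divide\<close>), and a diagram chase along
  \<open>0 \<rightarrow> C' \<rightarrow> C \<rightarrow> C \<rightarrow> 0\<close> moves the pair one degree up (\<open>two_term_model_step\<close>).

  For \<open>p = n\<close> this describes the classes of the cocycles that are killed by all \<open>y\<^sub>j\<^sup>k\<close>: they are
  the classes of \<open>g u\<close> with \<open>g f \<in> I\<close>. Lemma \<open>coboundary_imp_mem\<close> compares different exponents \<open>k\<close>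
  and shows that such a \<open>g u\<close> is a coboundary in \<open>\<Gamma>\<^sub>Q(E)\<close> only if \<open>g \<in> I\<close>. Both directions of the theorem
  (\<open>not_artinian_H\<close>, \<open>artinian_H\<close>) are then statements about monomials.
\<close>

section \<open>Homomorphisms, submodules and quotients\<close>

lemma mod_hom_closed:
  "h \<in> mod_hom R M N \<Longrightarrow> x \<in> carrier M \<Longrightarrow> h x \<in> carrier N"
  by (auto simp: mod_hom_def hom_def)

lemma mod_hom_add:
  "h \<in> mod_hom R M N \<Longrightarrow> x \<in> carrier M \<Longrightarrow> y \<in> carrier M \<Longrightarrow> h (x \<oplus>\<^bsub>M\<^esub> y) = h x \<oplus>\<^bsub>N\<^esub> h y"
  by (auto simp: mod_hom_def hom_def)

lemma mod_hom_smult: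
  "h \<in> mod_hom R M N \<Longrightarrow> r \<in> carrier R \<Longrightarrow> x \<in> carrier M \<Longrightarrow> h (r \<odot>\<^bsub>M\<^esub> x) = r \<odot>\<^bsub>N\<^esub> h x"
  by (auto simp: mod_hom_def)

lemma mod_hom_zero:
  assumes "module R M" "module R N" "h \<in> mod_hom R M N"
  shows "h \<zero>\<^bsub>M\<^esub> = \<zero>\<^bsub>N\<^esub>"
proof -
  interpret M: module R M by fact
  interpret N: module R N by fact
  have "h (\<zero>\<^bsub>R\<^esub> \<odot>\<^bsub>M\<^esub> \<zero>\<^bsub>M\<^esub>) = \<zero>\<^bsub>R\<^esub> \<odot>\<^bsub>N\<^esub> h \<zero>\<^bsub>M\<^esub>"
    by (rule mod_hom_smult[OF assms(3)]) auto
  then show ?thesis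
    using mod_hom_closed[OF assms(3)] by simp
qed

lemma mod_homI:
  assumes "\<And>x. x \<in> carrier M \<Longrightarrow> h x \<in> carrier N"
    and "\<And>x y. x \<in> carrier M \<Longrightarrow> y \<in> carrier M \<Longrightarrow> h (x \<oplus>\<^bsub>M\<^esub> y) = h x \<oplus>\<^bsub>N\<^esub> h y"
    and "\<And>r x. r \<in> carrier R \<Longrightarrow> x \<in> carrier M \<Longrightarrow> h (r \<odot>\<^bsub>M\<^esub> x) = r \<odot>\<^bsub>N\<^esub> h x"
  shows "h \<in> mod_hom R M N"
  using assms by (auto simp: mod_hom_def hom_def)

definition annihilated :: "'r \<Rightarrow> ('r, 'a) module \<Rightarrow> ('r, 'a) module"
  where "annihilated a M = M\<lparr>carrier := {x \<in> carrier M. a \<odot>\<^bsub>M\<^esub> x = \<zero>\<^bsub>M\<^esub>}\<rparr>"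

lemma annihilated_simps [simp]:
  "carrier (annihilated a M) = {x \<in> carrier M. a \<odot>\<^bsub>M\<^esub> x = \<zero>\<^bsub>M\<^esub>}"
  "add (annihilated a M) = add M" "zero (annihilated a M) = zero M" "smult (annihilated a M) = smult M"
  by (simp_all add: annihilated_def)

context module
begin

lemma submodule_criterion:
  assumes "H \<subseteq> carrier M" "\<zero>\<^bsub>M\<^esub> \<in> H"
    and "\<And>x y. x \<in> H \<Longrightarrow> y \<in> H \<Longrightarrow> x \<oplus>\<^bsub>M\<^esub> y \<in> H"
    and "\<And>r x. r \<in> carrier R \<Longrightarrow> x \<in> H \<Longrightarrow> r \<odot>\<^bsub>M\<^esub> x \<in> H"
  shows "submodule H R M"
proof (rule submoduleI)
  fix a assume a: "a \<in> H"
  have "\<ominus>\<^bsub>M\<^esub> a = (\<ominus> \<one>) \<odot>\<^bsub>M\<^esub> a"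
    using a assms(1) by (subst smult_l_minus) auto
  then show "\<ominus>\<^bsub>M\<^esub> a \<in> H" using assms(4) a by simp
qed (use assms in auto)

lemma submodule_diff:
  assumes "submodule H R M" "x \<in> H" "y \<in> H"
  shows "x \<ominus>\<^bsub>M\<^esub> y \<in> H"
  using submoduleE[OF assms(1)] assms(2,3) by (simp add: a_minus_def)

lemma add_diff_cancel:
  assumes "x \<in> carrier M" "y \<in> carrier M"
  shows "(x \<oplus>\<^bsub>M\<^esub> y) \<ominus>\<^bsub>M\<^esub> x = y"
  using assms by (simp add: a_minus_def M.a_comm[of x y] M.a_assoc M.r_neg)

lemma smult_r_diff:
  assumes "r \<in> carrier R" "x \<in> carrier M" "y \<in> carrier M"
  shows "r \<odot>\<^bsub>M\<^esub> (x \<ominus>\<^bsub>M\<^esub> y) = r \<odot>\<^bsub>M\<^esub> x \<ominus>\<^bsub>M\<^esub> r \<odot>\<^bsub>M\<^esub> y"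
  using assms by (simp add: a_minus_def smult_r_distr smult_r_minus)

text \<open>
  Solutions of \<open>r x = c\<close> differ by an element that \<open>r\<close> kills. In this additive form the chases
  below hardly need subtraction.
\<close>

lemma smult_eq_smultE:
  assumes "r \<in> carrier R" "x \<in> carrier M" "y \<in> carrier M" "r \<odot>\<^bsub>M\<^esub> x = r \<odot>\<^bsub>M\<^esub> y"
  obtains c where "c \<in> carrier M" "r \<odot>\<^bsub>M\<^esub> c = \<zero>\<^bsub>M\<^esub>" "x = y \<oplus>\<^bsub>M\<^esub> c"
proof
  show "x \<ominus>\<^bsub>M\<^esub> y \<in> carrier M" using assms by simp
  show "r \<odot>\<^bsub>M\<^esub> (x \<ominus>\<^bsub>M\<^esub> y) = \<zero>\<^bsub>M\<^esub>"
    using assms by (simp add: smult_r_diff) (simp add: a_minus_def M.r_neg)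
  show "x = y \<oplus>\<^bsub>M\<^esub> (x \<ominus>\<^bsub>M\<^esub> y)"
    using assms by (simp add: a_minus_def M.a_lcomm M.r_neg)
qed

lemma submodule_kernel_smult:
  assumes "\<And>a. a \<in> A \<Longrightarrow> a \<in> carrier R"
  shows "submodule {x \<in> carrier M. \<forall>a\<in>A. a \<odot>\<^bsub>M\<^esub> x = \<zero>\<^bsub>M\<^esub>} R M"
proof (rule submodule_criterion)
  fix r x assume r: "r \<in> carrier R" and x: "x \<in> {x \<in> carrier M. \<forall>a\<in>A. a \<odot>\<^bsub>M\<^esub> x = \<zero>\<^bsub>M\<^esub>}"
  have "a \<odot>\<^bsub>M\<^esub> (r \<odot>\<^bsub>M\<^esub> x) = r \<odot>\<^bsub>M\<^esub> (a \<odot>\<^bsub>M\<^esub> x)" if "a \<in> A" for a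
    using that assms r x by (metis (no_types, lifting) R.m_comm mem_Collect_eq smult_assoc1)
  then show "r \<odot>\<^bsub>M\<^esub> x \<in> {x \<in> carrier M. \<forall>a\<in>A. a \<odot>\<^bsub>M\<^esub> x = \<zero>\<^bsub>M\<^esub>}"
    using r x by auto
qed (use assms in \<open>auto simp: smult_r_distr\<close>)

lemma abelian_subgroup_submodule:
  assumes "submodule N R M"
  shows "abelian_subgroup N M"
  using assms M.abelian_group_axioms
  by (intro abelian_subgroupI3) (auto simp: additive_subgroup_def submodule_def)

end

context
  fixes R :: "'r ring" and M :: "('r, 'a) module" and N :: "'a set"
  assumes mod: "module R M" and sub: "submodule N R M"
begin

interpretation M: module R M by (rule mod)
interpretation N: abelian_subgroup N M by (rule M.abelian_subgroup_submodule[OF sub])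

lemma carrier_quotient: "carrier (quotient_module M N) = (\<lambda>x. N +>\<^bsub>M\<^esub> x) ` carrier M"
  by (auto simp: quotient_module_def A_RCOSETS_def')

lemma zero_quotient: "\<zero>\<^bsub>quotient_module M N\<^esub> = N"
  by (simp add: quotient_module_def)

lemma quotient_add:
  assumes "x \<in> carrier M" "y \<in> carrier M"
  shows "(N +>\<^bsub>M\<^esub> x) \<oplus>\<^bsub>quotient_module M N\<^esub> (N +>\<^bsub>M\<^esub> y) = N +>\<^bsub>M\<^esub> (x \<oplus>\<^bsub>M\<^esub> y)"
  using N.a_rcos_sum assms by (simp add: quotient_module_def)

lemma quotient_eq_iff:
  assumes "x \<in> carrier M" "y \<in> carrier M"
  shows "N +>\<^bsub>M\<^esub> x = N +>\<^bsub>M\<^esub> y \<longleftrightarrow> x \<ominus>\<^bsub>M\<^esub> y \<in> N"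
proof -
  have "x \<ominus>\<^bsub>M\<^esub> y \<in> N \<longleftrightarrow> x \<in> N +>\<^bsub>M\<^esub> y"
    using N.a_rcos_module[of y x] assms by (simp add: a_minus_def)
  also have "\<dots> \<longleftrightarrow> N +>\<^bsub>M\<^esub> x = N +>\<^bsub>M\<^esub> y"
    using N.a_repr_independence'[of x y] N.a_repr_independenceD[of x y] assms by metis
  finally show ?thesis by simp
qed

lemma quotient_eq_zero_iff:
  assumes "x \<in> carrier M"
  shows "N +>\<^bsub>M\<^esub> x = N \<longleftrightarrow> x \<in> N"
  using N.a_rcos_self[OF assms] N.a_rcos_const by auto

text \<open>
  The scalar multiplication of the quotient collects the cosets of all \<open>r y\<close> with \<open>y\<close> in the given
  coset; these cosets coincide, so that the union is a single one.
\<close>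

lemma quotient_smult:
  assumes "r \<in> carrier R" "x \<in> carrier M"
  shows "r \<odot>\<^bsub>quotient_module M N\<^esub> (N +>\<^bsub>M\<^esub> x) = N +>\<^bsub>M\<^esub> (r \<odot>\<^bsub>M\<^esub> x)"
proof -
  have "N +>\<^bsub>M\<^esub> (r \<odot>\<^bsub>M\<^esub> y) = N +>\<^bsub>M\<^esub> (r \<odot>\<^bsub>M\<^esub> x)" if "y \<in> N +>\<^bsub>M\<^esub> x" for y
  proof -
    have y: "y \<in> carrier M" using that assms(2) N.a_elemrcos_carrier by blast
    have "N +>\<^bsub>M\<^esub> y = N +>\<^bsub>M\<^esub> x" using that assms(2) N.a_repr_independence' by metis
    then have "r \<odot>\<^bsub>M\<^esub> (y \<ominus>\<^bsub>M\<^esub> x) \<in> N"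
      using quotient_eq_iff[OF y assms(2)] submodule.smult_closed[OF sub assms(1)] by simp
    then show ?thesis
      using assms y by (simp add: quotient_eq_iff M.smult_r_diff)
  qed
  moreover have "x \<in> N +>\<^bsub>M\<^esub> x" using assms(2) by (rule N.a_rcos_self)
  ultimately have "(\<Union>y\<in>N +>\<^bsub>M\<^esub> x. N +>\<^bsub>M\<^esub> (r \<odot>\<^bsub>M\<^esub> y)) = N +>\<^bsub>M\<^esub> (r \<odot>\<^bsub>M\<^esub> x)"
    by blast
  then show ?thesis
    by (simp add: quotient_module_def)
qed

lemma module_quotient: "module R (quotient_module M N)"
proof (rule moduleI)
  show "abelian_group (quotient_module M N)"
  proof (rule abelian_groupI)
    have N: "N = N +>\<^bsub>M\<^esub> \<zero>\<^bsub>M\<^esub>" using quotient_eq_zero_iff[of "\<zero>\<^bsub>M\<^esub>"] by simp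
    then show "\<zero>\<^bsub>quotient_module M N\<^esub> \<in> carrier (quotient_module M N)"
      by (auto simp: carrier_quotient zero_quotient)
    fix X assume "X \<in> carrier (quotient_module M N)"
    then obtain x where x: "x \<in> carrier M" "X = N +>\<^bsub>M\<^esub> x" by (auto simp: carrier_quotient)
    show "\<exists>Y\<in>carrier (quotient_module M N). Y \<oplus>\<^bsub>quotient_module M N\<^esub> X = \<zero>\<^bsub>quotient_module M N\<^esub>"
      using x by (intro bexI[of _ "N +>\<^bsub>M\<^esub> (\<ominus>\<^bsub>M\<^esub> x)"])
        (auto simp: carrier_quotient quotient_add zero_quotient M.l_neg quotient_eq_zero_iff)
    show "\<zero>\<^bsub>quotient_module M N\<^esub> \<oplus>\<^bsub>quotient_module M N\<^esub> X = X"
      using x N quotient_add[of "\<zero>\<^bsub>M\<^esub>" x] by (simp add: zero_quotient)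
    fix Y assume "Y \<in> carrier (quotient_module M N)"
    then obtain y where y: "y \<in> carrier M" "Y = N +>\<^bsub>M\<^esub> y" by (auto simp: carrier_quotient)
    show "X \<oplus>\<^bsub>quotient_module M N\<^esub> Y \<in> carrier (quotient_module M N)"
      using x y by (auto simp: carrier_quotient quotient_add)
    show "X \<oplus>\<^bsub>quotient_module M N\<^esub> Y = Y \<oplus>\<^bsub>quotient_module M N\<^esub> X"
      using x y by (simp add: quotient_add M.a_comm)
    fix Z assume "Z \<in> carrier (quotient_module M N)"
    then obtain z where z: "z \<in> carrier M" "Z = N +>\<^bsub>M\<^esub> z" by (auto simp: carrier_quotient)
    show "X \<oplus>\<^bsub>quotient_module M N\<^esub> Y \<oplus>\<^bsub>quotient_module M N\<^esub> Z
        = X \<oplus>\<^bsub>quotient_module M N\<^esub> (Y \<oplus>\<^bsub>quotient_module M N\<^esub> Z)"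
      using x y z by (simp add: quotient_add M.a_assoc)
  qed
  show "cring R" by (rule M.R.is_cring)
next
  fix r X assume r: "r \<in> carrier R" and "X \<in> carrier (quotient_module M N)"
  then obtain x where x: "x \<in> carrier M" "X = N +>\<^bsub>M\<^esub> x" by (auto simp: carrier_quotient)
  show "r \<odot>\<^bsub>quotient_module M N\<^esub> X \<in> carrier (quotient_module M N)"
    using r x by (auto simp: carrier_quotient quotient_smult)
  fix s assume s: "s \<in> carrier R"
  show "(r \<oplus>\<^bsub>R\<^esub> s) \<odot>\<^bsub>quotient_module M N\<^esub> X =
      r \<odot>\<^bsub>quotient_module M N\<^esub> X \<oplus>\<^bsub>quotient_module M N\<^esub> s \<odot>\<^bsub>quotient_module M N\<^esub> X"
    using r s x by (simp add: quotient_smult quotient_add M.smult_l_distr)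
  show "(r \<otimes>\<^bsub>R\<^esub> s) \<odot>\<^bsub>quotient_module M N\<^esub> X =
      r \<odot>\<^bsub>quotient_module M N\<^esub> (s \<odot>\<^bsub>quotient_module M N\<^esub> X)"
    using r s x by (simp add: quotient_smult M.smult_assoc1)
next
  fix r X Y assume r: "r \<in> carrier R"
    and "X \<in> carrier (quotient_module M N)" "Y \<in> carrier (quotient_module M N)"
  then obtain x y where x: "x \<in> carrier M" "X = N +>\<^bsub>M\<^esub> x" and y: "y \<in> carrier M" "Y = N +>\<^bsub>M\<^esub> y"
    by (auto simp: carrier_quotient)
  show "r \<odot>\<^bsub>quotient_module M N\<^esub> (X \<oplus>\<^bsub>quotient_module M N\<^esub> Y) =
      r \<odot>\<^bsub>quotient_module M N\<^esub> X \<oplus>\<^bsub>quotient_module M N\<^esub> r \<odot>\<^bsub>quotient_module M N\<^esub> Y"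
    using r x y by (simp add: quotient_smult quotient_add M.smult_r_distr)
next
  fix X assume "X \<in> carrier (quotient_module M N)"
  then show "\<one>\<^bsub>R\<^esub> \<odot>\<^bsub>quotient_module M N\<^esub> X = X"
    by (auto simp: carrier_quotient quotient_smult)
qed

end

section \<open>Artinian modules\<close>

lemma (in module) submodule_restrict_iff:
  assumes "submodule W R M"
  shows "submodule N R (M\<lparr>carrier := W\<rparr>) \<longleftrightarrow> submodule N R M \<and> N \<subseteq> W"
proof -
  interpret W: module R "M\<lparr>carrier := W\<rparr>"
    by (rule submodule.submodule_is_module[OF assms module_axioms])
  have W: "W \<subseteq> carrier M" using submoduleE[OF assms] by simp
  show ?thesis
  proof
    assume N: "submodule N R (M\<lparr>carrier := W\<rparr>)"
    note E = W.submoduleE[OF N]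
    have "\<zero>\<^bsub>M\<^esub> \<in> N" using subgroup.one_closed[OF submodule.axioms(1)[OF N]] by simp
    then show "submodule N R M \<and> N \<subseteq> W"
      using E W by (auto intro!: submodule_criterion)
  next
    assume N: "submodule N R M \<and> N \<subseteq> W"
    note E = submoduleE[OF conjunct1[OF N]]
    have "\<zero>\<^bsub>M\<^esub> \<in> N" using subgroup.one_closed[OF submodule.axioms(1)[OF conjunct1[OF N]]] by simp
    then show "submodule N R (M\<lparr>carrier := W\<rparr>)"
      using E N by (auto intro!: W.submodule_criterion)
  qed
qed

text \<open>
  This is dual to Hilbert's basis theorem. A submodule \<open>N\<close> is measured by the submodules
  \<open>G j = {y\<^sup>j x | x \<in> N, y\<^sup>j\<^sup>+\<^sup>1 x = 0}\<close> of the kernel of \<open>y\<close>, the analogues of the ideals of leading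
  coefficients. They decrease with \<open>j\<close>, and nested submodules with equal \<open>G j\<close> for all \<open>j\<close> are
  equal, since every element is killed by a power of \<open>y\<close>. For a descending chain of submodules the
  doubly indexed family \<open>G j i\<close> stabilises: first along the diagonal, and then for each of the
  finitely many smaller \<open>j\<close>.
\<close>

lemma artinian_if_torsion_and_kernel_artinian:
  fixes R :: "'r ring" and M :: "('r, 'a) module"
  assumes mod: "module R M" and y: "y \<in> carrier R"
    and tors: "\<And>x. x \<in> carrier M \<Longrightarrow> \<exists>k::nat. (y [^]\<^bsub>R\<^esub> k) \<odot>\<^bsub>M\<^esub> x = \<zero>\<^bsub>M\<^esub>"
    and ker: "artinian_module R (annihilated y M)"
  shows "artinian_module R M"
  unfolding artinian_module_def
proof (intro conjI allI impI)
  show "module R M" by (rule mod)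
  interpret M: module R M by (rule mod)
  fix N :: "nat \<Rightarrow> 'a set"
  assume "(\<forall>i. submodule (N i) R M) \<and> (\<forall>i. N (Suc i) \<subseteq> N i)"
  then have N: "\<forall>i. submodule (N i) R M" and dec: "\<forall>i. N (Suc i) \<subseteq> N i" by auto
  note E = M.submoduleE[OF spec[OF N]]
  define G where "G j i = {(y [^]\<^bsub>R\<^esub> j) \<odot>\<^bsub>M\<^esub> x | x. x \<in> N i \<and> (y [^]\<^bsub>R\<^esub> Suc j) \<odot>\<^bsub>M\<^esub> x = \<zero>\<^bsub>M\<^esub>}" for j i :: nat
  let ?W = "{x \<in> carrier M. y \<odot>\<^bsub>M\<^esub> x = \<zero>\<^bsub>M\<^esub>}"
  have yp: "y [^]\<^bsub>R\<^esub> j \<in> carrier R" for j :: nat using y by simp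
  have zN: "\<zero>\<^bsub>M\<^esub> \<in> N i" for i
    using subgroup.one_closed[OF submodule.axioms(1)[OF spec[OF N]]] by simp
  have W: "submodule ?W R M"
    using M.submodule_kernel_smult[of "{y}"] y by simp
  have pow_Suc: "(y [^]\<^bsub>R\<^esub> Suc j) \<odot>\<^bsub>M\<^esub> x = y \<odot>\<^bsub>M\<^esub> ((y [^]\<^bsub>R\<^esub> j) \<odot>\<^bsub>M\<^esub> x)"
    "(y [^]\<^bsub>R\<^esub> Suc j) \<odot>\<^bsub>M\<^esub> x = (y [^]\<^bsub>R\<^esub> j) \<odot>\<^bsub>M\<^esub> (y \<odot>\<^bsub>M\<^esub> x)" if "x \<in> carrier M" for j :: nat and x
    using that y by (simp_all add: M.smult_assoc1[symmetric] M.R.m_comm)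
  have sub: "submodule (G j i) R (M\<lparr>carrier := ?W\<rparr>)" for j i
  proof -
    have "submodule (G j i) R M"
    proof (rule M.submodule_criterion)
      show "G j i \<subseteq> carrier M"
        unfolding G_def using subsetD[OF E(1)] yp M.smult_closed by blast
      show "\<zero>\<^bsub>M\<^esub> \<in> G j i" unfolding G_def using zN yp y by (auto intro!: exI[of _ "\<zero>\<^bsub>M\<^esub>"])
    next
      fix u v assume "u \<in> G j i" "v \<in> G j i"
      then obtain x x' where x: "x \<in> N i" "(y [^]\<^bsub>R\<^esub> Suc j) \<odot>\<^bsub>M\<^esub> x = \<zero>\<^bsub>M\<^esub>" "u = (y [^]\<^bsub>R\<^esub> j) \<odot>\<^bsub>M\<^esub> x"
        "x' \<in> N i" "(y [^]\<^bsub>R\<^esub> Suc j) \<odot>\<^bsub>M\<^esub> x' = \<zero>\<^bsub>M\<^esub>" "v = (y [^]\<^bsub>R\<^esub> j) \<odot>\<^bsub>M\<^esub> x'"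
        by (auto simp: G_def)
      then have c: "x \<in> carrier M" "x' \<in> carrier M" using E by auto
      have "(y [^]\<^bsub>R\<^esub> Suc j) \<odot>\<^bsub>M\<^esub> (x \<oplus>\<^bsub>M\<^esub> x') = \<zero>\<^bsub>M\<^esub>"
        using x c yp[of "Suc j"] M.smult_r_distr by (metis M.M.l_zero M.M.zero_closed)
      then show "u \<oplus>\<^bsub>M\<^esub> v \<in> G j i"
        unfolding G_def using x c yp E(5) M.smult_r_distr
        by (intro CollectI exI[of _ "x \<oplus>\<^bsub>M\<^esub> x'"]) auto
    next
      fix r u assume r: "r \<in> carrier R" and "u \<in> G j i"
      then obtain x where x: "x \<in> N i" "(y [^]\<^bsub>R\<^esub> Suc j) \<odot>\<^bsub>M\<^esub> x = \<zero>\<^bsub>M\<^esub>" "u = (y [^]\<^bsub>R\<^esub> j) \<odot>\<^bsub>M\<^esub> x"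
        by (auto simp: G_def)
      then have c: "x \<in> carrier M" using E by auto
      have comm: "s \<odot>\<^bsub>M\<^esub> (r \<odot>\<^bsub>M\<^esub> x) = r \<odot>\<^bsub>M\<^esub> (s \<odot>\<^bsub>M\<^esub> x)" if "s \<in> carrier R" for s
        using that r c by (metis M.R.m_comm M.smult_assoc1)
      show "r \<odot>\<^bsub>M\<^esub> u \<in> G j i"
        unfolding G_def
      proof (intro CollectI exI[of _ "r \<odot>\<^bsub>M\<^esub> x"] conjI)
        show "r \<odot>\<^bsub>M\<^esub> u = (y [^]\<^bsub>R\<^esub> j) \<odot>\<^bsub>M\<^esub> (r \<odot>\<^bsub>M\<^esub> x)" using comm[OF yp] x(3) by simp
        show "r \<odot>\<^bsub>M\<^esub> x \<in> N i" using E(4) r x(1) .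
        show "(y [^]\<^bsub>R\<^esub> Suc j) \<odot>\<^bsub>M\<^esub> (r \<odot>\<^bsub>M\<^esub> x) = \<zero>\<^bsub>M\<^esub>"
          unfolding comm[OF yp] x(2) using r by simp
      qed
    qed
    moreover have "G j i \<subseteq> ?W"
    proof
      fix u assume "u \<in> G j i"
      then obtain x where x: "x \<in> N i" "(y [^]\<^bsub>R\<^esub> Suc j) \<odot>\<^bsub>M\<^esub> x = \<zero>\<^bsub>M\<^esub>" "u = (y [^]\<^bsub>R\<^esub> j) \<odot>\<^bsub>M\<^esub> x"
        unfolding G_def by blast
      have c: "x \<in> carrier M" using E(1) x(1) by auto
      show "u \<in> ?W" using x(2)[unfolded pow_Suc(1)[OF c]] yp x(3) c by simp
    qed
    ultimately show ?thesis by (simp add: M.submodule_restrict_iff[OF W])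
  qed
  have Nle: "N i' \<subseteq> N i" if "i \<le> i'" for i i'
    using lift_Suc_antimono_le[of N i i'] dec that by blast
  have Gi: "G j i' \<subseteq> G j i" if "i \<le> i'" for i i' j
    using Nle[OF that] by (auto simp: G_def)
  have Gj1: "G (Suc j) i \<subseteq> G j i" for i j
  proof
    fix u assume "u \<in> G (Suc j) i"
    then obtain x where x: "x \<in> N i" "(y [^]\<^bsub>R\<^esub> Suc (Suc j)) \<odot>\<^bsub>M\<^esub> x = \<zero>\<^bsub>M\<^esub>" "u = (y [^]\<^bsub>R\<^esub> Suc j) \<odot>\<^bsub>M\<^esub> x"
      unfolding G_def by blast
    have c: "x \<in> carrier M" using E x by auto
    show "u \<in> G j i"
      unfolding G_def using x(1) x(2,3)[unfolded pow_Suc(2)[OF c]] E(4) y c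
      by (intro CollectI exI[of _ "y \<odot>\<^bsub>M\<^esub> x"]) auto
  qed
  have Gj: "G j' i \<subseteq> G j i" if "j \<le> j'" for i j j'
    using lift_Suc_antimono_le[of "\<lambda>j. G j i" j j'] Gj1 that by blast
  have stab: "\<exists>k. \<forall>i\<ge>k. F i = F k"
    if "\<And>i. submodule (F i) R (M\<lparr>carrier := ?W\<rparr>)" "\<And>i. F (Suc i) \<subseteq> F i" for F :: "nat \<Rightarrow> 'a set"
    using ker that unfolding artinian_module_def annihilated_def by blast
  have "\<exists>k. \<forall>i\<ge>k. G i i = G k k"
    using Gi Gj sub by (intro stab) (meson le_SucI order_refl subset_trans)+
  then obtain k0 where k0: "\<And>i. i \<ge> k0 \<Longrightarrow> G i i = G k0 k0" by blast
  have "\<forall>j. \<exists>k. \<forall>i\<ge>k. G j i = G j k"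
    using Gi sub by (intro allI stab) auto
  then obtain \<kappa> where \<kappa>: "\<And>j i. i \<ge> \<kappa> j \<Longrightarrow> G j i = G j (\<kappa> j)" by metis
  define k where "k = Max (insert k0 (\<kappa> ` {..<k0}))"
  have k: "k0 \<le> k" "\<And>j. j < k0 \<Longrightarrow> \<kappa> j \<le> k"
    by (auto simp: k_def)
  have Geq: "G j i = G j k" if "i \<ge> k" for i j
  proof (cases "j < k0")
    case True
    then show ?thesis using \<kappa>[of j i] \<kappa>[of j k] k(2)[of j] that by simp
  next
    case False
    have "G k0 k0 \<subseteq> G j i" "G j i \<subseteq> G k0 k0" if "k \<le> i" for i
      using k0[of "max i j"] Gi[of i "max i j" j] Gj[of j "max i j" "max i j"]
        Gi[of k0 i j] Gj[of k0 j k0] that k(1) False by auto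
    then show ?thesis using that by blast
  qed
  have "N k \<subseteq> N i" if "k \<le> i" for i
  proof -
    have "x \<in> N i" if "x \<in> N k" "(y [^]\<^bsub>R\<^esub> j) \<odot>\<^bsub>M\<^esub> x = \<zero>\<^bsub>M\<^esub>" for x and j :: nat
      using that
    proof (induction j arbitrary: x)
      case 0
      then have "x = \<zero>\<^bsub>M\<^esub>" using subsetD[OF E(1)] by simp
      then show ?case using zN by simp
    next
      case (Suc j)
      have "(y [^]\<^bsub>R\<^esub> j) \<odot>\<^bsub>M\<^esub> x \<in> G j k"
        unfolding G_def using Suc.prems by blast
      then have "(y [^]\<^bsub>R\<^esub> j) \<odot>\<^bsub>M\<^esub> x \<in> G j i"
        using Geq[OF \<open>k \<le> i\<close>] by simp
      then obtain x' where x': "x' \<in> N i" "(y [^]\<^bsub>R\<^esub> j) \<odot>\<^bsub>M\<^esub> x = (y [^]\<^bsub>R\<^esub> j) \<odot>\<^bsub>M\<^esub> x'"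
        unfolding G_def by blast
      have c: "x \<in> carrier M" "x' \<in> carrier M" "x' \<in> N k"
        using Suc.prems(1) x'(1) E(1) Nle[OF \<open>k \<le> i\<close>] by auto
      have "(y [^]\<^bsub>R\<^esub> j) \<odot>\<^bsub>M\<^esub> (x \<ominus>\<^bsub>M\<^esub> x') = \<zero>\<^bsub>M\<^esub>"
        using c yp x'(2) by (simp add: M.smult_r_diff) (simp add: a_minus_def M.M.r_neg)
      then have "x \<ominus>\<^bsub>M\<^esub> x' \<in> N i"
        using Suc.IH M.submodule_diff[OF spec[OF N] Suc.prems(1) c(3)] by blast
      then have "(x \<ominus>\<^bsub>M\<^esub> x') \<oplus>\<^bsub>M\<^esub> x' \<in> N i" using x'(1) E(5) by blast
      then show ?case using c by (simp add: a_minus_def M.M.a_assoc M.M.l_neg)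
    qed
    then show ?thesis using tors E(1) by blast
  qed
  then show "\<exists>k. \<forall>i\<ge>k. N i = N k" using Nle by blast
qed

section \<open>Division in injective modules\<close>

lemma regular_module_simps [simp]:
  "carrier (regular_module R) = carrier R" "add (regular_module R) = add R"
  "zero (regular_module R) = zero R" "smult (regular_module R) = mult R"
  by (simp_all add: regular_module_def ring.extend_def)

lemma module_regular:
  fixes R :: "'r ring" (structure)
  assumes "cring R"
  shows "module R (regular_module R)"
proof (rule moduleI)
  interpret cring R by fact
  show "cring R" by (rule is_cring)
  show "abelian_group (regular_module R)"
    by (rule abelian_groupI) (auto simp: a_ac intro: bexI[of _ "\<ominus> x" for x] l_neg)
qed (simp_all add: cring.cring_simprules[OF assms] monoid.r_one[OF ring.is_monoid[OF cring.axioms(1)[OF assms]]])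

lemma submodule_ideal:
  fixes R :: "'r ring"
  assumes "cring R" "ideal I R"
  shows "submodule I R (regular_module R)"
proof -
  interpret I: ideal I R by fact
  interpret M: module R "regular_module R" by (rule module_regular) fact
  show ?thesis by (rule M.submodule_criterion) (auto simp: I.I_l_closed)
qed

text \<open>
  As \<open>a\<close> is regular modulo \<open>I\<close>, the map \<open>i + a s \<mapsto> s c\<close> is well defined on the ideal \<open>I + a R\<close>.
  The element \<open>c'\<close> is the value at \<open>1\<close> of an extension to \<open>R\<close>.
\<close>

lemma injective_module_divide:
  fixes R :: "'r ring" and E :: "('r, 'a) module"
  assumes inj: "injective_module R E" and I: "ideal I R" and a: "a \<in> carrier R"
    and reg: "\<And>s. s \<in> carrier R \<Longrightarrow> a \<otimes>\<^bsub>R\<^esub> s \<in> I \<Longrightarrow> s \<in> I"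
    and c: "c \<in> carrier E" and kill: "\<And>r. r \<in> I \<Longrightarrow> r \<odot>\<^bsub>E\<^esub> c = \<zero>\<^bsub>E\<^esub>"
  obtains c' where "c' \<in> carrier E" "a \<odot>\<^bsub>E\<^esub> c' = c" "\<And>r. r \<in> I \<Longrightarrow> r \<odot>\<^bsub>E\<^esub> c' = \<zero>\<^bsub>E\<^esub>"
proof -
  interpret E: module R E using inj by (simp add: injective_module_def)
  interpret I: ideal I R by fact
  let ?S = "regular_module R"
  interpret S: module R ?S by (rule module_regular[OF E.R.is_cring])
  define J where "J = {i \<oplus>\<^bsub>R\<^esub> a \<otimes>\<^bsub>R\<^esub> s | i s. i \<in> I \<and> s \<in> carrier R}"
  define g where "g q = (SOME e. \<exists>i s. i \<in> I \<and> s \<in> carrier R \<and> q = i \<oplus>\<^bsub>R\<^esub> a \<otimes>\<^bsub>R\<^esub> s \<and> e = s \<odot>\<^bsub>E\<^esub> c)" for q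
  have Jc: "J \<subseteq> carrier R" using a by (auto simp: J_def)
  have g: "g (i \<oplus>\<^bsub>R\<^esub> a \<otimes>\<^bsub>R\<^esub> s) = s \<odot>\<^bsub>E\<^esub> c" if "i \<in> I" "s \<in> carrier R" for i s
    unfolding g_def
  proof (rule some_equality)
    fix e assume "\<exists>i' s'. i' \<in> I \<and> s' \<in> carrier R \<and> i \<oplus>\<^bsub>R\<^esub> a \<otimes>\<^bsub>R\<^esub> s = i' \<oplus>\<^bsub>R\<^esub> a \<otimes>\<^bsub>R\<^esub> s' \<and> e = s' \<odot>\<^bsub>E\<^esub> c"
    then obtain i' s' where i': "i' \<in> I" "s' \<in> carrier R"
      and eq: "i \<oplus>\<^bsub>R\<^esub> a \<otimes>\<^bsub>R\<^esub> s = i' \<oplus>\<^bsub>R\<^esub> a \<otimes>\<^bsub>R\<^esub> s'" and e: "e = s' \<odot>\<^bsub>E\<^esub> c" by blast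
    have ic: "i \<in> carrier R" "i' \<in> carrier R" using that i' by auto
    have "a \<otimes>\<^bsub>R\<^esub> (s' \<ominus>\<^bsub>R\<^esub> s) = (i' \<oplus>\<^bsub>R\<^esub> a \<otimes>\<^bsub>R\<^esub> s') \<ominus>\<^bsub>R\<^esub> i' \<ominus>\<^bsub>R\<^esub> a \<otimes>\<^bsub>R\<^esub> s"
      using a that(2) i'(2) ic by algebra
    also have "\<dots> = i \<ominus>\<^bsub>R\<^esub> i'"
      unfolding eq[symmetric] using a that(2) i'(2) ic by algebra
    also have "\<dots> \<in> I" using that(1) i'(1) by (simp add: a_minus_def)
    finally have "s' \<ominus>\<^bsub>R\<^esub> s \<in> I" using reg that(2) i'(2) by simp
    then have "(s' \<ominus>\<^bsub>R\<^esub> s) \<odot>\<^bsub>E\<^esub> c = \<zero>\<^bsub>E\<^esub>" by (rule kill)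
    moreover have "s' = (s' \<ominus>\<^bsub>R\<^esub> s) \<oplus>\<^bsub>R\<^esub> s" using that(2) i'(2) by algebra
    ultimately show "e = s \<odot>\<^bsub>E\<^esub> c"
      unfolding e using c that(2) i'(2) E.smult_l_distr[of "s' \<ominus>\<^bsub>R\<^esub> s" s c] by simp
  qed (use that in blast)
  have "submodule J R ?S"
  proof (rule S.submodule_criterion)
    show "J \<subseteq> carrier ?S" using Jc by simp
    show "\<zero>\<^bsub>?S\<^esub> \<in> J"
      unfolding J_def using a by (intro CollectI exI[of _ "\<zero>\<^bsub>R\<^esub>"]) auto
  next
    fix p q assume "p \<in> J" "q \<in> J"
    then obtain i s i' s' where *: "i \<in> I" "s \<in> carrier R" "p = i \<oplus>\<^bsub>R\<^esub> a \<otimes>\<^bsub>R\<^esub> s"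
      "i' \<in> I" "s' \<in> carrier R" "q = i' \<oplus>\<^bsub>R\<^esub> a \<otimes>\<^bsub>R\<^esub> s'" unfolding J_def by blast
    have ic: "i \<in> carrier R" "i' \<in> carrier R" using * by auto
    have "p \<oplus>\<^bsub>R\<^esub> q = (i \<oplus>\<^bsub>R\<^esub> i') \<oplus>\<^bsub>R\<^esub> a \<otimes>\<^bsub>R\<^esub> (s \<oplus>\<^bsub>R\<^esub> s')"
      unfolding *(3,6) using ic a *(2,5) by algebra
    then show "p \<oplus>\<^bsub>?S\<^esub> q \<in> J" using * unfolding J_def by auto
  next
    fix r p assume r: "r \<in> carrier R" and "p \<in> J"
    then obtain i s where *: "i \<in> I" "s \<in> carrier R" "p = i \<oplus>\<^bsub>R\<^esub> a \<otimes>\<^bsub>R\<^esub> s"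
      unfolding J_def by blast
    have ic: "i \<in> carrier R" using * by auto
    have "r \<otimes>\<^bsub>R\<^esub> p = (r \<otimes>\<^bsub>R\<^esub> i) \<oplus>\<^bsub>R\<^esub> a \<otimes>\<^bsub>R\<^esub> (r \<otimes>\<^bsub>R\<^esub> s)"
      unfolding *(3) using ic a *(2) r by algebra
    moreover have "r \<otimes>\<^bsub>R\<^esub> i \<in> I" using *(1) r by (rule I.I_l_closed)
    ultimately show "r \<odot>\<^bsub>?S\<^esub> p \<in> J" using *(2) r unfolding J_def by auto
  qed
  then have modJ: "module R (?S\<lparr>carrier := J\<rparr>)"
    by (rule submodule.submodule_is_module[OF _ S.module_axioms])
  have "g \<in> mod_hom R (?S\<lparr>carrier := J\<rparr>) E"
  proof (rule mod_homI)
    fix q assume "q \<in> carrier (?S\<lparr>carrier := J\<rparr>)"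
    then show "g q \<in> carrier E" using g c by (auto simp: J_def)
  next
    fix p q assume "p \<in> carrier (?S\<lparr>carrier := J\<rparr>)" "q \<in> carrier (?S\<lparr>carrier := J\<rparr>)"
    then have "p \<in> J" "q \<in> J" by auto
    then obtain i s i' s' where *: "i \<in> I" "s \<in> carrier R" "p = i \<oplus>\<^bsub>R\<^esub> a \<otimes>\<^bsub>R\<^esub> s"
      "i' \<in> I" "s' \<in> carrier R" "q = i' \<oplus>\<^bsub>R\<^esub> a \<otimes>\<^bsub>R\<^esub> s'" unfolding J_def by blast
    have ic: "i \<in> carrier R" "i' \<in> carrier R" using * by auto
    have "p \<oplus>\<^bsub>R\<^esub> q = (i \<oplus>\<^bsub>R\<^esub> i') \<oplus>\<^bsub>R\<^esub> a \<otimes>\<^bsub>R\<^esub> (s \<oplus>\<^bsub>R\<^esub> s')"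
      unfolding *(3,6) using ic a *(2,5) by algebra
    then have "g (p \<oplus>\<^bsub>R\<^esub> q) = (s \<oplus>\<^bsub>R\<^esub> s') \<odot>\<^bsub>E\<^esub> c" using g * by simp
    then show "g (p \<oplus>\<^bsub>?S\<lparr>carrier := J\<rparr>\<^esub> q) = g p \<oplus>\<^bsub>E\<^esub> g q"
      using * c by (simp add: g E.smult_l_distr)
  next
    fix r p assume r: "r \<in> carrier R" and "p \<in> carrier (?S\<lparr>carrier := J\<rparr>)"
    then have "p \<in> J" by simp
    then obtain i s where *: "i \<in> I" "s \<in> carrier R" "p = i \<oplus>\<^bsub>R\<^esub> a \<otimes>\<^bsub>R\<^esub> s"
      unfolding J_def by blast
    have ic: "i \<in> carrier R" using * by auto
    have "r \<otimes>\<^bsub>R\<^esub> p = (r \<otimes>\<^bsub>R\<^esub> i) \<oplus>\<^bsub>R\<^esub> a \<otimes>\<^bsub>R\<^esub> (r \<otimes>\<^bsub>R\<^esub> s)"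
      unfolding *(3) using ic a *(2) r by algebra
    moreover have "r \<otimes>\<^bsub>R\<^esub> i \<in> I" using *(1) r by (rule I.I_l_closed)
    ultimately have "g (r \<otimes>\<^bsub>R\<^esub> p) = (r \<otimes>\<^bsub>R\<^esub> s) \<odot>\<^bsub>E\<^esub> c" using g r * by simp
    then show "g (r \<odot>\<^bsub>?S\<lparr>carrier := J\<rparr>\<^esub> p) = r \<odot>\<^bsub>E\<^esub> g p"
      using * c r by (simp add: g E.smult_assoc1)
  qed
  moreover have "id \<in> mod_hom R (?S\<lparr>carrier := J\<rparr>) ?S"
    using Jc by (intro mod_homI) auto
  ultimately obtain h where h: "h \<in> mod_hom R ?S E" "\<And>x. x \<in> J \<Longrightarrow> h x = g x"
    using inj modJ S.module_axioms unfolding injective_module_def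
    by (metis (no_types, lifting) id_apply inj_on_id partial_object.select_convs(1)
        partial_object.surjective partial_object.update_convs(1))
  have hr: "h r = r \<odot>\<^bsub>E\<^esub> h \<one>\<^bsub>R\<^esub>" if "r \<in> carrier R" for r
    using mod_hom_smult[OF h(1) that, of "\<one>\<^bsub>R\<^esub>"] that by simp
  show ?thesis
  proof (rule that)
    show "h \<one>\<^bsub>R\<^esub> \<in> carrier E" using mod_hom_closed[OF h(1)] by simp
    have aJ: "a = \<zero>\<^bsub>R\<^esub> \<oplus>\<^bsub>R\<^esub> a \<otimes>\<^bsub>R\<^esub> \<one>\<^bsub>R\<^esub>" using a by simp
    have "a \<in> J" unfolding J_def
      by (intro CollectI exI[of _ "\<zero>\<^bsub>R\<^esub>"] exI[of _ "\<one>\<^bsub>R\<^esub>"] conjI aJ) auto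
    moreover have "g a = c" using g[of "\<zero>\<^bsub>R\<^esub>" "\<one>\<^bsub>R\<^esub>"] a c by simp
    ultimately show "a \<odot>\<^bsub>E\<^esub> h \<one>\<^bsub>R\<^esub> = c" using hr[OF a] h(2) by simp
  next
    fix r assume r: "r \<in> I"
    then have rc: "r = r \<oplus>\<^bsub>R\<^esub> a \<otimes>\<^bsub>R\<^esub> \<zero>\<^bsub>R\<^esub>" using a by simp
    have "r \<in> J" unfolding J_def
      by (intro CollectI exI[of _ r] exI[of _ "\<zero>\<^bsub>R\<^esub>"] conjI rc r) auto
    moreover have "g r = \<zero>\<^bsub>E\<^esub>" using g[of r "\<zero>\<^bsub>R\<^esub>"] r a c by simp
    ultimately show "r \<odot>\<^bsub>E\<^esub> h \<one>\<^bsub>R\<^esub> = \<zero>\<^bsub>E\<^esub>" using hr[of r] h(2) r by simp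
  qed
qed

section \<open>Two-term models of a complex\<close>

locale module_complex =
  fixes R :: "'r ring" (structure) and C :: "nat \<Rightarrow> ('r, 'e) module" and D :: "nat \<Rightarrow> 'e \<Rightarrow> 'e"
  assumes mod: "\<And>i. module R (C i)"
    and hom: "\<And>i. D i \<in> mod_hom R (C i) (C (Suc i))"
    and D_D: "\<And>i x. x \<in> carrier (C i) \<Longrightarrow> D (Suc i) (D i x) = \<zero>\<^bsub>C (Suc (Suc i))\<^esub>"
begin

lemmas D_closed = mod_hom_closed[OF hom]
lemmas D_add = mod_hom_add[OF hom]
lemmas D_smult = mod_hom_smult[OF hom]
lemmas D_zero = mod_hom_zero[OF mod mod hom]
lemmas smult_closed' = module.smult_closed[OF mod]
lemmas smult_l_distr' = module.smult_l_distr[OF mod]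
lemmas smult_r_distr' = module.smult_r_distr[OF mod]
lemmas smult_assoc' = module.smult_assoc1[OF mod]
lemmas smult_zero' = module.smult_r_null[OF mod]
lemmas zero_smult' = module.smult_l_null[OF mod]
lemmas smult_one' = module.smult_one[OF mod]

lemma abgrp: "abelian_group (C i)"
  using mod[of i] by (simp add: module_def)

lemma abmon: "abelian_monoid (C i)"
  using abgrp[of i] by (simp add: abelian_group_def)

lemmas add_closed' = abelian_monoid.a_closed[OF abmon]
lemmas zero_closed' = abelian_monoid.zero_closed[OF abmon]
lemmas l_zero' = abelian_monoid.l_zero[OF abmon]
lemmas r_zero' = abelian_monoid.r_zero[OF abmon]
lemmas a_assoc' = abelian_monoid.a_assoc[OF abmon]
lemmas a_comm' = abelian_monoid.a_comm[OF abmon]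
lemmas a_lcomm' = abelian_monoid.a_lcomm[OF abmon]

lemma l_cancel':
  assumes "x \<in> carrier (C i)" "y \<in> carrier (C i)" "z \<in> carrier (C i)"
  shows "x \<oplus>\<^bsub>C i\<^esub> y = x \<oplus>\<^bsub>C i\<^esub> z \<longleftrightarrow> y = z"
proof -
  interpret abelian_group "C i" by (rule abgrp)
  show ?thesis using assms add.right_cancel[of x y z] by (simp add: a_comm)
qed

lemma cring: "cring R"
  using mod[of 0] by (simp add: module_def)

lemmas closed' = D_closed smult_closed' add_closed' zero_closed'

end

text \<open>
  The conditions say that \<open>(g, h) \<mapsto> (g u, h v)\<close> is a map to \<open>C\<close> from the complex
  \<open>f : R/I \<rightarrow> R/I\<close> in the degrees \<open>p + 1\<close> and \<open>p + 2\<close>, and that its mapping cone is exact in the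
  range that an induction on \<open>p\<close> needs. For degrees above \<open>p + 2\<close> this is exactness of \<open>C\<close>; for
  degree \<open>p\<close> only the part is kept that concerns the ring elements.
\<close>

definition two_term_model ::
  "'r ring \<Rightarrow> 'r \<Rightarrow> 'r set \<Rightarrow> (nat \<Rightarrow> ('r, 'e) module) \<Rightarrow> (nat \<Rightarrow> 'e \<Rightarrow> 'e) \<Rightarrow> nat \<Rightarrow> 'e \<Rightarrow> 'e \<Rightarrow> bool"
  where "two_term_model R f I C D p u v \<longleftrightarrow>
    u \<in> carrier (C (Suc p)) \<and> v \<in> carrier (C (Suc (Suc p))) \<and>
    D (Suc p) u = f \<odot>\<^bsub>C (Suc (Suc p))\<^esub> v \<and> D (Suc (Suc p)) v = \<zero>\<^bsub>C (Suc (Suc (Suc p)))\<^esub> \<and>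
    (\<forall>z\<in>carrier (C p). \<forall>g\<in>carrier R.
      D p z = g \<odot>\<^bsub>C (Suc p)\<^esub> u \<and> g \<otimes>\<^bsub>R\<^esub> f \<in> I \<longrightarrow> g \<in> I) \<and>
    (\<forall>z\<in>carrier (C (Suc p)). \<forall>h\<in>carrier R.
      D (Suc p) z = h \<odot>\<^bsub>C (Suc (Suc p))\<^esub> v \<longrightarrow>
        (\<exists>g\<in>carrier R. \<exists>w\<in>carrier (C p).
          z = g \<odot>\<^bsub>C (Suc p)\<^esub> u \<oplus>\<^bsub>C (Suc p)\<^esub> D p w \<and> h \<ominus>\<^bsub>R\<^esub> g \<otimes>\<^bsub>R\<^esub> f \<in> I)) \<and>
    (\<forall>z\<in>carrier (C (Suc (Suc p))).
      D (Suc (Suc p)) z = \<zero>\<^bsub>C (Suc (Suc (Suc p)))\<^esub> \<longrightarrow>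
        (\<exists>h\<in>carrier R. \<exists>w\<in>carrier (C (Suc p)).
          z = h \<odot>\<^bsub>C (Suc (Suc p))\<^esub> v \<oplus>\<^bsub>C (Suc (Suc p))\<^esub> D (Suc p) w)) \<and>
    (\<forall>i\<ge>Suc (Suc p). \<forall>z\<in>carrier (C (Suc i)).
      D (Suc i) z = \<zero>\<^bsub>C (Suc (Suc i))\<^esub> \<longrightarrow> (\<exists>w\<in>carrier (C i). z = D i w))"

context module_complex
begin

text \<open>
  Multiplication by \<open>a\<close> gives the exact sequence \<open>0 \<rightarrow> C' \<rightarrow> C \<rightarrow> C \<rightarrow> 0\<close> of complexes, where \<open>C'\<close>
  consists of the elements killed by \<open>a\<close>. The new pair \<open>f v' - d u'\<close>, \<open>d v'\<close> is the image of \<open>u\<close>, \<open>v\<close>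
  under the connecting map. Each of the four exactness conditions for \<open>C'\<close> follows from two
  neighbouring ones for \<open>C\<close>: one applies a condition for \<open>C\<close>, multiplies the result by \<open>a\<close>, applies
  the condition one degree lower, and divides by \<open>a\<close> again where an element of \<open>C'\<close> is wanted.
\<close>

lemma two_term_model_step:
  assumes f: "f \<in> carrier R" and a: "a \<in> carrier R" and I: "ideal I R"
    and kill: "\<And>r i x. r \<in> I \<Longrightarrow> x \<in> carrier (C i) \<Longrightarrow> r \<odot>\<^bsub>C i\<^esub> x = \<zero>\<^bsub>C i\<^esub>"
    and div: "\<And>i x. x \<in> carrier (C i) \<Longrightarrow> \<exists>x'\<in>carrier (C i). a \<odot>\<^bsub>C i\<^esub> x' = x"
    and model: "two_term_model R f I C D p u v"
    and u': "u' \<in> carrier (C (Suc p))" "a \<odot>\<^bsub>C (Suc p)\<^esub> u' = u"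
    and v': "v' \<in> carrier (C (Suc (Suc p)))" "a \<odot>\<^bsub>C (Suc (Suc p))\<^esub> v' = v"
    and w: "w \<in> carrier (C (Suc (Suc p)))"
      "f \<odot>\<^bsub>C (Suc (Suc p))\<^esub> v' = w \<oplus>\<^bsub>C (Suc (Suc p))\<^esub> D (Suc p) u'"
  shows "two_term_model R f {i \<oplus> a \<otimes> s | i s. i \<in> I \<and> s \<in> carrier R}
    (\<lambda>i. annihilated a (C i)) D
    (Suc p) w (D (Suc (Suc p)) v')"
proof -
  interpret R: cring R by (rule cring)
  interpret I: ideal I R by (rule I)
  interpret C2: abelian_group "C (Suc (Suc p))" by (rule abgrp)
  let ?p1 = "Suc p" let ?p2 = "Suc (Suc p)" let ?p3 = "Suc (Suc (Suc p))"
  let ?I' = "{i \<oplus> a \<otimes> s | i s. i \<in> I \<and> s \<in> carrier R}"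
  have u: "u \<in> carrier (C ?p1)" and v: "v \<in> carrier (C ?p2)"
    and du: "D ?p1 u = f \<odot>\<^bsub>C ?p2\<^esub> v" and dv: "D ?p2 v = \<zero>\<^bsub>C ?p3\<^esub>"
    using model by (auto simp: two_term_model_def)
  have N2: "g \<in> I" if "z \<in> carrier (C p)" "g \<in> carrier R" "D p z = g \<odot>\<^bsub>C ?p1\<^esub> u" "g \<otimes> f \<in> I" for z g
    using model that unfolding two_term_model_def by blast
  have N1: "\<exists>g\<in>carrier R. \<exists>w\<in>carrier (C p). z = g \<odot>\<^bsub>C ?p1\<^esub> u \<oplus>\<^bsub>C ?p1\<^esub> D p w \<and> h \<ominus> g \<otimes> f \<in> I"
    if "z \<in> carrier (C ?p1)" "h \<in> carrier R" "D ?p1 z = h \<odot>\<^bsub>C ?p2\<^esub> v" for z h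
    using model that unfolding two_term_model_def by blast
  have Z0: "\<exists>h\<in>carrier R. \<exists>w\<in>carrier (C ?p1). z = h \<odot>\<^bsub>C ?p2\<^esub> v \<oplus>\<^bsub>C ?p2\<^esub> D ?p1 w"
    if "z \<in> carrier (C ?p2)" "D ?p2 z = \<zero>\<^bsub>C ?p3\<^esub>" for z
    using model that unfolding two_term_model_def by blast
  have P: "\<exists>w\<in>carrier (C i). z = D i w"
    if "?p2 \<le> i" "z \<in> carrier (C (Suc i))" "D (Suc i) z = \<zero>\<^bsub>C (Suc (Suc i))\<^esub>" for z i
    using model that unfolding two_term_model_def by blast
  note simps = D_add D_smult D_zero smult_l_distr' smult_r_distr' smult_assoc'
    smult_zero' zero_smult' l_zero' r_zero' closed'
  have swap: "a \<odot>\<^bsub>C i\<^esub> (r \<odot>\<^bsub>C i\<^esub> x) = r \<odot>\<^bsub>C i\<^esub> (a \<odot>\<^bsub>C i\<^esub> x)"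
    if "r \<in> carrier R" "x \<in> carrier (C i)" for r x i
    using that a by (metis R.m_comm smult_assoc')
  have aD: "a \<odot>\<^bsub>C (Suc i)\<^esub> D i x = D i (a \<odot>\<^bsub>C i\<^esub> x)" if "x \<in> carrier (C i)" for i x
    using that a by (simp add: D_smult)
  have lift: "\<exists>c\<in>carrier (C i). a \<odot>\<^bsub>C i\<^esub> c = \<zero>\<^bsub>C i\<^esub> \<and> x = y \<oplus>\<^bsub>C i\<^esub> c"
    if "x \<in> carrier (C i)" "y \<in> carrier (C i)" "a \<odot>\<^bsub>C i\<^esub> x = a \<odot>\<^bsub>C i\<^esub> y" for i x y
    using module.smult_eq_smultE[OF mod a that] by metis
  have DD: "D (Suc i) (D i x) = \<zero>\<^bsub>C (Suc (Suc i))\<^esub>" if "x \<in> carrier (C i)" for i x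
    using that by (rule D_D)
  have aw: "a \<odot>\<^bsub>C ?p2\<^esub> w = \<zero>\<^bsub>C ?p2\<^esub>"
  proof -
    have "a \<odot>\<^bsub>C ?p2\<^esub> (f \<odot>\<^bsub>C ?p2\<^esub> v') = a \<odot>\<^bsub>C ?p2\<^esub> w \<oplus>\<^bsub>C ?p2\<^esub> D ?p1 u"
      using w a u' by (simp add: simps aD)
    moreover have "a \<odot>\<^bsub>C ?p2\<^esub> (f \<odot>\<^bsub>C ?p2\<^esub> v') = D ?p1 u"
      using swap[OF f v'(1)] v' du by simp
    ultimately show ?thesis
      using w a u by (metis (no_types, lifting) D_closed C2.add.r_cancel_one' smult_closed')
  qed
  have dw: "D ?p2 w = f \<odot>\<^bsub>C ?p3\<^esub> D ?p2 v'"
  proof -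
    have "D ?p2 (f \<odot>\<^bsub>C ?p2\<^esub> v') = D ?p2 w"
      unfolding w(2) using w(1) u'(1) by (simp add: simps DD)
    then show ?thesis using f v' by (simp add: simps)
  qed
  show ?thesis
    unfolding two_term_model_def
  proof (intro conjI ballI impI allI)
    show "w \<in> carrier (annihilated a (C ?p2))"
      using w aw by simp
    show "D ?p2 v' \<in> carrier (annihilated a (C ?p3))"
      using v' dv by (simp add: aD D_closed)
  next
    show "D ?p2 w = f \<odot>\<^bsub>annihilated a (C ?p3)\<^esub> D ?p2 v'"
      using dw by simp
    show "D ?p3 (D ?p2 v') = \<zero>\<^bsub>annihilated a (C (Suc ?p3))\<^esub>"
      using v' by (simp add: DD)
  next
    fix z g assume z0: "z \<in> carrier (annihilated a (C ?p1))"
      and g: "g \<in> carrier R"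
      and "D ?p1 z = g \<odot>\<^bsub>annihilated a (C ?p2)\<^esub> w \<and> g \<otimes> f \<in> ?I'"
    then have dz: "D ?p1 z = g \<odot>\<^bsub>C ?p2\<^esub> w" and "g \<otimes> f \<in> ?I'" by auto
    then obtain j h where j: "j \<in> I" "h \<in> carrier R" "g \<otimes> f = j \<oplus> a \<otimes> h" by blast
    have jc: "j \<in> carrier R" using j by simp
    have z: "z \<in> carrier (C ?p1)" "a \<odot>\<^bsub>C ?p1\<^esub> z = \<zero>\<^bsub>C ?p1\<^esub>" using z0 by auto
    have "D ?p1 (z \<oplus>\<^bsub>C ?p1\<^esub> g \<odot>\<^bsub>C ?p1\<^esub> u') = g \<odot>\<^bsub>C ?p2\<^esub> (w \<oplus>\<^bsub>C ?p2\<^esub> D ?p1 u')"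
      using z g u' w(1) dz by (simp add: simps)
    also have "\<dots> = (g \<otimes> f) \<odot>\<^bsub>C ?p2\<^esub> v'"
      using g f v' by (simp add: w(2)[symmetric] smult_assoc')
    also have "\<dots> = h \<odot>\<^bsub>C ?p2\<^esub> v"
      using j jc a v' v by (simp add: simps kill swap)
    finally have "D ?p1 (z \<oplus>\<^bsub>C ?p1\<^esub> g \<odot>\<^bsub>C ?p1\<^esub> u') = h \<odot>\<^bsub>C ?p2\<^esub> v" .
    \<comment> \<open>\<open>z + g u'\<close> is a lift of \<open>g u\<close> along \<open>a\<close>, and its boundary is a multiple of \<open>v\<close>\<close>
    from N1[OF _ j(2) this] obtain g1 x where g1: "g1 \<in> carrier R" and x: "x \<in> carrier (C p)"
      and eq: "z \<oplus>\<^bsub>C ?p1\<^esub> g \<odot>\<^bsub>C ?p1\<^esub> u' = g1 \<odot>\<^bsub>C ?p1\<^esub> u \<oplus>\<^bsub>C ?p1\<^esub> D p x" and hg: "h \<ominus> g1 \<otimes> f \<in> I"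
      using z g u' by (auto simp: closed')
    have "a \<odot>\<^bsub>C ?p1\<^esub> (z \<oplus>\<^bsub>C ?p1\<^esub> g \<odot>\<^bsub>C ?p1\<^esub> u') = g \<odot>\<^bsub>C ?p1\<^esub> u"
      using z g u' a u by (simp add: simps(5) closed' swap l_zero')
    moreover have "a \<odot>\<^bsub>C ?p1\<^esub> (g1 \<odot>\<^bsub>C ?p1\<^esub> u \<oplus>\<^bsub>C ?p1\<^esub> D p x) = (a \<otimes> g1) \<odot>\<^bsub>C ?p1\<^esub> u \<oplus>\<^bsub>C ?p1\<^esub> D p (a \<odot>\<^bsub>C p\<^esub> x)"
      using g1 u a x by (simp add: simps)
    ultimately have eq2: "g \<odot>\<^bsub>C ?p1\<^esub> u = (a \<otimes> g1) \<odot>\<^bsub>C ?p1\<^esub> u \<oplus>\<^bsub>C ?p1\<^esub> D p (a \<odot>\<^bsub>C p\<^esub> x)"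
      using eq by simp
    have "g \<odot>\<^bsub>C ?p1\<^esub> u = (a \<otimes> g1) \<odot>\<^bsub>C ?p1\<^esub> u \<oplus>\<^bsub>C ?p1\<^esub> (g \<ominus> a \<otimes> g1) \<odot>\<^bsub>C ?p1\<^esub> u"
    proof -
      have "g = a \<otimes> g1 \<oplus> (g \<ominus> a \<otimes> g1)" using g a g1 by algebra
      then show ?thesis using g a g1 u smult_l_distr'[of "a \<otimes> g1" "g \<ominus> a \<otimes> g1" u ?p1] by simp
    qed
    then have "D p (a \<odot>\<^bsub>C p\<^esub> x) = (g \<ominus> a \<otimes> g1) \<odot>\<^bsub>C ?p1\<^esub> u"
      using eq2 g a g1 u x l_cancel' by (simp add: closed')
    moreover have "(g \<ominus> a \<otimes> g1) \<otimes> f \<in> I"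
    proof -
      have "(g \<ominus> a \<otimes> g1) \<otimes> f = g \<otimes> f \<ominus> a \<otimes> (g1 \<otimes> f)"
        using g a g1 f by algebra
      also have "\<dots> = j \<oplus> a \<otimes> (h \<ominus> g1 \<otimes> f)"
        unfolding j(3) using jc a g1 f j(2) by algebra
      also have "\<dots> \<in> I" using j(1) I.I_l_closed[OF hg a] by simp
      finally show ?thesis .
    qed
    ultimately have "g \<ominus> a \<otimes> g1 \<in> I"
      using N2[of "a \<odot>\<^bsub>C p\<^esub> x" "g \<ominus> a \<otimes> g1"] g a g1 x by (simp add: closed')
    moreover have "g = (g \<ominus> a \<otimes> g1) \<oplus> a \<otimes> g1" using g a g1 by algebra
    ultimately show "g \<in> ?I'" using g1 by blast
  next
    fix z h assume z0: "z \<in> carrier (annihilated a (C ?p2))"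
      and h: "h \<in> carrier R"
      and "D ?p2 z = h \<odot>\<^bsub>annihilated a (C ?p3)\<^esub> D ?p2 v'"
    then have dz: "D ?p2 z = h \<odot>\<^bsub>C ?p3\<^esub> D ?p2 v'" by simp
    have z: "z \<in> carrier (C ?p2)" "a \<odot>\<^bsub>C ?p2\<^esub> z = \<zero>\<^bsub>C ?p2\<^esub>" using z0 by auto
    have canc: "(h \<oplus> \<ominus> h) = \<zero>" using h by (rule R.r_neg)
    have "D ?p2 (z \<oplus>\<^bsub>C ?p2\<^esub> (\<ominus> h) \<odot>\<^bsub>C ?p2\<^esub> v') = (h \<oplus> \<ominus> h) \<odot>\<^bsub>C ?p3\<^esub> D ?p2 v'"
      using z h v' dz by (simp add: simps del: R.r_neg)
    then have "D ?p2 (z \<oplus>\<^bsub>C ?p2\<^esub> (\<ominus> h) \<odot>\<^bsub>C ?p2\<^esub> v') = \<zero>\<^bsub>C ?p3\<^esub>"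
      using v' by (simp add: canc simps)
    then obtain h1 x where h1: "h1 \<in> carrier R" and x: "x \<in> carrier (C ?p1)"
      and eq: "z \<oplus>\<^bsub>C ?p2\<^esub> (\<ominus> h) \<odot>\<^bsub>C ?p2\<^esub> v' = h1 \<odot>\<^bsub>C ?p2\<^esub> v \<oplus>\<^bsub>C ?p2\<^esub> D ?p1 x"
      using Z0[of "z \<oplus>\<^bsub>C ?p2\<^esub> (\<ominus> h) \<odot>\<^bsub>C ?p2\<^esub> v'"] z h v' by (auto simp: closed')
    \<comment> \<open>the coefficient of \<open>v'\<close> in \<open>z\<close>; as \<open>a z = 0\<close>, its multiple \<open>q v\<close> is a coboundary\<close>
    define q where "q = h \<oplus> a \<otimes> h1"
    have q: "q \<in> carrier R" using h a h1 by (simp add: q_def)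
    have zeq: "z = q \<odot>\<^bsub>C ?p2\<^esub> v' \<oplus>\<^bsub>C ?p2\<^esub> D ?p1 x"
    proof -
      have "z = z \<oplus>\<^bsub>C ?p2\<^esub> (\<ominus> h \<oplus> h) \<odot>\<^bsub>C ?p2\<^esub> v'"
        using z v' h by (simp add: R.l_neg simps)
      also have "\<dots> = (z \<oplus>\<^bsub>C ?p2\<^esub> (\<ominus> h) \<odot>\<^bsub>C ?p2\<^esub> v') \<oplus>\<^bsub>C ?p2\<^esub> h \<odot>\<^bsub>C ?p2\<^esub> v'"
        using z v' h by (simp add: simps a_assoc' del: R.l_neg)
      also have "\<dots> = q \<odot>\<^bsub>C ?p2\<^esub> v' \<oplus>\<^bsub>C ?p2\<^esub> D ?p1 x"
        unfolding eq using z v' h h1 a x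
        by (simp add: q_def simps v'(2)[symmetric] swap a_assoc' a_comm' a_lcomm')
      finally show ?thesis .
    qed
    have "\<zero>\<^bsub>C ?p2\<^esub> = q \<odot>\<^bsub>C ?p2\<^esub> v \<oplus>\<^bsub>C ?p2\<^esub> D ?p1 (a \<odot>\<^bsub>C ?p1\<^esub> x)"
    proof -
      have "\<zero>\<^bsub>C ?p2\<^esub> = a \<odot>\<^bsub>C ?p2\<^esub> (q \<odot>\<^bsub>C ?p2\<^esub> v' \<oplus>\<^bsub>C ?p2\<^esub> D ?p1 x)"
        using z(2) zeq by simp
      also have "\<dots> = q \<odot>\<^bsub>C ?p2\<^esub> v \<oplus>\<^bsub>C ?p2\<^esub> D ?p1 (a \<odot>\<^bsub>C ?p1\<^esub> x)"
        using q v' x a by (simp add: smult_r_distr' closed' swap aD)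
      finally show ?thesis .
    qed
    moreover have "\<zero>\<^bsub>C ?p2\<^esub> = q \<odot>\<^bsub>C ?p2\<^esub> v \<oplus>\<^bsub>C ?p2\<^esub> (\<ominus> q) \<odot>\<^bsub>C ?p2\<^esub> v"
      using q v by (simp add: smult_l_distr'[symmetric] R.r_neg zero_smult')
    ultimately have "D ?p1 (a \<odot>\<^bsub>C ?p1\<^esub> x) = (\<ominus> q) \<odot>\<^bsub>C ?p2\<^esub> v"
      using q v x a l_cancel'[of "q \<odot>\<^bsub>C ?p2\<^esub> v" ?p2] by (simp add: closed')
    with N1[of "a \<odot>\<^bsub>C ?p1\<^esub> x" "\<ominus> q"] obtain g y where g: "g \<in> carrier R" and y: "y \<in> carrier (C p)"
      and ax: "a \<odot>\<^bsub>C ?p1\<^esub> x = g \<odot>\<^bsub>C ?p1\<^esub> u \<oplus>\<^bsub>C ?p1\<^esub> D p y" and qg: "\<ominus> q \<ominus> g \<otimes> f \<in> I"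
      using a x q by (auto simp: closed')
    obtain y' where y': "y' \<in> carrier (C p)" "a \<odot>\<^bsub>C p\<^esub> y' = y" using div[OF y] by blast
    have "a \<odot>\<^bsub>C ?p1\<^esub> x = a \<odot>\<^bsub>C ?p1\<^esub> (g \<odot>\<^bsub>C ?p1\<^esub> u' \<oplus>\<^bsub>C ?p1\<^esub> D p y')"
      using a g u' y' by (simp add: ax smult_r_distr' closed' swap aD)
    then obtain c where c: "c \<in> carrier (C ?p1)" "a \<odot>\<^bsub>C ?p1\<^esub> c = \<zero>\<^bsub>C ?p1\<^esub>"
      and xeq: "x = (g \<odot>\<^bsub>C ?p1\<^esub> u' \<oplus>\<^bsub>C ?p1\<^esub> D p y') \<oplus>\<^bsub>C ?p1\<^esub> c"
      using lift[OF x] g u' y' by (metis add_closed' D_closed smult_closed')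
    have Dx: "D ?p1 x = g \<odot>\<^bsub>C ?p2\<^esub> D ?p1 u' \<oplus>\<^bsub>C ?p2\<^esub> D ?p1 c"
      unfolding xeq using g u' y' c by (simp add: simps DD)
    have "(\<ominus> q \<ominus> g \<otimes> f) \<odot>\<^bsub>C ?p2\<^esub> v' = \<zero>\<^bsub>C ?p2\<^esub>" using kill[OF qg v'(1)] .
    then have "(\<ominus> g) \<odot>\<^bsub>C ?p2\<^esub> (f \<odot>\<^bsub>C ?p2\<^esub> v') = q \<odot>\<^bsub>C ?p2\<^esub> v' \<oplus>\<^bsub>C ?p2\<^esub> (\<ominus> q \<ominus> g \<otimes> f) \<odot>\<^bsub>C ?p2\<^esub> v'
      \<and> (\<ominus> q \<ominus> g \<otimes> f) \<odot>\<^bsub>C ?p2\<^esub> v' = \<zero>\<^bsub>C ?p2\<^esub>"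
    proof -
      assume *: "(\<ominus> q \<ominus> g \<otimes> f) \<odot>\<^bsub>C ?p2\<^esub> v' = \<zero>\<^bsub>C ?p2\<^esub>"
      have "(\<ominus> g) \<otimes> f = q \<oplus> (\<ominus> q \<ominus> g \<otimes> f)" using q g f by algebra
      then have "((\<ominus> g) \<otimes> f) \<odot>\<^bsub>C ?p2\<^esub> v' = q \<odot>\<^bsub>C ?p2\<^esub> v' \<oplus>\<^bsub>C ?p2\<^esub> (\<ominus> q \<ominus> g \<otimes> f) \<odot>\<^bsub>C ?p2\<^esub> v'"
        using smult_l_distr'[of q "\<ominus> q \<ominus> g \<otimes> f" v' ?p2] q g f v' by simp
      then show ?thesis using * smult_assoc'[of "\<ominus> g" f v' ?p2] g f v' by simp
    qed
    then have qv: "q \<odot>\<^bsub>C ?p2\<^esub> v' = (\<ominus> g) \<odot>\<^bsub>C ?p2\<^esub> (f \<odot>\<^bsub>C ?p2\<^esub> v')"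
      using q v' by (simp add: r_zero' closed')
    have "z = (\<ominus> g) \<odot>\<^bsub>C ?p2\<^esub> (w \<oplus>\<^bsub>C ?p2\<^esub> D ?p1 u') \<oplus>\<^bsub>C ?p2\<^esub> (g \<odot>\<^bsub>C ?p2\<^esub> D ?p1 u' \<oplus>\<^bsub>C ?p2\<^esub> D ?p1 c)"
      unfolding zeq qv Dx w(2) ..
    also have "\<dots> = (\<ominus> g) \<odot>\<^bsub>C ?p2\<^esub> w \<oplus>\<^bsub>C ?p2\<^esub> ((\<ominus> g \<oplus> g) \<odot>\<^bsub>C ?p2\<^esub> D ?p1 u' \<oplus>\<^bsub>C ?p2\<^esub> D ?p1 c)"
      using g w(1) u' c by (simp add: smult_r_distr' smult_l_distr' closed' a_assoc')
    also have "\<dots> = (\<ominus> g) \<odot>\<^bsub>C ?p2\<^esub> w \<oplus>\<^bsub>C ?p2\<^esub> D ?p1 c"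
      using g u' c by (simp add: R.l_neg zero_smult' closed' l_zero')
    finally have "z = (\<ominus> g) \<odot>\<^bsub>C ?p2\<^esub> w \<oplus>\<^bsub>C ?p2\<^esub> D ?p1 c" .
    moreover have "h \<ominus> (\<ominus> g) \<otimes> f \<in> ?I'"
    proof -
      have "h \<ominus> (\<ominus> g) \<otimes> f = \<ominus> (\<ominus> q \<ominus> g \<otimes> f) \<oplus> a \<otimes> (\<ominus> h1)"
        unfolding q_def using h g f a h1 by algebra
      then show ?thesis using qg h1 by (intro CollectI exI[of _ "\<ominus> (\<ominus> q \<ominus> g \<otimes> f)"] exI[of _ "\<ominus> h1"]) auto
    qed
    ultimately show "\<exists>g\<in>carrier R. \<exists>w'\<in>carrier (annihilated a (C ?p1)).
        z = g \<odot>\<^bsub>annihilated a (C ?p2)\<^esub> w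
          \<oplus>\<^bsub>annihilated a (C ?p2)\<^esub> D ?p1 w' \<and>
        h \<ominus> g \<otimes> f \<in> ?I'"
      using g c by (intro bexI[of _ "\<ominus> g"] bexI[of _ c]) auto
  next
    fix z assume z0: "z \<in> carrier (annihilated a (C ?p3))"
      and "D ?p3 z = \<zero>\<^bsub>annihilated a (C (Suc ?p3))\<^esub>"
    then have dz: "D ?p3 z = \<zero>\<^bsub>C (Suc ?p3)\<^esub>" by simp
    have z: "z \<in> carrier (C ?p3)" "a \<odot>\<^bsub>C ?p3\<^esub> z = \<zero>\<^bsub>C ?p3\<^esub>" using z0 by auto
    obtain x where x: "x \<in> carrier (C ?p2)" "z = D ?p2 x" using P[OF order_refl z(1) dz] by blast
    have "D ?p2 (a \<odot>\<^bsub>C ?p2\<^esub> x) = \<zero>\<^bsub>C ?p3\<^esub>" using x z a by (simp add: D_smult)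
    then obtain h y where h: "h \<in> carrier R" and y: "y \<in> carrier (C ?p1)"
      and ax: "a \<odot>\<^bsub>C ?p2\<^esub> x = h \<odot>\<^bsub>C ?p2\<^esub> v \<oplus>\<^bsub>C ?p2\<^esub> D ?p1 y"
      using Z0[of "a \<odot>\<^bsub>C ?p2\<^esub> x"] a x by (auto simp: closed')
    obtain y' where y': "y' \<in> carrier (C ?p1)" "a \<odot>\<^bsub>C ?p1\<^esub> y' = y" using div[OF y] by blast
    have "a \<odot>\<^bsub>C ?p2\<^esub> x = a \<odot>\<^bsub>C ?p2\<^esub> (h \<odot>\<^bsub>C ?p2\<^esub> v' \<oplus>\<^bsub>C ?p2\<^esub> D ?p1 y')"
      using a h v' y' by (simp add: ax smult_r_distr' closed' swap aD)
    then obtain c where c: "c \<in> carrier (C ?p2)" "a \<odot>\<^bsub>C ?p2\<^esub> c = \<zero>\<^bsub>C ?p2\<^esub>"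
      and xeq: "x = (h \<odot>\<^bsub>C ?p2\<^esub> v' \<oplus>\<^bsub>C ?p2\<^esub> D ?p1 y') \<oplus>\<^bsub>C ?p2\<^esub> c"
      using lift[OF x(1)] h v' y' by (metis add_closed' D_closed smult_closed')
    have "z = h \<odot>\<^bsub>C ?p3\<^esub> D ?p2 v' \<oplus>\<^bsub>C ?p3\<^esub> D ?p2 c"
      unfolding x(2) xeq using h v' y' c by (simp add: simps DD)
    then show "\<exists>h\<in>carrier R. \<exists>w'\<in>carrier (annihilated a (C ?p2)).
        z = h \<odot>\<^bsub>annihilated a (C ?p3)\<^esub> D ?p2 v'
          \<oplus>\<^bsub>annihilated a (C ?p3)\<^esub> D ?p2 w'"
      using h c by (intro bexI[of _ h] bexI[of _ c]) auto
  next
    fix i z assume i: "?p3 \<le> i"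
      and z0: "z \<in> carrier (annihilated a (C (Suc i)))"
      and "D (Suc i) z = \<zero>\<^bsub>annihilated a (C (Suc (Suc i)))\<^esub>"
    then have dz: "D (Suc i) z = \<zero>\<^bsub>C (Suc (Suc i))\<^esub>" by simp
    have z: "z \<in> carrier (C (Suc i))" "a \<odot>\<^bsub>C (Suc i)\<^esub> z = \<zero>\<^bsub>C (Suc i)\<^esub>" using z0 by auto
    obtain x where x: "x \<in> carrier (C i)" "z = D i x" using P[OF _ z(1) dz] i by auto
    obtain j where j: "i = Suc j" "?p2 \<le> j" using i by (cases i) auto
    have "D i (a \<odot>\<^bsub>C i\<^esub> x) = \<zero>\<^bsub>C (Suc i)\<^esub>" using x z a by (simp add: D_smult)
    then obtain y where y: "y \<in> carrier (C j)" and ax: "a \<odot>\<^bsub>C i\<^esub> x = D j y"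
      using P[of j "a \<odot>\<^bsub>C i\<^esub> x"] a x j by (auto simp: closed')
    obtain y' where y': "y' \<in> carrier (C j)" "a \<odot>\<^bsub>C j\<^esub> y' = y" using div[OF y] by blast
    have "a \<odot>\<^bsub>C i\<^esub> x = a \<odot>\<^bsub>C i\<^esub> D j y'"
      using y' ax by (simp add: j(1) aD)
    then obtain c where c: "c \<in> carrier (C i)" "a \<odot>\<^bsub>C i\<^esub> c = \<zero>\<^bsub>C i\<^esub>" and xeq: "x = D j y' \<oplus>\<^bsub>C i\<^esub> c"
      using lift[OF x(1)] y' j by (metis D_closed)
    have "z = D i c"
      unfolding x(2) xeq using y' c by (simp add: j simps DD)
    then show "\<exists>w'\<in>carrier (annihilated a (C i)). z = D i w'"
      using c by auto
  qed
qed

end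

section \<open>Monomial ideals in the polynomial ring\<close>

abbreviation "lkp \<equiv> Poly_Mapping.lookup"

lemma bipoly_ring_simps [simp]:
  "mult (bipoly_ring m n) = (*)" "one (bipoly_ring m n) = 1"
  "zero (bipoly_ring m n) = 0" "add (bipoly_ring m n) = (+)"
  by (simp_all add: bipoly_ring_def)

lemma keys_uminus [simp]: "Poly_Mapping.keys (- p :: 'a \<Rightarrow>\<^sub>0 'b::ab_group_add) = Poly_Mapping.keys p"
  by (auto simp: in_keys_iff)

lemma poly_mapping_sum_single:
  fixes p :: "'a \<Rightarrow>\<^sub>0 'b::comm_monoid_add"
  shows "p = (\<Sum>\<mu>\<in>Poly_Mapping.keys p. Poly_Mapping.single \<mu> (lkp p \<mu>))"
proof (rule poly_mapping_eqI)
  fix \<nu>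
  have "lkp (\<Sum>\<mu>\<in>Poly_Mapping.keys p. Poly_Mapping.single \<mu> (lkp p \<mu>)) \<nu> =
      (\<Sum>\<mu>\<in>Poly_Mapping.keys p. if \<mu> = \<nu> then lkp p \<mu> else 0)"
    by (simp add: lookup_sum lookup_single when_def)
  then show "lkp p \<nu> = lkp (\<Sum>\<mu>\<in>Poly_Mapping.keys p. Poly_Mapping.single \<mu> (lkp p \<mu>)) \<nu>"
    by (simp add: in_keys_iff)
qed

lemma lookup_monomial_mult:
  fixes p :: "'a::cancel_comm_monoid_add \<Rightarrow>\<^sub>0 'b::comm_semiring_1"
  shows "lkp (Poly_Mapping.single \<mu> c * p) (\<mu> + \<nu>) = c * lkp p \<nu>"
proof -
  have "Poly_Mapping.single \<mu> c * p =
      (\<Sum>\<kappa>\<in>Poly_Mapping.keys p. Poly_Mapping.single (\<mu> + \<kappa>) (c * lkp p \<kappa>))"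
    by (subst (1) poly_mapping_sum_single[of p]) (simp add: sum_distrib_left mult_single)
  then have "lkp (Poly_Mapping.single \<mu> c * p) (\<mu> + \<nu>) =
      (\<Sum>\<kappa>\<in>Poly_Mapping.keys p. if \<kappa> = \<nu> then c * lkp p \<kappa> else 0)"
    by (simp add: lookup_sum lookup_single when_def)
  then show ?thesis by (simp add: in_keys_iff)
qed

lemma keys_monomial_mult:
  fixes p :: "'a::cancel_comm_monoid_add \<Rightarrow>\<^sub>0 'b::comm_semiring_1"
  shows "Poly_Mapping.keys (Poly_Mapping.single \<mu> 1 * p) = (+) \<mu> ` Poly_Mapping.keys p"
proof (intro equalityI subsetI)
  fix \<kappa> assume "\<kappa> \<in> Poly_Mapping.keys (Poly_Mapping.single \<mu> 1 * p)"
  then show "\<kappa> \<in> (+) \<mu> ` Poly_Mapping.keys p"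
    using keys_mult[of "Poly_Mapping.single \<mu> 1" p] by (auto split: if_splits)
next
  fix \<kappa> assume "\<kappa> \<in> (+) \<mu> ` Poly_Mapping.keys p"
  then show "\<kappa> \<in> Poly_Mapping.keys (Poly_Mapping.single \<mu> 1 * p)"
    using lookup_monomial_mult[of \<mu> 1 p] by (auto simp: in_keys_iff)
qed

lemma keys_add_nat: "Poly_Mapping.keys (\<mu> + \<nu> :: 'a \<Rightarrow>\<^sub>0 nat) = Poly_Mapping.keys \<mu> \<union> Poly_Mapping.keys \<nu>"
  by (auto simp: in_keys_iff lookup_add)

text \<open>
  Fixing \<open>K\<close> fixes the type of the coefficients in all statements below.
\<close>

context
  fixes m n :: nat and K :: "'k::field itself"
begin

private abbreviation (input) "S \<equiv> bipoly_ring m n :: 'k bipoly ring"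
private abbreviation (input) "V \<equiv> Inl ` {..<m} \<union> Inr ` {..<n} :: (nat + nat) set"

lemma carrier_bipoly_iff: "p \<in> carrier S \<longleftrightarrow> (\<forall>\<mu>\<in>Poly_Mapping.keys p. Poly_Mapping.keys \<mu> \<subseteq> V)"
  by (simp add: bipoly_ring_def)

lemma bipoly_add_closed: "p \<in> carrier S \<Longrightarrow> q \<in> carrier S \<Longrightarrow> p + q \<in> carrier S"
  using keys_add[of p q] unfolding carrier_bipoly_iff by blast

lemma bipoly_mult_closed: "p \<in> carrier S \<Longrightarrow> q \<in> carrier S \<Longrightarrow> p * q \<in> carrier S"
  unfolding carrier_bipoly_iff
proof
  fix \<mu> assume p: "\<forall>\<mu>\<in>Poly_Mapping.keys p. Poly_Mapping.keys \<mu> \<subseteq> V"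
    and q: "\<forall>\<mu>\<in>Poly_Mapping.keys q. Poly_Mapping.keys \<mu> \<subseteq> V"
    and "\<mu> \<in> Poly_Mapping.keys (p * q)"
  then obtain \<alpha> \<beta> where "\<mu> = \<alpha> + \<beta>" "\<alpha> \<in> Poly_Mapping.keys p" "\<beta> \<in> Poly_Mapping.keys q"
    using keys_mult[of p q] by blast
  then show "Poly_Mapping.keys \<mu> \<subseteq> V" using p q by (simp add: keys_add_nat)
qed

lemma bipoly_uminus_closed: "p \<in> carrier S \<Longrightarrow> - p \<in> carrier S"
  by (simp add: carrier_bipoly_iff)

lemma single_in_bipoly: "Poly_Mapping.keys \<mu> \<subseteq> V \<Longrightarrow> Poly_Mapping.single \<mu> c \<in> carrier S"
  by (simp add: carrier_bipoly_iff)

lemma cring_bipoly: "cring S"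
proof (rule cringI)
  show "abelian_group S"
  proof (rule abelian_groupI)
    fix p assume p: "p \<in> carrier S"
    then show "\<exists>q\<in>carrier S. q \<oplus>\<^bsub>S\<^esub> p = \<zero>\<^bsub>S\<^esub>"
      by (intro bexI[of _ "- p"]) (auto intro: bipoly_uminus_closed)
  qed (auto simp: bipoly_add_closed algebra_simps carrier_bipoly_iff[of 0])
  show "comm_monoid S"
    by (rule comm_monoidI) (auto simp: bipoly_mult_closed algebra_simps carrier_bipoly_iff[of 1])
qed (simp add: algebra_simps)

lemma bipoly_a_inv:
  assumes "p \<in> carrier S"
  shows "\<ominus>\<^bsub>S\<^esub> p = - p"
proof -
  interpret cring S by (rule cring_bipoly)
  show ?thesis
    using assms minus_equality[of "- p" p] bipoly_uminus_closed[OF assms] by simp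
qed

lemma bipoly_a_minus: "p \<in> carrier S \<Longrightarrow> q \<in> carrier S \<Longrightarrow> p \<ominus>\<^bsub>S\<^esub> q = p - q"
  by (simp add: a_minus_def bipoly_a_inv)

definition ypow :: "nat \<Rightarrow> nat \<Rightarrow> 'k bipoly"
  where "ypow j k = Poly_Mapping.single (Poly_Mapping.single (Inr j) k) 1"

lemma ypow_in_bipoly [simp]: "j < n \<Longrightarrow> ypow j k \<in> carrier S"
  unfolding ypow_def by (rule single_in_bipoly) auto

lemma ypow_add: "ypow j (k + l) = (ypow j k * ypow j l :: 'k bipoly)"
  by (simp add: ypow_def mult_single single_add)

lemma ypow_0 [simp]: "ypow j 0 = 1"
  by (simp add: ypow_def)

text \<open>
  For \<open>p \<le> n\<close> this is the ideal generated by the \<open>y\<^sub>j\<^sup>k\<close> with \<open>j < p\<close>, see \<open>ypow_ideal_0\<close> and \<open>ypow_ideal_Suc\<close>. As a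
  condition on monomials it makes regularity and colon ideals visible in the exponents.
\<close>

definition ypow_ideal :: "nat \<Rightarrow> nat \<Rightarrow> 'k bipoly set"
  where "ypow_ideal k p =
    {q \<in> carrier S. \<forall>\<mu>\<in>Poly_Mapping.keys q. \<exists>j<p. k \<le> lkp \<mu> (Inr j)}"

lemma ypow_ideal_subset: "q \<in> ypow_ideal k p \<Longrightarrow> q \<in> carrier S"
  by (simp add: ypow_ideal_def)

lemma zero_in_ypow_ideal: "0 \<in> ypow_ideal k p"
  by (simp add: ypow_ideal_def carrier_bipoly_iff)

lemma ypow_ideal_add: "q \<in> ypow_ideal k p \<Longrightarrow> r \<in> ypow_ideal k p \<Longrightarrow> q + r \<in> ypow_ideal k p"
  using keys_add[of q r] bipoly_add_closed[of q r] unfolding ypow_ideal_def by blast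

lemma ypow_ideal_mult: 
  assumes "r \<in> carrier S" "q \<in> ypow_ideal k p"
  shows "r * q \<in> ypow_ideal k p"
  unfolding ypow_ideal_def
proof (intro CollectI conjI ballI)
  show "r * q \<in> carrier S" using assms by (auto intro: bipoly_mult_closed ypow_ideal_subset)
  fix \<mu> assume "\<mu> \<in> Poly_Mapping.keys (r * q)"
  then obtain \<alpha> \<beta> where "\<mu> = \<alpha> + \<beta>" "\<beta> \<in> Poly_Mapping.keys q" using keys_mult[of r q] by blast
  then show "\<exists>j<p. k \<le> lkp \<mu> (Inr j)"
    using assms(2) by (fastforce simp: ypow_ideal_def lookup_add)
qed

lemma ideal_ypow_ideal: "ideal (ypow_ideal k p) S"
proof (rule idealI)
  interpret cring S by (rule cring_bipoly)
  show "ring S" by (rule ring_axioms)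
  show "subgroup (ypow_ideal k p) (add_monoid S)"
  proof (rule add.subgroupI)
    show "ypow_ideal k p \<noteq> ({} :: 'k bipoly set)" using zero_in_ypow_ideal by blast
    fix q :: "'k bipoly" assume q: "q \<in> ypow_ideal k p"
    show "\<ominus>\<^bsub>S\<^esub> q \<in> ypow_ideal k p"
      using q by (simp add: bipoly_a_inv ypow_ideal_subset)
        (simp add: ypow_ideal_def bipoly_uminus_closed)
  qed (auto simp: ypow_ideal_add ypow_ideal_subset)
  fix q r :: "'k bipoly" assume qr: "q \<in> ypow_ideal k p" "r \<in> carrier S"
  show "r \<otimes>\<^bsub>S\<^esub> q \<in> ypow_ideal k p" using ypow_ideal_mult[OF qr(2,1)] by simp
  then show "q \<otimes>\<^bsub>S\<^esub> r \<in> ypow_ideal k p" by (simp add: mult.commute)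
qed

lemma ypow_ideal_0: "ypow_ideal k 0 = {0}"
proof -
  have "q = 0" if "q \<in> ypow_ideal k 0" for q :: "'k bipoly"
    using that poly_mapping_sum_single[of q] by (auto simp: ypow_ideal_def)
  then show ?thesis using zero_in_ypow_ideal by auto
qed

lemma ypow_ideal_mono: "p \<le> p' \<Longrightarrow> q \<in> ypow_ideal k p \<Longrightarrow> q \<in> ypow_ideal k p'"
  unfolding ypow_ideal_def using less_le_trans by blast

lemma ypow_mem: "j < p \<Longrightarrow> p \<le> n \<Longrightarrow> ypow j k \<in> ypow_ideal k p"
  by (auto simp: ypow_ideal_def) (auto simp: ypow_def)

lemma keys_ypow_mult:
  "Poly_Mapping.keys (ypow j k * q :: 'k bipoly) = (+) (Poly_Mapping.single (Inr j) k) ` Poly_Mapping.keys q"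
  unfolding ypow_def by (rule keys_monomial_mult)

lemma ypow_ideal_Suc:
  assumes p: "p < n"
  shows "ypow_ideal k (Suc p) = {i \<oplus>\<^bsub>S\<^esub> ypow p k \<otimes>\<^bsub>S\<^esub> s | i s. i \<in> ypow_ideal k p \<and> s \<in> carrier S}"
    (is "_ = ?J")
proof (intro equalityI subsetI)
  fix q assume "q \<in> ?J"
  then obtain i s where "i \<in> ypow_ideal k p" "s \<in> carrier S" "q = i + s * ypow p k"
    by (auto simp: mult.commute)
  then show "q \<in> ypow_ideal k (Suc p)"
    using p by (auto intro!: ypow_ideal_add ypow_ideal_mult ypow_mem intro: ypow_ideal_mono[of p])
next
  fix q :: "'k bipoly" assume q: "q \<in> ypow_ideal k (Suc p)"
  have J_add: "r + r' \<in> ?J" if "r \<in> ?J" "r' \<in> ?J" for r r'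
  proof -
    obtain i s i' s' where *: "i \<in> ypow_ideal k p" "s \<in> carrier S" "r = i + ypow p k * s"
      "i' \<in> ypow_ideal k p" "s' \<in> carrier S" "r' = i' + ypow p k * s'" using \<open>r \<in> ?J\<close> \<open>r' \<in> ?J\<close> by auto
    show ?thesis
      using * by (intro CollectI exI[of _ "i + i'"] exI[of _ "s + s'"])
        (auto simp: algebra_simps intro: ypow_ideal_add bipoly_add_closed)
  qed
  have single_J: "Poly_Mapping.single \<mu> (lkp q \<mu>) \<in> ?J" if \<mu>: "\<mu> \<in> Poly_Mapping.keys q" for \<mu>
  proof (cases "\<exists>j<p. k \<le> lkp \<mu> (Inr j)")
    case True
    have "Poly_Mapping.keys \<mu> \<subseteq> V" using q \<mu> by (auto simp: ypow_ideal_def carrier_bipoly_iff)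
    then have "Poly_Mapping.single \<mu> (lkp q \<mu>) \<in> ypow_ideal k p"
      using True by (auto simp: ypow_ideal_def single_in_bipoly)
    then show ?thesis
      by (intro CollectI exI[of _ "Poly_Mapping.single \<mu> (lkp q \<mu>)"] exI[of _ 0]) (auto simp: carrier_bipoly_iff)
  next
    case False
    then have kp: "k \<le> lkp \<mu> (Inr p)" using q \<mu> by (auto simp: ypow_ideal_def less_Suc_eq)
    define \<nu> where "\<nu> = \<mu> - Poly_Mapping.single (Inr p) k"
    have \<mu>_eq: "\<mu> = Poly_Mapping.single (Inr p) k + \<nu>"
      using kp by (intro poly_mapping_eqI) (auto simp: \<nu>_def lookup_add lookup_minus lookup_single when_def)
    have "Poly_Mapping.keys \<mu> \<subseteq> V" using q \<mu> by (auto simp: ypow_ideal_def carrier_bipoly_iff)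
    then have "Poly_Mapping.keys \<nu> \<subseteq> V" unfolding \<mu>_eq keys_add_nat by simp
    then have "Poly_Mapping.single \<nu> (lkp q \<mu>) \<in> carrier S" by (rule single_in_bipoly)
    moreover have "Poly_Mapping.single \<mu> (lkp q \<mu>) = 0 + ypow p k * Poly_Mapping.single \<nu> (lkp q \<mu>)"
      by (subst \<mu>_eq) (simp add: ypow_def mult_single)
    ultimately show ?thesis
      by (intro CollectI exI[of _ 0] exI[of _ "Poly_Mapping.single \<nu> (lkp q \<mu>)"])
        (auto simp: zero_in_ypow_ideal)
  qed
  have zero_J: "0 \<in> ?J"
    by (intro CollectI exI[of _ 0]) (auto simp: zero_in_ypow_ideal carrier_bipoly_iff)
  have "(\<Sum>\<mu>\<in>K. Poly_Mapping.single \<mu> (lkp q \<mu>)) \<in> ?J"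
    if "finite K" "K \<subseteq> Poly_Mapping.keys q" for K
    using that
  proof (induction K)
    case (insert \<mu> K)
    have "Poly_Mapping.single \<mu> (lkp q \<mu>) \<in> ?J" "(\<Sum>\<mu>\<in>K. Poly_Mapping.single \<mu> (lkp q \<mu>)) \<in> ?J"
      using insert.prems single_J insert.IH by simp_all
    from J_add[OF this] show ?case using insert.hyps by simp
  qed (use zero_J in simp)
  from this[OF finite_keys order_refl] show "q \<in> ?J"
    unfolding poly_mapping_sum_single[of q, symmetric] .
qed

lemma ypow_regular:
  assumes s: "s \<in> carrier S" and mem: "ypow p k \<otimes>\<^bsub>S\<^esub> s \<in> ypow_ideal l p"
  shows "s \<in> ypow_ideal l p"
  unfolding ypow_ideal_def
proof (intro CollectI conjI ballI s)
  fix \<mu> assume "\<mu> \<in> Poly_Mapping.keys s"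
  then have "Poly_Mapping.single (Inr p) k + \<mu> \<in> Poly_Mapping.keys (ypow p k * s)"
    by (simp add: keys_ypow_mult)
  then obtain j where "j < p" "l \<le> lkp (Poly_Mapping.single (Inr p) k + \<mu>) (Inr j)"
    using mem by (auto simp: ypow_ideal_def)
  then show "\<exists>j<p. l \<le> lkp \<mu> (Inr j)" by (auto simp: lookup_add lookup_single)
qed

lemma ypow_ideal_annihilates:
  assumes M: "module S M" and x: "x \<in> carrier M" and "p \<le> n"
    and kill: "\<And>j. j < p \<Longrightarrow> ypow j k \<odot>\<^bsub>M\<^esub> x = \<zero>\<^bsub>M\<^esub>"
    and r: "r \<in> ypow_ideal k p"
  shows "r \<odot>\<^bsub>M\<^esub> x = \<zero>\<^bsub>M\<^esub>"
  using assms(3-5)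
proof (induction p arbitrary: r)
  case 0
  interpret M: module S M by fact
  show ?case using 0 M.smult_l_null[OF x] by (simp add: ypow_ideal_0)
next
  case (Suc p)
  interpret M: module S M by fact
  obtain i s where i: "i \<in> ypow_ideal k p" and s: "s \<in> carrier S" and r: "r = i + ypow p k * s"
    using Suc.prems(3) unfolding ypow_ideal_Suc[OF Suc_le_lessD[OF Suc.prems(1)]] by auto
  have Y: "ypow p k \<in> carrier S" using Suc.prems(1) by simp
  have "(s \<otimes>\<^bsub>S\<^esub> ypow p k) \<odot>\<^bsub>M\<^esub> x = \<zero>\<^bsub>M\<^esub>"
    unfolding M.smult_assoc1[OF s Y x] using Suc.prems(2)[of p] s by simp
  moreover have "i \<odot>\<^bsub>M\<^esub> x = \<zero>\<^bsub>M\<^esub>" using Suc.IH i Suc.prems by simp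
  ultimately show ?case
    using M.smult_l_distr[OF ypow_ideal_subset[OF i] _ x, of "s \<otimes>\<^bsub>S\<^esub> ypow p k"] s Y
    by (simp add: r mult.commute bipoly_mult_closed)
qed

text \<open>
  The monomial \<open>(y\<^sub>0 \<cdots> y\<^sub>p\<^sub>-\<^sub>1)\<^sup>e\<close>. Multiplication by it embeds \<open>S/(y\<^sub>0\<^sup>k, \<dots>, y\<^sub>p\<^sub>-\<^sub>1\<^sup>k)\<close> into the
  quotient for the exponent \<open>k + e\<close>; injectivity is \<open>ymon_colon\<close>.
\<close>

fun ymon :: "nat \<Rightarrow> nat \<Rightarrow> 'k bipoly"
  where "ymon e 0 = 1" | "ymon e (Suc p) = ypow p e * ymon e p"

definition yexp :: "nat \<Rightarrow> nat \<Rightarrow> bimonom"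
  where "yexp e p = (\<Sum>j<p. Poly_Mapping.single (Inr j) e)"

lemma lookup_yexp: "lkp (yexp e p) (Inr j) = (if j < p then e else 0)" "lkp (yexp e p) (Inl i) = 0"
  by (simp_all add: yexp_def lookup_sum lookup_single when_def)

lemma ymon_eq: "ymon e p = (Poly_Mapping.single (yexp e p) 1 :: 'k bipoly)"
  by (induction p) (simp_all add: yexp_def ypow_def mult_single add.commute)

lemma ymon_in_bipoly: "p \<le> n \<Longrightarrow> ymon e p \<in> carrier S"
  by (induction p) (auto intro!: bipoly_mult_closed simp: carrier_bipoly_iff[of 1])

lemma ymon_colon:
  assumes g: "g \<in> carrier S" and mem: "ymon e p * g \<in> ypow_ideal (k + e) p"
  shows "g \<in> ypow_ideal k p"
  unfolding ypow_ideal_def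
proof (intro CollectI conjI ballI g)
  fix \<mu> assume "\<mu> \<in> Poly_Mapping.keys g"
  then have "yexp e p + \<mu> \<in> Poly_Mapping.keys (ymon e p * g)"
    by (simp add: ymon_eq keys_monomial_mult)
  then obtain j where "j < p" "k + e \<le> lkp (yexp e p + \<mu>) (Inr j)"
    using mem by (auto simp: ypow_ideal_def)
  then show "\<exists>j<p. k \<le> lkp \<mu> (Inr j)" by (auto simp: lookup_add lookup_yexp)
qed

lemma ymon_mult_mem:
  assumes "p \<le> n" "g \<in> ypow_ideal k p"
  shows "ymon e p * g \<in> ypow_ideal (k + e) p"
  unfolding ypow_ideal_def
proof (intro CollectI conjI ballI)
  show "ymon e p * g \<in> carrier S"
    using assms by (auto intro: bipoly_mult_closed ymon_in_bipoly ypow_ideal_subset)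
  fix \<mu> assume "\<mu> \<in> Poly_Mapping.keys (ymon e p * g)"
  then obtain \<nu> where "\<mu> = yexp e p + \<nu>" "\<nu> \<in> Poly_Mapping.keys g"
    by (auto simp: ymon_eq keys_monomial_mult)
  then show "\<exists>j<p. k + e \<le> lkp \<mu> (Inr j)"
    using assms(2) by (fastforce simp: ypow_ideal_def lookup_add lookup_yexp)
qed

lemma ypow_dvd_ymon: "j < p \<Longrightarrow> p \<le> n \<Longrightarrow> \<exists>r\<in>carrier S. ymon e p = r * ypow j e"
proof (induction p)
  case (Suc p)
  show ?case
  proof (cases "j = p")
    case True
    then show ?thesis using Suc.prems by (intro bexI[of _ "ymon e p"]) (auto simp: mult.commute ymon_in_bipoly)
  next
    case False
    then obtain r where "r \<in> carrier S" "ymon e p = r * ypow j e" using Suc.IH Suc.prems by auto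
    then show ?thesis using Suc.prems
      by (intro bexI[of _ "ypow p e * r"]) (auto simp: mult.assoc intro: bipoly_mult_closed)
  qed
qed simp

lemma ideal_y_eq: "ideal_y m n = (ypow_ideal 1 n :: 'k bipoly set)"
proof
  interpret cring S by (rule cring_bipoly)
  have Y: "var_y ` {..<n} \<subseteq> ypow_ideal 1 n"
    using ypow_mem[of _ n 1] by (auto simp: var_y_def ypow_def)
  show "ideal_y m n \<subseteq> (ypow_ideal 1 n :: 'k bipoly set)"
    unfolding ideal_y_def by (rule genideal_minimal[OF ideal_ypow_ideal Y])
  have c: "(var_y ` {..<n} :: 'k bipoly set) \<subseteq> carrier S"
    using Y ypow_ideal_subset by blast
  interpret Q: ideal "ideal_y m n :: 'k bipoly set" S
    unfolding ideal_y_def by (rule genideal_ideal[OF c])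
  have "ypow_ideal 1 p \<subseteq> (ideal_y m n :: 'k bipoly set)" if "p \<le> n" for p
    using that
  proof (induction p)
    case 0
    then show ?case using Q.zero_closed by (simp add: ypow_ideal_0)
  next
    case (Suc p)
    have "ypow p 1 \<in> (ideal_y m n :: 'k bipoly set)"
      using genideal_self[OF c] Suc.prems by (auto simp: ideal_y_def var_y_def ypow_def)
    then show ?case
      unfolding ypow_ideal_Suc[OF Suc_le_lessD[OF Suc.prems]]
      using Suc Q.I_r_closed Q.a_closed by fastforce
  qed
  then show "(ypow_ideal 1 n :: 'k bipoly set) \<subseteq> ideal_y m n" by blast
qed

text \<open>
  The powers of \<open>Q\<close> and the ideals generated by the \<open>y\<^sub>j\<^sup>k\<close> are cofinal: elements of \<open>Q\<^sup>N\<close> have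
  \<open>y\<close>-degree at least \<open>N\<close>, and a monomial of \<open>y\<close>-degree \<open>n k\<close> contains some \<open>y\<^sub>j\<^sup>k\<close>. Hence torsion
  can be tested on powers of single variables.
\<close>

lemma ideal_y_power_ydegree:
  assumes "q \<in> (ideal_y m n :: 'k bipoly set) [^]\<^bsub>ideals_set S\<^esub> N" "\<mu> \<in> Poly_Mapping.keys q"
  shows "N \<le> (\<Sum>j<n. lkp \<mu> (Inr j))"
  using assms
proof (induction N arbitrary: q \<mu>)
  case (Suc N)
  have "q \<in> ideal_prod S (ideal_y m n [^]\<^bsub>ideals_set S\<^esub> N) (ideal_y m n)"
    using Suc.prems(1) by (simp add: ideals_set_def nat_pow_def)
  then show ?case using Suc.prems(2)
  proof (induction q arbitrary: \<mu> rule: ideal_prod.induct)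
    case (prod i j)
    then obtain \<alpha> \<beta> where ab: "\<mu> = \<alpha> + \<beta>" "\<alpha> \<in> Poly_Mapping.keys i" "\<beta> \<in> Poly_Mapping.keys j"
      using keys_mult[of i j] by auto
    obtain l where l: "l < n" "1 \<le> lkp \<beta> (Inr l)"
      using prod(2) ab(3) by (auto simp: ideal_y_eq ypow_ideal_def)
    have "lkp \<beta> (Inr l) \<le> (\<Sum>j<n. lkp \<beta> (Inr j))"
      using l(1) by (intro member_le_sum) auto
    then show ?case
      using Suc.IH[OF prod(1) ab(2)] l(2) by (simp add: ab(1) lookup_add sum.distrib)
  next
    case (sum s1 s2)
    then show ?case using keys_add[of s1 s2] by auto
  qed
qed simp

lemma ypow_in_ideal_y_power:
  assumes "j < n"
  shows "ypow j N \<in> (ideal_y m n :: 'k bipoly set) [^]\<^bsub>ideals_set S\<^esub> N"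
proof (induction N)
  case 0
  show ?case by (simp add: ideals_set_def nat_pow_def carrier_bipoly_iff)
next
  case (Suc N)
  have "ypow j N \<otimes>\<^bsub>S\<^esub> ypow j 1 \<in> ideal_prod S (ideal_y m n [^]\<^bsub>ideals_set S\<^esub> N) (ideal_y m n)"
    using Suc ypow_mem[OF assms order_refl, of 1] by (intro ideal_prod.prod) (auto simp: ideal_y_eq)
  then show ?case using ypow_add[of j N 1] by (simp add: ideals_set_def nat_pow_def)
qed

lemma torsion_part_iff:
  assumes M: "module S M" and n: "n \<ge> 1"
  shows "x \<in> torsion_part S (ideal_y m n) M \<longleftrightarrow>
    x \<in> carrier M \<and> (\<exists>k. \<forall>j<n. ypow j k \<odot>\<^bsub>M\<^esub> x = \<zero>\<^bsub>M\<^esub>)"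
proof
  assume "x \<in> torsion_part S (ideal_y m n) M"
  then show "x \<in> carrier M \<and> (\<exists>k. \<forall>j<n. ypow j k \<odot>\<^bsub>M\<^esub> x = \<zero>\<^bsub>M\<^esub>)"
    using ypow_in_ideal_y_power unfolding torsion_part_def by blast
next
  assume "x \<in> carrier M \<and> (\<exists>k. \<forall>j<n. ypow j k \<odot>\<^bsub>M\<^esub> x = \<zero>\<^bsub>M\<^esub>)"
  then obtain k where x: "x \<in> carrier M" and k: "\<And>j. j < n \<Longrightarrow> ypow j k \<odot>\<^bsub>M\<^esub> x = \<zero>\<^bsub>M\<^esub>" by blast
  interpret cring S by (rule cring_bipoly)
  have idl: "ideal ((ideal_y m n :: 'k bipoly set) [^]\<^bsub>ideals_set S\<^esub> N) S" for N :: nat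
  proof (induction N)
    case 0
    show ?case using oneideal by (simp add: ideals_set_def nat_pow_def)
  next
    case (Suc N)
    then show ?case using ideal_prod_is_ideal[OF Suc] ideal_ypow_ideal[of 1 n]
      by (simp add: ideals_set_def nat_pow_def ideal_y_eq)
  qed
  have "q \<in> ypow_ideal k n" if q: "q \<in> (ideal_y m n :: 'k bipoly set) [^]\<^bsub>ideals_set S\<^esub> (n * k)" for q
    unfolding ypow_ideal_def
  proof (intro CollectI conjI ballI)
    show "q \<in> carrier S" using ideal.Icarr[OF idl q] .
    fix \<mu> assume \<mu>: "\<mu> \<in> Poly_Mapping.keys q"
    show "\<exists>j<n. k \<le> lkp \<mu> (Inr j)"
    proof (rule ccontr)
      assume "\<not> ?thesis"
      then have "(\<Sum>j<n. lkp \<mu> (Inr j)) < (\<Sum>j<n. k)"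
        using n by (intro sum_strict_mono) (auto simp: not_le lessThan_empty_iff bot_nat_def)
      then show False using ideal_y_power_ydegree[OF q \<mu>] by simp
    qed
  qed
  then show "x \<in> torsion_part S (ideal_y m n) M"
    unfolding torsion_part_def
    using ypow_ideal_annihilates[OF M x order_refl k] x by blast
qed

end

section \<open>Killing powers of the variables one after the other\<close>

text \<open>
  What is needed of an injective resolution of \<open>S/fS\<close>: elements can be divided by \<open>y\<^sub>p\<^sup>k\<close> inside the
  part killed by the previous powers, \<open>f\<close> lies in \<open>Q\<close>, and the whole complex has the two-term model
  \<open>f : S \<rightarrow> S\<close>.
  The module of degree \<open>i\<close> of the resolution is \<open>X (i + 2)\<close>; the two zero modules in front of it make
  room for the positions \<open>p\<close> and \<open>p + 1\<close> of the model in the case \<open>p = 0\<close>. The element \<open>v0\<close> is the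
  image of \<open>1 \<in> S/fS\<close>.
\<close>

locale divisible_complex = module_complex "bipoly_ring m n" X D
  for m n :: nat and X :: "nat \<Rightarrow> ('k::field bipoly, 'e) module" and D :: "nat \<Rightarrow> 'e \<Rightarrow> 'e" +
  fixes f :: "'k bipoly" and v0 :: 'e
  assumes divide: "\<And>p c k i. \<lbrakk>p < n; c \<in> carrier (X i);
        \<And>r. r \<in> ypow_ideal m n k p \<Longrightarrow> r \<odot>\<^bsub>X i\<^esub> c = \<zero>\<^bsub>X i\<^esub>\<rbrakk>
      \<Longrightarrow> \<exists>c'\<in>carrier (X i). ypow p k \<odot>\<^bsub>X i\<^esub> c' = c \<and> (\<forall>r\<in>ypow_ideal m n k p. r \<odot>\<^bsub>X i\<^esub> c' = \<zero>\<^bsub>X i\<^esub>)"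
    and f_mem: "f \<in> ypow_ideal m n 1 n"
    and model_0: "two_term_model (bipoly_ring m n) f {0} X D 0 \<zero>\<^bsub>X 1\<^esub> v0"
begin

abbreviation "S \<equiv> bipoly_ring m n :: 'k bipoly ring"
abbreviation "J \<equiv> ypow_ideal m n :: nat \<Rightarrow> nat \<Rightarrow> 'k bipoly set"

text \<open>
  \<open>C k p\<close> is the complex \<open>Hom(S/I, X)\<close> for \<open>I = (y\<^sub>0\<^sup>k, \<dots>, y\<^sub>p\<^sub>-\<^sub>1\<^sup>k)\<close>.
\<close>

definition C :: "nat \<Rightarrow> nat \<Rightarrow> nat \<Rightarrow> ('k bipoly, 'e) module"
  where "C k p i = (X i)\<lparr>carrier := {x \<in> carrier (X i). \<forall>j<p. ypow j k \<odot>\<^bsub>X i\<^esub> x = \<zero>\<^bsub>X i\<^esub>}\<rparr>"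

lemma C_simps [simp]:
  "add (C k p i) = add (X i)" "zero (C k p i) = zero (X i)" "smult (C k p i) = smult (X i)"
  by (simp_all add: C_def)

lemma carrier_C: "x \<in> carrier (C k p i) \<longleftrightarrow>
    x \<in> carrier (X i) \<and> (\<forall>j<p. ypow j k \<odot>\<^bsub>X i\<^esub> x = \<zero>\<^bsub>X i\<^esub>)"
  by (simp add: C_def)

lemma carrier_C_iff:
  assumes "p \<le> n"
  shows "x \<in> carrier (C k p i) \<longleftrightarrow> x \<in> carrier (X i) \<and> (\<forall>r\<in>J k p. r \<odot>\<^bsub>X i\<^esub> x = \<zero>\<^bsub>X i\<^esub>)"
  using ypow_ideal_annihilates[OF mod _ assms] ypow_mem[OF _ assms] unfolding carrier_C by blast

lemma C_0: "C k 0 i = X i"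
  by (simp add: C_def)

lemma C_Suc: "C k (Suc p) = (\<lambda>i. annihilated (ypow p k) (C k p i))"
  by (rule ext) (auto simp: C_def annihilated_def less_Suc_eq intro!: arg_cong2[where f = "\<lambda>x y. y\<lparr>carrier := x\<rparr>"])

lemma f_in: "f \<in> carrier S"
  using f_mem by (rule ypow_ideal_subset)

lemma submodule_C:
  assumes "p \<le> n"
  shows "submodule (carrier (C k p i)) S (X i)"
proof -
  have "carrier (C k p i) = {x \<in> carrier (X i). \<forall>a\<in>(\<lambda>j. ypow j k) ` {..<p}. a \<odot>\<^bsub>X i\<^esub> x = \<zero>\<^bsub>X i\<^esub>}"
    by (auto simp: carrier_C)
  then show ?thesis
    using assms by (auto simp del: ball_simps intro!: module.submodule_kernel_smult[OF mod])
qed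

lemma complex_C:
  assumes p: "p \<le> n"
  shows "module_complex S (C k p) D"
proof (rule module_complex.intro)
  fix i
  have "C k p i = (X i)\<lparr>carrier := carrier (C k p i)\<rparr>" by (simp add: C_def)
  then show "module S (C k p i)"
    using submodule.submodule_is_module[OF submodule_C[OF p] mod] by metis
  show "D i \<in> mod_hom S (C k p i) (C k p (Suc i))"
  proof (rule mod_homI)
    fix x assume "x \<in> carrier (C k p i)"
    then have x: "x \<in> carrier (X i)" "\<And>j. j < p \<Longrightarrow> ypow j k \<odot>\<^bsub>X i\<^esub> x = \<zero>\<^bsub>X i\<^esub>"
      by (auto simp: carrier_C)
    have "ypow j k \<odot>\<^bsub>X (Suc i)\<^esub> D i x = \<zero>\<^bsub>X (Suc i)\<^esub>" if "j < p" for j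
      using D_smult[of "ypow j k" x i] x that p by (simp add: D_zero)
    then show "D i x \<in> carrier (C k p (Suc i))"
      using x by (simp add: carrier_C D_closed)
  qed (auto simp: carrier_C D_add D_smult)
qed (auto simp: carrier_C D_D)

text \<open>
  The pairs \<open>u\<close>, \<open>v\<close> that arise from \<open>0\<close>, \<open>v0\<close> by \<open>p\<close> steps. They depend on choices, therefore
  this is a relation; pairs for different exponents \<open>k\<close> are related by \<open>tower_scale\<close>.
\<close>

inductive tower :: "nat \<Rightarrow> nat \<Rightarrow> 'e \<Rightarrow> 'e \<Rightarrow> bool" for k
  where
    base: "tower k 0 \<zero>\<^bsub>X 1\<^esub> v0"
  | step: "\<lbrakk>tower k p u v; p < n;
      u' \<in> carrier (C k p (Suc p)); ypow p k \<odot>\<^bsub>X (Suc p)\<^esub> u' = u;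
      v' \<in> carrier (C k p (Suc (Suc p))); ypow p k \<odot>\<^bsub>X (Suc (Suc p))\<^esub> v' = v;
      w \<in> carrier (C k p (Suc (Suc p)));
      f \<odot>\<^bsub>X (Suc (Suc p))\<^esub> v' = w \<oplus>\<^bsub>X (Suc (Suc p))\<^esub> D (Suc p) u'\<rbrakk>
    \<Longrightarrow> tower k (Suc p) w (D (Suc (Suc p)) v')"

lemma divide_C:
  assumes p: "p < n" and x: "x \<in> carrier (C k p i)"
  shows "\<exists>x'\<in>carrier (C k p i). ypow p k \<odot>\<^bsub>C k p i\<^esub> x' = x"
  using divide[OF p, of x i k] x p by (auto simp: carrier_C_iff)

lemma tower_model: "tower k p u v \<Longrightarrow> two_term_model S f (J k p) (C k p) D p u v"
proof (induction rule: tower.induct)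
  case base
  have "C k 0 = X" by (rule ext) (rule C_0)
  then show ?case using model_0 by (simp add: ypow_ideal_0)
next
  case (step p u v u' v' w)
  interpret C: module_complex S "C k p" D using step.hyps(2) by (intro complex_C) simp
  show ?case
    unfolding ypow_ideal_Suc[OF step.hyps(2)] C_Suc[of k p]
  proof (rule C.two_term_model_step)
    show "f \<in> carrier S" by (rule f_in)
    show "ypow p k \<in> carrier S" using step.hyps(2) by simp
    show "ideal (J k p) S" by (rule ideal_ypow_ideal)
    show "\<exists>x'\<in>carrier (C k p i). ypow p k \<odot>\<^bsub>C k p i\<^esub> x' = x" if "x \<in> carrier (C k p i)" for i x
      using divide_C[OF step.hyps(2) that] .
    show "r \<odot>\<^bsub>C k p i\<^esub> x = \<zero>\<^bsub>C k p i\<^esub>" if "r \<in> J k p" "x \<in> carrier (C k p i)" for r i x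
      using that step.hyps(2) by (simp add: carrier_C_iff)
  qed (use step in auto)
qed

text \<open>
  The last property is the second exactness condition for cocycles, that is for \<open>h = 0\<close>.
\<close>

lemma modelD:
  assumes "tower k p u v"
  shows "u \<in> carrier (C k p (Suc p))" "v \<in> carrier (C k p (Suc (Suc p)))"
    "D (Suc p) u = f \<odot>\<^bsub>X (Suc (Suc p))\<^esub> v"
    "\<And>z g. z \<in> carrier (C k p p) \<Longrightarrow> g \<in> carrier S \<Longrightarrow> D p z = g \<odot>\<^bsub>X (Suc p)\<^esub> u \<Longrightarrow> g * f \<in> J k p \<Longrightarrow> g \<in> J k p"
    "\<And>z. z \<in> carrier (C k p (Suc p)) \<Longrightarrow> D (Suc p) z = \<zero>\<^bsub>X (Suc (Suc p))\<^esub> \<Longrightarrow>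
      \<exists>g\<in>carrier S. \<exists>w\<in>carrier (C k p p). z = g \<odot>\<^bsub>X (Suc p)\<^esub> u \<oplus>\<^bsub>X (Suc p)\<^esub> D p w \<and> g * f \<in> J k p"
proof -
  note M = tower_model[OF assms, unfolded two_term_model_def]
  show "u \<in> carrier (C k p (Suc p))" "v \<in> carrier (C k p (Suc (Suc p)))"
    "D (Suc p) u = f \<odot>\<^bsub>X (Suc (Suc p))\<^esub> v"
    "\<And>z g. z \<in> carrier (C k p p) \<Longrightarrow> g \<in> carrier S \<Longrightarrow> D p z = g \<odot>\<^bsub>X (Suc p)\<^esub> u \<Longrightarrow> g * f \<in> J k p \<Longrightarrow> g \<in> J k p"
    using M by auto
  fix z assume z: "z \<in> carrier (C k p (Suc p))" "D (Suc p) z = \<zero>\<^bsub>X (Suc (Suc p))\<^esub>"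
  have v: "v \<in> carrier (X (Suc (Suc p)))" using M by (auto simp: carrier_C)
  have S0: "0 \<in> carrier S" by (simp add: bipoly_ring_def)
  have "0 \<odot>\<^bsub>X (Suc (Suc p))\<^esub> v = \<zero>\<^bsub>X (Suc (Suc p))\<^esub>" using zero_smult'[OF v] by simp
  then have "\<exists>g\<in>carrier S. \<exists>w\<in>carrier (C k p p). z = g \<odot>\<^bsub>X (Suc p)\<^esub> u \<oplus>\<^bsub>X (Suc p)\<^esub> D p w \<and> 0 \<ominus>\<^bsub>S\<^esub> g * f \<in> J k p"
    using M z S0 by simp
  then obtain g w where gw: "g \<in> carrier S" "w \<in> carrier (C k p p)"
    "z = g \<odot>\<^bsub>X (Suc p)\<^esub> u \<oplus>\<^bsub>X (Suc p)\<^esub> D p w" "0 \<ominus>\<^bsub>S\<^esub> g * f \<in> J k p" by blast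
  have "g * f \<in> carrier S" using gw(1) f_in by (rule bipoly_mult_closed)
  then have "- (g * f) \<in> J k p" using gw(4) S0 by (simp add: bipoly_a_minus)
  then have "g * f \<in> J k p"
    by (simp add: ypow_ideal_def carrier_bipoly_iff)
  then show "\<exists>g\<in>carrier S. \<exists>w\<in>carrier (C k p p). z = g \<odot>\<^bsub>X (Suc p)\<^esub> u \<oplus>\<^bsub>X (Suc p)\<^esub> D p w \<and> g * f \<in> J k p"
    using gw by blast
qed

lemma tower_exists: "p \<le> n \<Longrightarrow> \<exists>u v. tower k p u v"
proof (induction p)
  case 0
  show ?case using tower.base by blast
next
  case (Suc p)
  then obtain u v where t: "tower k p u v" by auto
  have p: "p < n" using Suc.prems by simp
  interpret C: module_complex S "C k p" D using p by (intro complex_C) simp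
  obtain u' where u': "u' \<in> carrier (C k p (Suc p))" "ypow p k \<odot>\<^bsub>X (Suc p)\<^esub> u' = u"
    using divide_C[OF p modelD(1)[OF t]] by auto
  obtain v' where v': "v' \<in> carrier (C k p (Suc (Suc p)))" "ypow p k \<odot>\<^bsub>X (Suc (Suc p))\<^esub> v' = v"
    using divide_C[OF p modelD(2)[OF t]] by auto
  have fv: "f \<odot>\<^bsub>X (Suc (Suc p))\<^esub> v' \<in> carrier (C k p (Suc (Suc p)))"
    using C.smult_closed'[OF f_in v'(1)] by simp
  have Y: "ypow p k \<in> carrier S" using p by simp
  have "ypow p k \<odot>\<^bsub>C k p (Suc (Suc p))\<^esub> (f \<odot>\<^bsub>X (Suc (Suc p))\<^esub> v') = f \<odot>\<^bsub>X (Suc (Suc p))\<^esub> v"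
    using C.smult_assoc'[OF Y f_in v'(1)] C.smult_assoc'[OF f_in Y v'(1)] v'(2) by (simp add: mult.commute)
  moreover have "ypow p k \<odot>\<^bsub>C k p (Suc (Suc p))\<^esub> D (Suc p) u' = D (Suc p) u"
    using C.D_smult[OF Y u'(1)] u'(2) by simp
  ultimately obtain w where w: "w \<in> carrier (C k p (Suc (Suc p)))"
    "f \<odot>\<^bsub>X (Suc (Suc p))\<^esub> v' = D (Suc p) u' \<oplus>\<^bsub>C k p (Suc (Suc p))\<^esub> w"
    using module.smult_eq_smultE[OF C.mod Y fv C.D_closed[OF u'(1)]] modelD(3)[OF t] by metis
  have "f \<odot>\<^bsub>X (Suc (Suc p))\<^esub> v' = w \<oplus>\<^bsub>X (Suc (Suc p))\<^esub> D (Suc p) u'"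
    using w C.a_comm'[OF w(1) C.D_closed[OF u'(1)]] by simp
  then show ?case using tower.step[OF t p u' v' w(1)] by blast
qed

lemma smult_comm:
  assumes "r \<in> carrier S" "s \<in> carrier S" "x \<in> carrier (X i)"
  shows "r \<odot>\<^bsub>X i\<^esub> (s \<odot>\<^bsub>X i\<^esub> x) = s \<odot>\<^bsub>X i\<^esub> (r \<odot>\<^bsub>X i\<^esub> x)"
  using smult_assoc'[OF assms] smult_assoc'[OF assms(2,1,3)] by (simp add: mult.commute)

lemma ymon_smult_C:
  assumes p: "p \<le> n" and x: "x \<in> carrier (C (k + e) p i)"
  shows "ymon e p \<odot>\<^bsub>X i\<^esub> x \<in> carrier (C k p i)"
  unfolding carrier_C
proof (intro conjI allI impI)
  have xX: "x \<in> carrier (X i)" using x by (simp add: carrier_C)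
  show "ymon e p \<odot>\<^bsub>X i\<^esub> x \<in> carrier (X i)"
    using xX ymon_in_bipoly[OF p] by (intro smult_closed')
  fix j assume j: "j < p"
  obtain r where r: "r \<in> carrier S" "ymon e p = r * ypow j e"
    using ypow_dvd_ymon[OF j p] by blast
  have Y: "ypow j l \<in> carrier S" for l using j p by simp
  have "ypow j k \<odot>\<^bsub>X i\<^esub> (ymon e p \<odot>\<^bsub>X i\<^esub> x) = (ypow j k * ymon e p) \<odot>\<^bsub>X i\<^esub> x"
    using smult_assoc'[OF Y ymon_in_bipoly[OF p] xX] by simp
  also have "ypow j k * ymon e p = r * ypow j (k + e)"
    by (simp add: r(2) ypow_add mult_ac)
  also have "(r * ypow j (k + e)) \<odot>\<^bsub>X i\<^esub> x = r \<odot>\<^bsub>X i\<^esub> (ypow j (k + e) \<odot>\<^bsub>X i\<^esub> x)"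
    using smult_assoc'[OF r(1) Y xX] by simp
  also have "\<dots> = \<zero>\<^bsub>X i\<^esub>"
    using x j r(1) by (simp add: carrier_C smult_zero')
  finally show "ypow j k \<odot>\<^bsub>X i\<^esub> (ymon e p \<odot>\<^bsub>X i\<^esub> x) = \<zero>\<^bsub>X i\<^esub>" .
qed

text \<open>
  If \<open>v'\<close> divides \<open>v\<close> by \<open>y\<^sub>p\<^sup>k\<^sup>+\<^sup>e\<close>, then \<open>(y\<^sub>0 \<cdots> y\<^sub>p)\<^sup>e v'\<close> divides \<open>(y\<^sub>0 \<cdots> y\<^sub>p\<^sub>-\<^sub>1)\<^sup>e v\<close> by \<open>y\<^sub>p\<^sup>k\<close>, so
  the whole construction can be multiplied by these monomials.
\<close>

lemma tower_scale:
  "tower (k + e) p u v \<Longrightarrow> tower k p (ymon e p \<odot>\<^bsub>X (Suc p)\<^esub> u) (ymon e p \<odot>\<^bsub>X (Suc (Suc p))\<^esub> v)"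
proof (induction rule: tower.induct)
  case base
  have "v0 \<in> carrier (X 2)" using model_0 by (simp add: two_term_model_def numeral_2_eq_2)
  then show ?case
    using tower.base[of k] smult_one'[of v0 2] smult_one'[OF zero_closed', of 1] by (simp add: numeral_2_eq_2)
next
  case (step p u v u' v' w)
  let ?X1 = "X (Suc p)" and ?X2 = "X (Suc (Suc p))"
  define a :: "'k bipoly" where "a = ypow p e"
  define b :: "'k bipoly" where "b = ymon e p"
  have Y: "ypow p l \<in> carrier S" for l using step.hyps(2) by simp
  have p: "p \<le> n" using step.hyps(2) by simp
  have a: "a \<in> carrier S" using Y by (simp add: a_def)
  have b: "b \<in> carrier S" using ymon_in_bipoly[OF p] by (simp add: b_def)
  have ba: "b * a \<in> carrier S" by (rule bipoly_mult_closed[OF b a])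
  have ym: "ymon e (Suc p) = b * a" by (simp add: a_def b_def mult.commute)
  have X: "u' \<in> carrier ?X1" "v' \<in> carrier ?X2" "w \<in> carrier ?X2"
    using step.hyps by (auto simp: carrier_C)
  have in_C: "(b * a) \<odot>\<^bsub>X i\<^esub> x \<in> carrier (C k p i)" if x: "x \<in> carrier (C (k + e) p i)" for x i
  proof -
    interpret C: module_complex S "C k p" D using p by (rule complex_C)
    have "(b * a) \<odot>\<^bsub>X i\<^esub> x = a \<odot>\<^bsub>X i\<^esub> (b \<odot>\<^bsub>X i\<^esub> x)"
      using smult_assoc'[OF a b] x by (simp add: carrier_C mult.commute)
    then show ?thesis
      using C.smult_closed'[OF a ymon_smult_C[OF p x]] by (simp add: b_def)
  qed
  have scale: "ypow p k \<odot>\<^bsub>X i\<^esub> ((b * a) \<odot>\<^bsub>X i\<^esub> x) = b \<odot>\<^bsub>X i\<^esub> (ypow p (k + e) \<odot>\<^bsub>X i\<^esub> x)"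
    if "x \<in> carrier (X i)" for x i
  proof -
    have "ypow p k * (b * a) = b * ypow p (k + e)" by (simp add: a_def ypow_add mult_ac)
    then show ?thesis using smult_assoc'[OF Y ba that, of k] smult_assoc'[OF b Y that, of "k + e"] by simp
  qed
  have "tower k (Suc p) ((b * a) \<odot>\<^bsub>?X2\<^esub> w) (D (Suc (Suc p)) ((b * a) \<odot>\<^bsub>?X2\<^esub> v'))"
  proof (rule tower.step[OF step.IH step.hyps(2)])
    show "(b * a) \<odot>\<^bsub>?X1\<^esub> u' \<in> carrier (C k p (Suc p))"
      "(b * a) \<odot>\<^bsub>?X2\<^esub> v' \<in> carrier (C k p (Suc (Suc p)))"
      "(b * a) \<odot>\<^bsub>?X2\<^esub> w \<in> carrier (C k p (Suc (Suc p)))"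
      using step.hyps by (auto intro: in_C)
    show "ypow p k \<odot>\<^bsub>?X1\<^esub> ((b * a) \<odot>\<^bsub>?X1\<^esub> u') = ymon e p \<odot>\<^bsub>?X1\<^esub> u"
      "ypow p k \<odot>\<^bsub>?X2\<^esub> ((b * a) \<odot>\<^bsub>?X2\<^esub> v') = ymon e p \<odot>\<^bsub>?X2\<^esub> v"
      using scale X step.hyps by (simp_all add: b_def)
    have "f \<odot>\<^bsub>?X2\<^esub> ((b * a) \<odot>\<^bsub>?X2\<^esub> v') = (b * a) \<odot>\<^bsub>?X2\<^esub> (w \<oplus>\<^bsub>?X2\<^esub> D (Suc p) u')"
      using smult_comm[OF f_in ba X(2)] step.hyps by simp
    also have "\<dots> = (b * a) \<odot>\<^bsub>?X2\<^esub> w \<oplus>\<^bsub>?X2\<^esub> D (Suc p) ((b * a) \<odot>\<^bsub>?X1\<^esub> u')"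
      using ba X by (simp add: smult_r_distr' D_closed D_smult)
    finally show "f \<odot>\<^bsub>?X2\<^esub> ((b * a) \<odot>\<^bsub>?X2\<^esub> v') = (b * a) \<odot>\<^bsub>?X2\<^esub> w \<oplus>\<^bsub>?X2\<^esub> D (Suc p) ((b * a) \<odot>\<^bsub>?X1\<^esub> u')" .
  qed
  then show ?case unfolding ym using D_smult[OF ba X(2)] by simp
qed

lemma C_mono:
  assumes "k \<le> l" "p \<le> n" "x \<in> carrier (C k p i)"
  shows "x \<in> carrier (C l p i)"
  unfolding carrier_C
proof (intro conjI allI impI)
  show "x \<in> carrier (X i)" using assms(3) by (simp add: carrier_C)
  fix j assume j: "j < p"
  obtain e where e: "l = e + k" using assms(1) by (metis add.commute le_Suc_ex)
  show "ypow j l \<odot>\<^bsub>X i\<^esub> x = \<zero>\<^bsub>X i\<^esub>"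
    using smult_assoc'[of "ypow j e" "ypow j k" x i] assms j by (simp add: e ypow_add carrier_C smult_zero')
qed

text \<open>
  For \<open>l = k\<close> this is part of the two-term model. In general \<open>w\<close> is only killed by higher powers,
  and the claim is that the transition maps between the cohomology modules for different exponents
  are injective. Let \<open>U\<close> belong to a tower for \<open>k + l\<close>. Then \<open>\<pi> U\<close> belongs to a tower for \<open>k\<close>, so the
  cocycle \<open>g u\<close> is \<open>g\<^sub>1 \<pi> U\<close> up to a coboundary for \<open>k\<close>. As \<open>g u\<close> is a coboundary for \<open>k + l\<close>, the
  model for \<open>k + l\<close> puts \<open>g\<^sub>1 \<pi>\<close> into the ideal for \<open>k + l\<close>. Hence \<open>g\<^sub>1\<close> lies in the ideal for \<open>k\<close>,
  and \<open>g u\<close> is a coboundary for \<open>k\<close>.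
\<close>

lemma coboundary_imp_mem:
  assumes t: "tower k n u v" and g: "g \<in> carrier S" and gf: "g * f \<in> J k n"
    and w: "w \<in> carrier (C l n n)" and dw: "D n w = g \<odot>\<^bsub>X (Suc n)\<^esub> u"
  shows "g \<in> J k n"
proof -
  \<comment> \<open>\<open>k + l\<close> is large enough for \<open>w\<close> and at least \<open>k\<close>\<close>
  define e where "e = l"
  have w: "w \<in> carrier (C (k + e) n n)" by (rule C_mono[OF _ order_refl w]) (simp add: e_def)
  obtain U V where T: "tower (k + e) n U V" using tower_exists[of n] by blast
  define \<pi> where "\<pi> = (ymon e n :: 'k bipoly)"
  have \<pi>: "\<pi> \<in> carrier S" by (simp add: \<pi>_def ymon_in_bipoly)
  interpret C: module_complex S "C k n" D by (rule complex_C) simp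
  interpret C': module_complex S "C (k + e) n" D by (rule complex_C) simp
  have u: "u \<in> carrier (C k n (Suc n))" and v: "v \<in> carrier (C k n (Suc (Suc n)))"
    by (rule modelD[OF t])+
  have t': "tower k n (\<pi> \<odot>\<^bsub>X (Suc n)\<^esub> U) (\<pi> \<odot>\<^bsub>X (Suc (Suc n))\<^esub> V)"
    unfolding \<pi>_def by (rule tower_scale[OF T])
  have U: "U \<in> carrier (X (Suc n))" using modelD(1)[OF T] by (simp add: carrier_C)
  have "D (Suc n) (g \<odot>\<^bsub>X (Suc n)\<^esub> u) = (g * f) \<odot>\<^bsub>X (Suc (Suc n))\<^esub> v"
    using C.D_smult[OF g u] modelD(3)[OF t] C.smult_assoc'[OF g f_in v] by simp
  also have "\<dots> = \<zero>\<^bsub>X (Suc (Suc n))\<^esub>" using v gf by (simp add: carrier_C_iff)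
  finally obtain g1 w1 where g1: "g1 \<in> carrier S" "g1 * f \<in> J k n" and w1: "w1 \<in> carrier (C k n n)"
    and eq: "g \<odot>\<^bsub>X (Suc n)\<^esub> u = g1 \<odot>\<^bsub>X (Suc n)\<^esub> (\<pi> \<odot>\<^bsub>X (Suc n)\<^esub> U) \<oplus>\<^bsub>X (Suc n)\<^esub> D n w1"
    using modelD(5)[OF t', of "g \<odot>\<^bsub>X (Suc n)\<^esub> u"] C.smult_closed'[OF g u] by auto
  have w1': "w1 \<in> carrier (C (k + e) n n)" by (rule C_mono[OF _ order_refl w1]) simp
  define w2 where "w2 = w \<oplus>\<^bsub>X n\<^esub> (- 1) \<odot>\<^bsub>X n\<^esub> w1"
  have m1: "- 1 \<in> carrier S" by (simp add: carrier_bipoly_iff)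
  have w2: "w2 \<in> carrier (C (k + e) n n)"
    using C'.add_closed'[OF w C'.smult_closed'[OF m1 w1']] by (simp add: w2_def)
  have W: "w \<in> carrier (X n)" "w1 \<in> carrier (X n)" using w w1 by (auto simp: carrier_C)
  have g1\<pi>: "g1 * \<pi> \<in> carrier S" by (rule bipoly_mult_closed[OF g1(1) \<pi>])
  have "D n w2 = (g1 * \<pi>) \<odot>\<^bsub>X (Suc n)\<^esub> U"
  proof -
    have c: "g1 \<odot>\<^bsub>X (Suc n)\<^esub> (\<pi> \<odot>\<^bsub>X (Suc n)\<^esub> U) \<in> carrier (X (Suc n))"
      using g1 \<pi> U by (simp add: closed')
    have "D n w1 \<oplus>\<^bsub>X (Suc n)\<^esub> (- 1) \<odot>\<^bsub>X (Suc n)\<^esub> D n w1 = (1 \<oplus>\<^bsub>S\<^esub> - 1) \<odot>\<^bsub>X (Suc n)\<^esub> D n w1"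
      using smult_l_distr'[of 1 "- 1" "D n w1" "Suc n"] m1 W smult_one'[of "D n w1" "Suc n"]
      by (simp add: D_closed carrier_bipoly_iff)
    also have "\<dots> = \<zero>\<^bsub>X (Suc n)\<^esub>"
      using zero_smult'[of "D n w1" "Suc n"] W by (simp add: D_closed)
    finally have *: "D n w1 \<oplus>\<^bsub>X (Suc n)\<^esub> (- 1) \<odot>\<^bsub>X (Suc n)\<^esub> D n w1 = \<zero>\<^bsub>X (Suc n)\<^esub>" .
    have "D n w2 = g1 \<odot>\<^bsub>X (Suc n)\<^esub> (\<pi> \<odot>\<^bsub>X (Suc n)\<^esub> U) \<oplus>\<^bsub>X (Suc n)\<^esub> (D n w1 \<oplus>\<^bsub>X (Suc n)\<^esub> (- 1) \<odot>\<^bsub>X (Suc n)\<^esub> D n w1)"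
      unfolding w2_def using W m1 dw c by (simp add: D_add D_smult closed' eq a_assoc')
    also have "\<dots> = (g1 * \<pi>) \<odot>\<^bsub>X (Suc n)\<^esub> U"
      unfolding * using c r_zero' smult_assoc'[OF g1(1) \<pi> U] by simp
    finally show ?thesis .
  qed
  moreover have "g1 * \<pi> * f \<in> J (k + e) n"
    using ymon_mult_mem[OF order_refl g1(2), of e] by (simp add: \<pi>_def mult_ac)
  ultimately have "g1 * \<pi> \<in> J (k + e) n"
    using modelD(4)[OF T w2 g1\<pi>] by blast
  then have "g1 \<in> J k n"
    using ymon_colon[OF g1(1), of e n k] by (simp add: \<pi>_def mult.commute)
  then have "g1 \<odot>\<^bsub>X (Suc n)\<^esub> (\<pi> \<odot>\<^bsub>X (Suc n)\<^esub> U) = \<zero>\<^bsub>X (Suc n)\<^esub>"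
    using modelD(1)[OF t'] by (simp add: carrier_C_iff)
  then have "D n w1 = g \<odot>\<^bsub>X (Suc n)\<^esub> u"
    using eq W by (simp add: closed' l_zero')
  then show ?thesis using modelD(4)[OF t w1 g _ gf] by blast
qed

end

section \<open>The cohomology module in degree n - 1\<close>

context divisible_complex
begin

text \<open>
  \<open>T\<close> is \<open>\<Gamma>\<^sub>Q(X)\<close>. Because of the shift by two, degree \<open>n - 1\<close> of the resolution is position
  \<open>n + 1\<close> of \<open>X\<close>; there \<open>Z\<close>, \<open>B\<close> and \<open>H\<close> are the cocycles, the coboundaries and the cohomology of \<open>T\<close>.
\<close>

definition T :: "nat \<Rightarrow> 'e set"
  where "T i = {x \<in> carrier (X i). \<exists>k. \<forall>j<n. ypow j k \<odot>\<^bsub>X i\<^esub> x = \<zero>\<^bsub>X i\<^esub>}"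

lemma T_iff: "x \<in> T i \<longleftrightarrow> (\<exists>k. x \<in> carrier (C k n i))"
  by (auto simp: T_def carrier_C)

lemma submodule_T: "submodule (T i) S (X i)"
proof -
  interpret M: module S "X i" by (rule mod)
  show ?thesis
  proof (rule M.submodule_criterion)
    show "\<zero>\<^bsub>X i\<^esub> \<in> T i"
      by (auto simp: T_def)
    fix x y assume "x \<in> T i" "y \<in> T i"
    then obtain k l where "x \<in> carrier (C k n i)" "y \<in> carrier (C l n i)" by (auto simp: T_iff)
    then have "x \<in> carrier (C (max k l) n i)" "y \<in> carrier (C (max k l) n i)"
      by (auto intro: C_mono[rotated 2])
    then have "x \<oplus>\<^bsub>X i\<^esub> y \<in> carrier (C (max k l) n i)"
      using M.submoduleE(5)[OF submodule_C[OF order_refl]] by blast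
    then show "x \<oplus>\<^bsub>X i\<^esub> y \<in> T i" by (auto simp: T_iff)
  next
    fix r x assume "r \<in> carrier S" "x \<in> T i"
    then show "r \<odot>\<^bsub>X i\<^esub> x \<in> T i"
      using M.submoduleE(4)[OF submodule_C[OF order_refl]] by (auto simp: T_iff)
  qed (auto simp: T_def)
qed

lemma D_T:
  assumes "x \<in> T i"
  shows "D i x \<in> T (Suc i)"
  using assms module_complex.D_closed[OF complex_C[OF order_refl]] by (auto simp: T_iff)

definition Z :: "('k bipoly, 'e) module"
  where "Z = (X (Suc n))\<lparr>carrier := {z \<in> T (Suc n). D (Suc n) z = \<zero>\<^bsub>X (Suc (Suc n))\<^esub>}\<rparr>"

definition B :: "'e set"
  where "B = D n ` T n"

definition H :: "('k bipoly, 'e set) module"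
  where "H = quotient_module Z B"

abbreviation cl :: "'e \<Rightarrow> 'e set"
  where "cl z \<equiv> B +>\<^bsub>Z\<^esub> z"

lemma Z_simps [simp]:
  "add Z = add (X (Suc n))" "zero Z = zero (X (Suc n))" "smult Z = smult (X (Suc n))"
  by (simp_all add: Z_def)

lemma carrier_Z: "z \<in> carrier Z \<longleftrightarrow> z \<in> T (Suc n) \<and> D (Suc n) z = \<zero>\<^bsub>X (Suc (Suc n))\<^esub>"
  by (simp add: Z_def)

lemma T_closed: "x \<in> T i \<Longrightarrow> x \<in> carrier (X i)"
  by (simp add: T_def)

lemma module_Z: "module S Z"
proof -
  interpret M: module S "X (Suc n)" by (rule mod)
  note E = M.submoduleE[OF submodule_T] subgroup.one_closed[OF submodule.axioms(1)[OF submodule_T]]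
  have "submodule {z \<in> T (Suc n). D (Suc n) z = \<zero>\<^bsub>X (Suc (Suc n))\<^esub>} S (X (Suc n))"
    using E by (intro M.submodule_criterion)
      (auto simp: D_zero D_add D_smult T_closed l_zero' zero_closed' smult_zero')
  then show ?thesis
    unfolding Z_def by (rule submodule.submodule_is_module[OF _ mod])
qed

sublocale Z: module S Z by (rule module_Z)

lemma submodule_B: "submodule B S Z"
proof (rule Z.submodule_criterion)
  note E = module.submoduleE[OF mod submodule_T]
  show "B \<subseteq> carrier Z" by (auto simp: B_def carrier_Z D_T D_D T_closed)
  have "\<zero>\<^bsub>X n\<^esub> \<in> T n"
    using subgroup.one_closed[OF submodule.axioms(1)[OF submodule_T]] by simp
  then show "\<zero>\<^bsub>Z\<^esub> \<in> B" unfolding B_def using D_zero[of n] by (intro image_eqI[of _ _ "\<zero>\<^bsub>X n\<^esub>"]) auto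
  fix x y assume "x \<in> B" "y \<in> B"
  then obtain x' y' where "x' \<in> T n" "y' \<in> T n" "x = D n x'" "y = D n y'" by (auto simp: B_def)
  then show "x \<oplus>\<^bsub>Z\<^esub> y \<in> B"
    unfolding B_def using E(5) by (intro image_eqI[of _ _ "x' \<oplus>\<^bsub>X n\<^esub> y'"]) (auto simp: D_add T_closed)
next
  note E = module.submoduleE[OF mod submodule_T]
  fix r x assume r: "r \<in> carrier S" and "x \<in> B"
  then obtain x' where "x' \<in> T n" "x = D n x'" by (auto simp: B_def)
  then show "r \<odot>\<^bsub>Z\<^esub> x \<in> B"
    unfolding B_def using E(4) r by (intro image_eqI[of _ _ "r \<odot>\<^bsub>X n\<^esub> x'"]) (auto simp: D_smult T_closed)
qed

lemma module_H: "module S H"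
  unfolding H_def by (rule module_quotient[OF module_Z submodule_B])

lemmas carrier_H = carrier_quotient[OF module_Z submodule_B, folded H_def]
lemmas zero_H = zero_quotient[OF module_Z submodule_B, folded H_def]
lemmas add_H = quotient_add[OF module_Z submodule_B, folded H_def]
lemmas smult_H = quotient_smult[OF module_Z submodule_B, folded H_def]
lemmas cl_eq_iff = quotient_eq_iff[OF module_Z submodule_B]
lemmas cl_eq_zero_iff = quotient_eq_zero_iff[OF module_Z submodule_B]

lemma cl_zero: "cl \<zero>\<^bsub>X (Suc n)\<^esub> = \<zero>\<^bsub>H\<^esub>"
  using cl_eq_zero_iff[OF Z.M.zero_closed] subgroup.one_closed[OF submodule.axioms(1)[OF submodule_B]]
  by (simp add: zero_H)

text \<open>
  For \<open>k = 1\<close> the form \<open>f\<close> lies in \<open>(y\<^sub>0, \<dots>, y\<^sub>n\<^sub>-\<^sub>1)\<close>, which kills \<open>v\<close>; so \<open>d u = f v = 0\<close>. The class of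
  \<open>u\<close> corresponds to the inverse monomial \<open>(y\<^sub>0 \<cdots> y\<^sub>n\<^sub>-\<^sub>1)\<^sup>-\<^sup>1\<close>.
\<close>

lemma tower_one:
  assumes "tower 1 n u v"
  shows "u \<in> carrier Z"
proof -
  have "D (Suc n) u = \<zero>\<^bsub>X (Suc (Suc n))\<^esub>"
    using modelD(2,3)[OF assms] f_mem by (simp add: carrier_C_iff)
  then show ?thesis using modelD(1)[OF assms] by (auto simp: carrier_Z T_iff)
qed

lemma class_zero_imp_mem:
  assumes "tower 1 n u v" "g \<in> carrier S" "g \<odot>\<^bsub>X (Suc n)\<^esub> u \<in> B"
  shows "g \<in> J 1 n"
proof -
  obtain l w where "w \<in> carrier (C l n n)" "D n w = g \<odot>\<^bsub>X (Suc n)\<^esub> u"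
    using assms(3) by (auto simp: B_def T_iff)
  then show ?thesis
    using coboundary_imp_mem[OF assms(1,2) _, of w l] ypow_ideal_mult[OF assms(2) f_mem] by blast
qed

text \<open>
  The annihilator of the class of \<open>u\<close> is \<open>Q\<close>, so the submodules generated by \<open>x\<^sub>0\<^sup>i u\<close> form a strictly
  decreasing chain: \<open>x\<^sub>0\<^sup>i - s x\<^sub>0\<^sup>i\<^sup>+\<^sup>1\<close> contains the monomial \<open>x\<^sub>0\<^sup>i\<close> and thus never lies in \<open>Q\<close>.
\<close>

lemma not_artinian_H:
  assumes m: "m \<noteq> 0"
  shows "\<not> artinian_module S H"
proof
  assume art: "artinian_module S H"
  interpret H: module S H by (rule module_H)
  obtain u v where t: "tower 1 n u v" using tower_exists[of n] by blast
  note u = tower_one[OF t]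
  define x :: "nat \<Rightarrow> 'k bipoly" where "x i = Poly_Mapping.single (Poly_Mapping.single (Inl 0) i) 1" for i
  have x: "x i \<in> carrier S" for i
    unfolding x_def using m by (intro single_in_bipoly) auto
  have xS: "x (Suc i) = x 1 * x i" for i
    by (simp add: x_def mult_single single_add[symmetric])
  have uX: "r \<odot>\<^bsub>X (Suc n)\<^esub> u \<in> carrier Z" if "r \<in> carrier S" for r
    using Z.smult_closed[OF that u] by simp
  define N where "N i = {cl ((s * x i) \<odot>\<^bsub>X (Suc n)\<^esub> u) | s. s \<in> carrier S}" for i
  have "submodule (N i) S H" for i
  proof (rule H.submodule_criterion)
    have sx: "s * x i \<in> carrier S" if "s \<in> carrier S" for s using bipoly_mult_closed[OF that x] .
    show "N i \<subseteq> carrier H" using uX sx by (auto simp: N_def carrier_H)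
    have "cl ((0 * x i) \<odot>\<^bsub>X (Suc n)\<^esub> u) = \<zero>\<^bsub>H\<^esub>"
      using Z.smult_l_null[OF u] by (simp add: cl_zero)
    then show "\<zero>\<^bsub>H\<^esub> \<in> N i" unfolding N_def
      by (intro CollectI exI[of _ 0]) (simp add: carrier_bipoly_iff)
    fix a b assume "a \<in> N i" "b \<in> N i"
    then obtain s t where st: "s \<in> carrier S" "t \<in> carrier S" "a = cl ((s * x i) \<odot>\<^bsub>X (Suc n)\<^esub> u)"
      "b = cl ((t * x i) \<odot>\<^bsub>X (Suc n)\<^esub> u)" by (auto simp: N_def)
    have "a \<oplus>\<^bsub>H\<^esub> b = cl (((s + t) * x i) \<odot>\<^bsub>X (Suc n)\<^esub> u)"
      using st add_H[OF uX[OF sx[OF st(1)]] uX[OF sx[OF st(2)]]] Z.smult_l_distr[OF sx[OF st(1)] sx[OF st(2)] u]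
      by (simp add: distrib_right)
    then show "a \<oplus>\<^bsub>H\<^esub> b \<in> N i" using bipoly_add_closed[OF st(1,2)] by (auto simp: N_def)
  next
    have sx: "s * x i \<in> carrier S" if "s \<in> carrier S" for s using bipoly_mult_closed[OF that x] .
    fix r a assume r: "r \<in> carrier S" and "a \<in> N i"
    then obtain s where s: "s \<in> carrier S" "a = cl ((s * x i) \<odot>\<^bsub>X (Suc n)\<^esub> u)" by (auto simp: N_def)
    have "r \<odot>\<^bsub>H\<^esub> a = cl (((r * s) * x i) \<odot>\<^bsub>X (Suc n)\<^esub> u)"
      using s smult_H[OF r uX[OF sx[OF s(1)]]] Z.smult_assoc1[OF r sx[OF s(1)] u] by (simp add: mult.assoc)
    then show "r \<odot>\<^bsub>H\<^esub> a \<in> N i" using bipoly_mult_closed[OF r s(1)] by (auto simp: N_def)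
  qed
  moreover have "N (Suc i) \<subseteq> N i" for i
  proof
    fix a assume "a \<in> N (Suc i)"
    then obtain s where s: "s \<in> carrier S" "a = cl ((s * x (Suc i)) \<odot>\<^bsub>X (Suc n)\<^esub> u)" by (auto simp: N_def)
    then have "a = cl (((s * x 1) * x i) \<odot>\<^bsub>X (Suc n)\<^esub> u)" by (simp only: s(2) xS[of i] mult.assoc)
    then show "a \<in> N i" using bipoly_mult_closed[OF s(1) x[of 1]] by (auto simp: N_def)
  qed
  ultimately obtain k where k: "\<forall>i\<ge>k. N i = N k"
    using art unfolding artinian_module_def by blast
  have "cl ((1 * x k) \<odot>\<^bsub>X (Suc n)\<^esub> u) \<in> N k"
    unfolding N_def by (intro CollectI exI[of _ 1]) (simp add: carrier_bipoly_iff)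
  also have "N k = N (Suc k)" using k[rule_format, of "Suc k"] by simp
  finally obtain s where s: "s \<in> carrier S" and eq: "cl (x k \<odot>\<^bsub>X (Suc n)\<^esub> u) = cl ((s * x (Suc k)) \<odot>\<^bsub>X (Suc n)\<^esub> u)"
    by (auto simp: N_def)
  define g where "g = x k - s * x (Suc k)"
  have sx: "s * x (Suc k) \<in> carrier S" by (rule bipoly_mult_closed[OF s x])
  have g: "g \<in> carrier S"
    using bipoly_add_closed[OF x bipoly_uminus_closed[OF sx]] by (simp add: g_def)
  have "x k \<odot>\<^bsub>X (Suc n)\<^esub> u \<ominus>\<^bsub>Z\<^esub> (s * x (Suc k)) \<odot>\<^bsub>X (Suc n)\<^esub> u = g \<odot>\<^bsub>X (Suc n)\<^esub> u"
    using Z.smult_l_distr[OF x bipoly_uminus_closed[OF sx] u] Z.smult_l_minus[OF sx u]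
    by (simp add: g_def a_minus_def bipoly_a_inv[OF sx])
  then have "g \<odot>\<^bsub>X (Suc n)\<^esub> u \<in> B" using eq cl_eq_iff[OF uX[OF x] uX[OF sx]] by simp
  then have gJ: "g \<in> J 1 n" by (rule class_zero_imp_mem[OF t g])
  let ?\<mu> = "Poly_Mapping.single (Inl 0) k :: bimonom"
  have "lkp (s * x (Suc k)) ?\<mu> = 0"
  proof (rule ccontr)
    assume "lkp (s * x (Suc k)) ?\<mu> \<noteq> 0"
    then have "?\<mu> \<in> Poly_Mapping.keys (x (Suc k) * s)" by (simp add: in_keys_iff mult.commute)
    then obtain \<nu> where "?\<mu> = Poly_Mapping.single (Inl 0) (Suc k) + \<nu>" by (auto simp: x_def keys_monomial_mult)
    then have "lkp ?\<mu> (Inl 0) = Suc k + lkp \<nu> (Inl 0)" by (simp only: lookup_add lookup_single_eq)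
    then show False by simp
  qed
  then have "?\<mu> \<in> Poly_Mapping.keys g" by (simp add: g_def in_keys_iff lookup_minus x_def)
  then show False using gJ by (auto simp: ypow_ideal_def lookup_single)
qed

abbreviation const :: "'k \<Rightarrow> 'k bipoly"
  where "const c \<equiv> Poly_Mapping.single 0 c"

lemma const_in: "const c \<in> carrier S"
  by (simp add: carrier_bipoly_iff)

text \<open>
  The socle of \<open>K[y]/(y\<^sub>0\<^sup>k, \<dots>, y\<^sub>n\<^sub>-\<^sub>1\<^sup>k)\<close> is spanned by the monomial with all exponents \<open>k - 1\<close>: any
  other monomial that survives can be multiplied by some variable without leaving the normal forms.
\<close>

lemma top_monomial_mod_ypow_ideal:
  assumes m: "m = 0" and g: "g \<in> carrier S" and k: "k \<ge> 1"
    and yg: "\<And>j. j < n \<Longrightarrow> ypow j 1 * g \<in> J k n"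
  shows "\<exists>c. g - const c * ymon (k - 1) n \<in> J k n"
proof -
  let ?\<nu> = "yexp (k - 1) n"
  define c where "c = lkp g ?\<nu>"
  have cm: "const c * ymon (k - 1) n = Poly_Mapping.single ?\<nu> c"
    by (simp add: ymon_eq mult_single)
  have top: "\<mu> = ?\<nu>" if \<mu>: "\<mu> \<in> Poly_Mapping.keys g" and low: "\<And>j. j < n \<Longrightarrow> lkp \<mu> (Inr j) < k" for \<mu>
  proof (rule poly_mapping_eqI)
    fix i :: "nat + nat"
    have van: "lkp \<mu> i = 0" if "i \<notin> Inl ` {..<m} \<union> Inr ` {..<n}"
    proof -
      have "Poly_Mapping.keys \<mu> \<subseteq> Inl ` {..<m} \<union> Inr ` {..<n}"
        using g \<mu> by (simp add: carrier_bipoly_iff)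
      then show ?thesis using that by (metis in_keys_iff subsetD)
    qed
    show "lkp \<mu> i = lkp ?\<nu> i"
    proof (cases i)
      case (Inl a)
      then show ?thesis using van m by (auto simp: lookup_yexp)
    next
      case (Inr j)
      show ?thesis
      proof (cases "j < n")
        case True
        have "Poly_Mapping.single (Inr j) 1 + \<mu> \<in> Poly_Mapping.keys (ypow j 1 * g)"
          using \<mu> by (simp add: keys_ypow_mult)
        then obtain l where l: "l < n" "k \<le> lkp (Poly_Mapping.single (Inr j) 1 + \<mu>) (Inr l)"
          using yg[OF True] by (auto simp: ypow_ideal_def)
        then have "l = j" using low[OF l(1)] by (auto simp: lookup_add lookup_single when_def split: if_splits)
        then have "k \<le> Suc (lkp \<mu> (Inr j))" using l(2) by (simp add: lookup_add)
        then show ?thesis using low[OF True] Inr True by (simp add: lookup_yexp)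
      next
        case False
        then show ?thesis using van Inr by (auto simp: lookup_yexp)
      qed
    qed
  qed
  have "g - Poly_Mapping.single ?\<nu> c \<in> J k n"
    unfolding ypow_ideal_def
  proof (intro CollectI conjI ballI)
    have "Poly_Mapping.single ?\<nu> c \<in> carrier S"
      unfolding cm[symmetric] by (intro bipoly_mult_closed const_in ymon_in_bipoly order_refl)
    from bipoly_add_closed[OF g bipoly_uminus_closed[OF this]]
    show "g - Poly_Mapping.single ?\<nu> c \<in> carrier S" by simp
    fix \<mu> assume "\<mu> \<in> Poly_Mapping.keys (g - Poly_Mapping.single ?\<nu> c)"
    then have "lkp g \<mu> \<noteq> 0" "\<mu> \<noteq> ?\<nu>"
      by (auto simp: in_keys_iff lookup_minus lookup_single c_def when_def split: if_splits)
    then show "\<exists>j<n. k \<le> lkp \<mu> (Inr j)"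
      using top[of \<mu>] by (force simp: in_keys_iff not_less)
  qed
  then show ?thesis unfolding cm[symmetric] by blast
qed

lemma smult_cong_mod_ypow_ideal:
  assumes x: "x \<in> carrier (C k n i)" and "g \<in> carrier S" "h \<in> carrier S" and "g - h \<in> J k n"
  shows "g \<odot>\<^bsub>X i\<^esub> x = h \<odot>\<^bsub>X i\<^esub> x"
proof -
  have xX: "x \<in> carrier (X i)" using x by (simp add: carrier_C)
  have "((g - h) \<oplus>\<^bsub>S\<^esub> h) \<odot>\<^bsub>X i\<^esub> x = (g - h) \<odot>\<^bsub>X i\<^esub> x \<oplus>\<^bsub>X i\<^esub> h \<odot>\<^bsub>X i\<^esub> x"
    using assms xX by (intro smult_l_distr') (auto intro: ypow_ideal_subset)
  moreover have "(g - h) \<odot>\<^bsub>X i\<^esub> x = \<zero>\<^bsub>X i\<^esub>"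
    using x assms(4) by (simp add: carrier_C_iff)
  ultimately show ?thesis using assms xX by (simp add: l_zero' closed')
qed

text \<open>
  A class of the socle is \<open>g u'\<close> for a tower \<open>u'\<close> of some exponent \<open>k\<close>. By \<open>coboundary_imp_mem\<close>, \<open>g\<close> is
  in the socle of \<open>K[y]/(y\<^sub>0\<^sup>k, \<dots>, y\<^sub>n\<^sub>-\<^sub>1\<^sup>k)\<close>, hence a multiple of the top monomial. The top monomial
  moves \<open>u'\<close> to a tower for the exponent \<open>1\<close>, and all of these span the same line.
\<close>

lemma socle_H:
  assumes m: "m = 0" and t: "tower 1 n u v" and h: "h \<in> carrier H"
    and yh: "\<And>j. j < n \<Longrightarrow> ypow j 1 \<odot>\<^bsub>H\<^esub> h = \<zero>\<^bsub>H\<^esub>"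
  shows "\<exists>c. h = const c \<odot>\<^bsub>H\<^esub> cl u"
proof -
  let ?X = "X (Suc n)"
  obtain z where z: "z \<in> carrier Z" "h = cl z" using h by (auto simp: carrier_H)
  obtain k0 where k0: "z \<in> carrier (C k0 n (Suc n))" using z by (auto simp: carrier_Z T_iff)
  define k where "k = Suc k0"
  have k: "k \<ge> 1" by (simp add: k_def)
  have zk: "z \<in> carrier (C k n (Suc n))" by (rule C_mono[OF _ order_refl k0]) (simp add: k_def)
  obtain u' v' where t': "tower k n u' v'" using tower_exists[of n] by blast
  note u' = modelD(1)[OF t']
  have u'X: "u' \<in> carrier ?X" using u' by (simp add: carrier_C)
  obtain g w where g: "g \<in> carrier S" "g * f \<in> J k n" and w: "w \<in> carrier (C k n n)"
    and z_eq: "z = g \<odot>\<^bsub>?X\<^esub> u' \<oplus>\<^bsub>?X\<^esub> D n w"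
    using modelD(5)[OF t' zk] z(1) by (auto simp: carrier_Z)
  have wT: "w \<in> T n" using w by (auto simp: T_iff)
  note TX = module.submoduleE[OF mod submodule_T]
  have cl_cong: "cl a = cl b" if "a \<in> carrier Z" "b \<in> carrier Z" "x \<in> T n" "a = b \<oplus>\<^bsub>?X\<^esub> D n x" for a b x
  proof -
    have "D n x \<in> B" using that(3) by (simp add: B_def)
    moreover from this have Dx: "D n x \<in> carrier Z" using Z.submoduleE(1)[OF submodule_B] by blast
    have "a \<ominus>\<^bsub>Z\<^esub> b = D n x"
      using Z.add_diff_cancel[OF that(2) Dx] by (simp add: that(4))
    ultimately show ?thesis using cl_eq_iff[OF that(1,2)] by simp
  qed
  have "ypow j 1 * g \<in> J k n" if j: "j < n" for j
  proof -
    let ?y = "ypow j 1 :: 'k bipoly"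
    have y: "?y \<in> carrier S" using j by simp
    have "?y \<odot>\<^bsub>Z\<^esub> z \<in> B"
      using yh[OF j] smult_H[OF y z(1)] cl_eq_zero_iff[OF Z.smult_closed[OF y z(1)]] by (simp add: z(2) zero_H)
    then obtain b where b: "b \<in> T n" "?y \<odot>\<^bsub>?X\<^esub> z = D n b" by (auto simp: B_def)
    have m1: "- ?y \<in> carrier S" using y by (rule bipoly_uminus_closed)
    have c: "b \<oplus>\<^bsub>X n\<^esub> (- ?y) \<odot>\<^bsub>X n\<^esub> w \<in> T n" using TX(5)[OF b(1) TX(4)[OF m1 wT]] .
    then obtain l where l: "b \<oplus>\<^bsub>X n\<^esub> (- ?y) \<odot>\<^bsub>X n\<^esub> w \<in> carrier (C l n n)" by (auto simp: T_iff)
    have wX: "w \<in> carrier (X n)" and bX: "b \<in> carrier (X n)" using wT b(1) by (auto simp: T_closed)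
    have yg: "?y * g \<in> carrier S" by (rule bipoly_mult_closed[OF y g(1)])
    have "?y \<odot>\<^bsub>?X\<^esub> D n w \<oplus>\<^bsub>?X\<^esub> (- ?y) \<odot>\<^bsub>?X\<^esub> D n w = \<zero>\<^bsub>?X\<^esub>"
      using smult_l_distr'[OF y m1 D_closed[OF wX]] zero_smult'[OF D_closed[OF wX]] by simp
    then have "D n (b \<oplus>\<^bsub>X n\<^esub> (- ?y) \<odot>\<^bsub>X n\<^esub> w) = (?y * g) \<odot>\<^bsub>?X\<^esub> u'"
      using bX wX m1 y g(1) u'X smult_assoc'[OF y g(1) u'X]
      by (simp add: D_add D_smult closed' b(2)[symmetric] z_eq smult_r_distr' a_assoc' r_zero')
    moreover have "?y * g * f \<in> J k n"
      using ypow_ideal_mult[OF y g(2)] by (simp add: mult.assoc)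
    ultimately show ?thesis using coboundary_imp_mem[OF t' yg _ l] by blast
  qed
  then obtain c where c: "g - const c * ymon (k - 1) n \<in> J k n"
    using top_monomial_mod_ypow_ideal[OF m g(1) k] by blast
  have ym: "ymon (k - 1) n \<in> carrier S" by (simp add: ymon_in_bipoly)
  define U where "U = ymon (k - 1) n \<odot>\<^bsub>?X\<^esub> u'"
  have tU: "tower 1 n U (ymon (k - 1) n \<odot>\<^bsub>X (Suc (Suc n))\<^esub> v')"
    unfolding U_def using k by (intro tower_scale) (use t' in simp)
  note UZ = tower_one[OF tU] and uZ = tower_one[OF t]
  have gu: "g \<odot>\<^bsub>?X\<^esub> u' = const c \<odot>\<^bsub>?X\<^esub> U"
  proof -
    have "g \<odot>\<^bsub>?X\<^esub> u' = (const c * ymon (k - 1) n) \<odot>\<^bsub>?X\<^esub> u'"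
      by (rule smult_cong_mod_ypow_ideal[OF u' g(1) bipoly_mult_closed[OF const_in ym] c])
    then show ?thesis
      using smult_assoc'[OF const_in ym u'X] by (simp add: U_def)
  qed
  obtain g1 w1 where g1: "g1 \<in> carrier S" and w1: "w1 \<in> carrier (C 1 n n)"
    and U_eq: "U = g1 \<odot>\<^bsub>?X\<^esub> u \<oplus>\<^bsub>?X\<^esub> D n w1"
    using modelD(5)[OF t modelD(1)[OF tU]] UZ by (auto simp: carrier_Z)
  have w1T: "w1 \<in> T n" using w1 by (auto simp: T_iff)
  have "ypow j 1 * g1 \<in> J 1 n" if "j < n" for j
    using ypow_ideal_mult[OF g1 ypow_mem[OF that order_refl]] by (simp add: mult.commute)
  then obtain c1 where c1: "g1 - const c1 * ymon (1 - 1) n \<in> J 1 n"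
    using top_monomial_mod_ypow_ideal[OF m g1, of 1] by auto
  have ym0: "ymon 0 n = (1 :: 'k bipoly)"
    by (simp add: ymon_eq) (metis (no_types, lifting) lookup_yexp(1) lookup_yexp(2) lookup_zero obj_sumE poly_mapping_eqI single_one)
  have "g1 \<odot>\<^bsub>?X\<^esub> u = const c1 \<odot>\<^bsub>?X\<^esub> u"
    using c1 by (intro smult_cong_mod_ypow_ideal[OF modelD(1)[OF t] g1 const_in]) (simp add: ym0)
  then have "cl U = cl (const c1 \<odot>\<^bsub>?X\<^esub> u)"
    using U_eq Z.smult_closed[OF const_in uZ] by (intro cl_cong[OF UZ _ w1T]) auto
  moreover have "h = cl (const c \<odot>\<^bsub>?X\<^esub> U)"
    unfolding z(2) using z_eq gu Z.smult_closed[OF const_in UZ] by (intro cl_cong[OF z(1) _ wT]) auto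
  ultimately have "h = const c \<odot>\<^bsub>H\<^esub> (const c1 \<odot>\<^bsub>H\<^esub> cl u)"
    using smult_H[OF const_in UZ] smult_H[OF const_in uZ] by simp
  also have "\<dots> = (const c * const c1) \<odot>\<^bsub>H\<^esub> cl u"
    using module.smult_assoc1[OF module_H const_in const_in] uZ by (auto simp: carrier_H)
  finally show ?thesis by (auto simp: mult_single)
qed

lemma ypow_pow: "j < n \<Longrightarrow> ypow j 1 [^]\<^bsub>S\<^esub> k = ypow j k"
proof (induction k)
  case (Suc k)
  have "(ypow j (k + 1) :: 'k bipoly) = ypow j k * ypow j 1" by (rule ypow_add)
  then show ?case using Suc by (simp add: nat_pow_def)
qed (simp add: nat_pow_def)

text \<open>
  Let \<open>W p\<close> be the part of \<open>H\<close> killed by \<open>y\<^sub>j\<close> for all \<open>j \<ge> p\<close>. Then \<open>W 0\<close> is the socle, at most a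
  line, \<open>W n\<close> is all of \<open>H\<close>, and \<open>W p\<close> is the kernel of \<open>y\<^sub>p\<close> on \<open>W (p + 1)\<close>, where \<open>y\<^sub>p\<close> acts locally
  nilpotently.
\<close>

lemma artinian_H:
  assumes m: "m = 0"
  shows "artinian_module S H"
proof -
  interpret H: module S H by (rule module_H)
  obtain u v where t: "tower 1 n u v" using tower_exists[of n] by blast
  have uH: "cl u \<in> carrier H" using tower_one[OF t] by (auto simp: carrier_H)
  define W where "W p = {h \<in> carrier H. \<forall>j<n. p \<le> j \<longrightarrow> ypow j 1 \<odot>\<^bsub>H\<^esub> h = \<zero>\<^bsub>H\<^esub>}" for p
  have subW: "submodule (W p) S H" for p
  proof -
    have "W p = {h \<in> carrier H. \<forall>a\<in>(\<lambda>j. ypow j 1) ` {j. p \<le> j \<and> j < n}. a \<odot>\<^bsub>H\<^esub> h = \<zero>\<^bsub>H\<^esub>}"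
      by (auto simp: W_def)
    then show ?thesis by (auto simp del: ball_simps intro!: H.submodule_kernel_smult)
  qed
  have modW: "module S (H\<lparr>carrier := W p\<rparr>)" for p
    by (rule submodule.submodule_is_module[OF subW module_H])
  have tors: "\<exists>k. ypow j k \<odot>\<^bsub>H\<^esub> h = \<zero>\<^bsub>H\<^esub>" if h: "h \<in> carrier H" and j: "j < n" for h j
  proof -
    obtain z where z: "z \<in> carrier Z" "h = cl z" using h by (auto simp: carrier_H)
    obtain k where "ypow j k \<odot>\<^bsub>Z\<^esub> z = \<zero>\<^bsub>Z\<^esub>" using z(1) j by (auto simp: carrier_Z T_def)
    then have "ypow j k \<odot>\<^bsub>H\<^esub> h = \<zero>\<^bsub>H\<^esub>"
      using smult_H[of "ypow j k", OF _ z(1)] j by (simp add: z(2) cl_zero)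
    then show ?thesis by blast
  qed
  have W_0: "N = {\<zero>\<^bsub>H\<^esub>} \<or> N = W 0" if N: "submodule N S H" "N \<subseteq> W 0" for N
  proof (rule disjCI)
    have zN: "\<zero>\<^bsub>H\<^esub> \<in> N" using subgroup.one_closed[OF submodule.axioms(1)[OF N(1)]] by simp
    assume "N \<noteq> W 0"
    then obtain h' where h': "h' \<in> W 0" "h' \<notin> N" using N(2) by blast
    have "h = \<zero>\<^bsub>H\<^esub>" if h: "h \<in> N" for h
    proof (rule ccontr)
      assume nz: "h \<noteq> \<zero>\<^bsub>H\<^esub>"
      obtain c where c: "h = const c \<odot>\<^bsub>H\<^esub> cl u" using socle_H[OF m t, of h] h N(2) by (auto simp: W_def)
      obtain c' where c': "h' = const c' \<odot>\<^bsub>H\<^esub> cl u" using socle_H[OF m t, of h'] h' by (auto simp: W_def)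
      have "c \<noteq> 0"
      proof
        assume "c = 0"
        then have "h = \<zero>\<^bsub>S\<^esub> \<odot>\<^bsub>H\<^esub> cl u" by (simp add: c)
        then show False using nz unfolding H.smult_l_null[OF uH] by blast
      qed
      then have "const c' = const (c' / c) * const c" by (simp add: mult_single)
      then have "h' = const (c' / c) \<odot>\<^bsub>H\<^esub> h"
        using H.smult_assoc1[OF const_in const_in uH, of "c' / c" c] by (simp add: c c')
      then show False using h' H.submoduleE(4)[OF N(1) const_in h] by simp
    qed
    then show "N = {\<zero>\<^bsub>H\<^esub>}" using zN by blast
  qed
  have "artinian_module S (H\<lparr>carrier := W p\<rparr>)" if "p \<le> n" for p
    using that
  proof (induction p)
    case 0
    show ?case
      unfolding artinian_module_def
    proof (intro conjI modW allI impI)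
      fix N :: "nat \<Rightarrow> 'e set set"
      assume "(\<forall>i. submodule (N i) S (H\<lparr>carrier := W 0\<rparr>)) \<and> (\<forall>i. N (Suc i) \<subseteq> N i)"
      then have N: "submodule (N i) S H" "N i \<subseteq> W 0" and dec: "N (Suc i) \<subseteq> N i" for i
        by (auto simp: H.submodule_restrict_iff[OF subW])
      have le: "N j \<subseteq> N i" if "i \<le> j" for i j
        using lift_Suc_antimono_le[of N i j] dec that by blast
      show "\<exists>k. \<forall>i\<ge>k. N i = N k"
      proof (cases "\<exists>k. N k = {\<zero>\<^bsub>H\<^esub>}")
        case True
        then obtain k where k: "N k = {\<zero>\<^bsub>H\<^esub>}" by blast
        have "N i = N k" if "k \<le> i" for i
          using le[OF that] k subgroup.one_closed[OF submodule.axioms(1)[OF N(1)[of i]]] by auto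
        then show ?thesis by blast
      next
        case False
        then have "N i = W 0" for i using W_0[OF N(1) N(2)] by blast
        then show ?thesis by simp
      qed
    qed
  next
    case (Suc p)
    let ?M = "H\<lparr>carrier := W (Suc p)\<rparr>"
    have p: "p < n" using Suc.prems by simp
    show ?case
    proof (rule artinian_if_torsion_and_kernel_artinian[of S ?M "ypow p 1"])
      show "\<exists>k::nat. (ypow p 1 [^]\<^bsub>S\<^esub> k) \<odot>\<^bsub>?M\<^esub> x = \<zero>\<^bsub>?M\<^esub>" if x: "x \<in> carrier ?M" for x
      proof -
        obtain k where "ypow p k \<odot>\<^bsub>H\<^esub> x = \<zero>\<^bsub>H\<^esub>" using tors[of x p] x p by (auto simp: W_def)
        then have "(ypow p 1 [^]\<^bsub>S\<^esub> k) \<odot>\<^bsub>H\<^esub> x = \<zero>\<^bsub>H\<^esub>" by (simp only: ypow_pow[OF p])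
        then show ?thesis by auto
      qed
      have "{x \<in> carrier ?M. ypow p 1 \<odot>\<^bsub>?M\<^esub> x = \<zero>\<^bsub>?M\<^esub>} = W p"
        using p by (auto simp: W_def Suc_le_eq le_less)
      then show "artinian_module S (annihilated (ypow p 1) ?M)"
        using Suc.IH p by (simp add: annihilated_def)
    qed (use modW p in auto)
  qed
  moreover have "H\<lparr>carrier := W n\<rparr> = H" by (auto simp: W_def)
  ultimately show ?thesis by (metis order_refl)
qed

end

section \<open>Injective resolutions of the hypersurface ring\<close>

text \<open>
  A linear order of the variables makes the polynomials over a field an integral domain, by comparison
  of leading monomials. It is used for the regularity of \<open>f\<close> in the base case of the two-term model.
\<close>

instantiation sum :: (linorder, linorder) linorder
begin

definition less_eq_sum :: "'a + 'b \<Rightarrow> 'a + 'b \<Rightarrow> bool"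
  where "less_eq_sum x y =
    (case x of Inl a \<Rightarrow> (case y of Inl b \<Rightarrow> a \<le> b | Inr _ \<Rightarrow> True)
      | Inr a \<Rightarrow> (case y of Inl _ \<Rightarrow> False | Inr b \<Rightarrow> a \<le> b))"

definition less_sum :: "'a + 'b \<Rightarrow> 'a + 'b \<Rightarrow> bool"
  where "less_sum x y \<longleftrightarrow> x \<le> y \<and> \<not> y \<le> x"

instance
  by standard (auto simp: less_eq_sum_def less_sum_def split: sum.splits)

end

definition shifted_module :: "(nat \<Rightarrow> ('r, 'e) module) \<Rightarrow> nat \<Rightarrow> ('r, 'e) module"
  where "shifted_module E i = (if i < 2 then (E 0)\<lparr>carrier := {\<zero>\<^bsub>E 0\<^esub>}\<rparr> else E (i - 2))"

definition shifted_diff :: "(nat \<Rightarrow> ('r, 'e) module) \<Rightarrow> (nat \<Rightarrow> 'e \<Rightarrow> 'e) \<Rightarrow> nat \<Rightarrow> 'e \<Rightarrow> 'e"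
  where "shifted_diff E d i = (if i < 2 then (\<lambda>_. \<zero>\<^bsub>E 0\<^esub>) else d (i - 2))"

lemma shifted_simps [simp]:
  "shifted_module E (Suc (Suc i)) = E i" "shifted_diff E d (Suc (Suc i)) = d i"
  "shifted_module E 0 = (E 0)\<lparr>carrier := {\<zero>\<^bsub>E 0\<^esub>}\<rparr>"
  "shifted_module E (Suc 0) = (E 0)\<lparr>carrier := {\<zero>\<^bsub>E 0\<^esub>}\<rparr>"
  "shifted_diff E d 0 = (\<lambda>_. \<zero>\<^bsub>E 0\<^esub>)" "shifted_diff E d (Suc 0) = (\<lambda>_. \<zero>\<^bsub>E 0\<^esub>)"
  by (simp_all add: shifted_module_def shifted_diff_def)

lemma nat_shift2_cases:
  obtains "i = 0" | "i = Suc 0" | j where "i = Suc (Suc j)"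
  by (metis not0_implies_Suc)

lemma module_zero_submodule:
  assumes "module R M"
  shows "module R (M\<lparr>carrier := {\<zero>\<^bsub>M\<^esub>}\<rparr>)"
proof -
  interpret M: module R M by fact
  have "submodule {\<zero>\<^bsub>M\<^esub>} R M" by (rule M.submodule_criterion) auto
  then show ?thesis by (rule submodule.submodule_is_module) fact
qed

lemma injective_resolution_imp_complex:
  assumes "injective_resolution R N E d \<epsilon>"
  shows "module_complex R (shifted_module E) (shifted_diff E d)"
proof (rule module_complex.intro)
  have mod: "module R (E i)" for i
    using assms by (simp add: injective_resolution_def injective_module_def)
  have hom: "d i \<in> mod_hom R (E i) (E (Suc i))" for i
    using assms by (simp add: injective_resolution_def)
  have ker: "d i ` carrier (E i) = a_kernel (E (Suc i)) (E (Suc (Suc i))) (d (Suc i))" for i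
    using assms by (simp add: injective_resolution_def)
  interpret E0: module R "E 0" by (rule mod)
  fix i
  show "module R (shifted_module E i)"
    by (cases i rule: nat_shift2_cases) (simp_all add: mod module_zero_submodule)
  show "shifted_diff E d i \<in> mod_hom R (shifted_module E i) (shifted_module E (Suc i))"
    by (cases i rule: nat_shift2_cases) (auto simp: hom intro!: mod_homI)
  fix x assume x: "x \<in> carrier (shifted_module E i)"
  show "shifted_diff E d (Suc i) (shifted_diff E d i x) = \<zero>\<^bsub>shifted_module E (Suc (Suc i))\<^esub>"
  proof (cases i rule: nat_shift2_cases)
    case 2
    then show ?thesis using mod_hom_zero[OF mod mod hom, of 0] by simp
  next
    case (3 j)
    then have "d j x \<in> a_kernel (E (Suc j)) (E (Suc (Suc j))) (d (Suc j))"
      using x ker[of j] by auto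
    then show ?thesis using 3 by (simp add: a_kernel_def')
  qed simp
qed

text \<open>
  The base case \<open>p = 0\<close> of the two-term model expresses that \<open>E\<close> is a resolution of \<open>S/fS\<close>: the
  elements killed by \<open>d 0\<close> are the multiples of the image of \<open>1\<close>, the annihilator of that image is
  \<open>fS\<close>, and \<open>E\<close> is exact in the positive degrees.
\<close>

lemma divisible_complex_resolution:
  fixes f :: "'k::field bipoly" and E :: "nat \<Rightarrow> ('k bipoly, 'e) module"
  assumes form: "bihomogeneous_form m n (a, b) f" and b: "b \<ge> 1"
    and res: "injective_resolution (bipoly_ring m n) (hypersurface_module m n f) E d \<epsilon>"
  shows "divisible_complex m n (shifted_module E) (shifted_diff E d) f
    (\<epsilon> (PIdl\<^bsub>bipoly_ring m n\<^esub> f +>\<^bsub>regular_module (bipoly_ring m n)\<^esub> 1))"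
proof -
  let ?S = "bipoly_ring m n :: 'k bipoly ring"
  let ?X = "shifted_module E" and ?D = "shifted_diff E d"
  let ?I = "PIdl\<^bsub>?S\<^esub> f"
  let ?R = "regular_module ?S"
  let ?c = "\<lambda>r. ?I +>\<^bsub>?R\<^esub> r"
  interpret S: cring ?S by (rule cring_bipoly)
  interpret X: module_complex ?S ?X ?D by (rule injective_resolution_imp_complex[OF res])
  have f: "f \<in> carrier ?S" and f0: "f \<noteq> 0"
    and deg: "\<And>\<mu>. \<mu> \<in> Poly_Mapping.keys f \<Longrightarrow> bidegree m n \<mu> = (a, b)"
    using form by (auto simp: bihomogeneous_form_def)
  have inj: "injective_module ?S (E i)" for i
    using res by (simp add: injective_resolution_def)
  have mod: "module ?S (E i)" for i
    using inj by (simp add: injective_module_def)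
  have I: "submodule ?I ?S ?R"
    by (rule submodule_ideal[OF cring_bipoly S.cgenideal_ideal[OF f]])
  have modR: "module ?S ?R" by (rule module_regular[OF cring_bipoly])
  have hyp: "hypersurface_module m n f = quotient_module ?R ?I"
    by (simp add: hypersurface_module_def)
  have eps: "\<epsilon> \<in> mod_hom ?S (quotient_module ?R ?I) (E 0)"
    and eps_inj: "inj_on \<epsilon> (carrier (quotient_module ?R ?I))"
    and eps_img: "\<epsilon> ` carrier (quotient_module ?R ?I) = a_kernel (E 0) (E 1) (d 0)"
    and ker: "\<And>i. d i ` carrier (E i) = a_kernel (E (Suc i)) (E (Suc (Suc i))) (d (Suc i))"
    using res by (auto simp: injective_resolution_def hyp)
  have one: "(1 :: 'k bipoly) \<in> carrier ?S" using S.one_closed by simp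
  have c_in: "?c r \<in> carrier (quotient_module ?R ?I)" if "r \<in> carrier ?S" for r
    using that by (simp add: carrier_quotient[OF modR I])
  have eps_c: "\<epsilon> (?c r) = r \<odot>\<^bsub>E 0\<^esub> \<epsilon> (?c 1)" if r: "r \<in> carrier ?S" for r
    using quotient_smult[OF modR I r, of 1] one mod_hom_smult[OF eps r c_in[OF one]] by simp
  have eps_0: "\<epsilon> ?I = \<zero>\<^bsub>E 0\<^esub>"
    using mod_hom_zero[OF module_quotient[OF modR I] mod eps] by (simp add: zero_quotient[OF modR I])
  have zero_c: "?I \<in> carrier (quotient_module ?R ?I)"
    using quotient_eq_zero_iff[OF modR I, of 0] c_in[of 0] S.zero_closed
      subgroup.one_closed[OF submodule.axioms(1)[OF I]] by simp
  have eps_c_0: "r \<odot>\<^bsub>E 0\<^esub> \<epsilon> (?c 1) = \<zero>\<^bsub>E 0\<^esub> \<longleftrightarrow> r \<in> ?I" if r: "r \<in> carrier ?S" for r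
  proof -
    have "r \<odot>\<^bsub>E 0\<^esub> \<epsilon> (?c 1) = \<zero>\<^bsub>E 0\<^esub> \<longleftrightarrow> \<epsilon> (?c r) = \<epsilon> ?I"
      by (simp add: eps_c[OF r] eps_0)
    also have "\<dots> \<longleftrightarrow> ?c r = ?I" using eps_inj c_in[OF r] zero_c by (auto dest: inj_onD)
    also have "\<dots> \<longleftrightarrow> r \<in> ?I" using r by (simp add: quotient_eq_zero_iff[OF modR I])
    finally show ?thesis .
  qed
  have v0: "\<epsilon> (?c 1) \<in> carrier (E 0)" using mod_hom_closed[OF eps c_in[OF one]] .
  interpret E0: module ?S "E 0" by (rule mod)
  show ?thesis
  proof (rule divisible_complex.intro[OF X.module_complex_axioms divisible_complex_axioms.intro])
    fix p c k i
    assume p: "p < n" and c: "c \<in> carrier (?X i)"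
      and kill: "\<And>r. r \<in> ypow_ideal m n k p \<Longrightarrow> r \<odot>\<^bsub>?X i\<^esub> c = \<zero>\<^bsub>?X i\<^esub>"
    show "\<exists>c'\<in>carrier (?X i). ypow p k \<odot>\<^bsub>?X i\<^esub> c' = c \<and>
        (\<forall>r\<in>ypow_ideal m n k p. r \<odot>\<^bsub>?X i\<^esub> c' = \<zero>\<^bsub>?X i\<^esub>)"
    proof (cases "i < 2")
      case True
      then have "?X i = (E 0)\<lparr>carrier := {\<zero>\<^bsub>E 0\<^esub>}\<rparr>" by (simp add: shifted_module_def)
      then show ?thesis using c kill p by (auto intro!: ypow_in_bipoly)
    next
      case False
      then have Xi: "?X i = E (i - 2)" by (simp add: shifted_module_def)
      have c': "c \<in> carrier (E (i - 2))" using c by (simp add: Xi)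
      have kill': "r \<odot>\<^bsub>E (i - 2)\<^esub> c = \<zero>\<^bsub>E (i - 2)\<^esub>" if "r \<in> ypow_ideal m n k p" for r
        using kill[OF that] by (simp add: Xi)
      have reg: "s \<in> ypow_ideal m n k p"
        if "s \<in> carrier ?S" "ypow p k \<otimes>\<^bsub>?S\<^esub> s \<in> ypow_ideal m n k p" for s
        by (rule ypow_regular[OF that])
      obtain c' where "c' \<in> carrier (E (i - 2))" "ypow p k \<odot>\<^bsub>E (i - 2)\<^esub> c' = c"
        "\<And>r. r \<in> ypow_ideal m n k p \<Longrightarrow> r \<odot>\<^bsub>E (i - 2)\<^esub> c' = \<zero>\<^bsub>E (i - 2)\<^esub>"
        using injective_module_divide[OF inj ideal_ypow_ideal ypow_in_bipoly[OF p] reg c' kill']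
        by blast
      then show ?thesis unfolding Xi by blast
    qed
  next
    show "f \<in> ypow_ideal m n 1 n"
      unfolding ypow_ideal_def
    proof (intro CollectI conjI ballI f)
      fix \<mu> assume "\<mu> \<in> Poly_Mapping.keys f"
      then have "(\<Sum>j<n. lkp \<mu> (Inr j)) = b" using deg by (simp add: bidegree_def)
      then have "(\<Sum>j<n. lkp \<mu> (Inr j)) \<noteq> 0" using b by simp
      then obtain j where "j < n" "lkp \<mu> (Inr j) \<noteq> 0" by (metis lessThan_iff sum.neutral)
      then show "\<exists>j<n. 1 \<le> lkp \<mu> (Inr j)" by (intro exI[of _ j]) auto
    qed
  next
    let ?v = "\<epsilon> (?c 1)"
    have fv: "f \<odot>\<^bsub>E 0\<^esub> ?v = \<zero>\<^bsub>E 0\<^esub>" using eps_c_0[OF f] S.cgenideal_self[OF f] by simp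
    have dv: "d 0 ?v = \<zero>\<^bsub>E (Suc 0)\<^esub>"
      using eps_img c_in[OF one] by (auto simp: a_kernel_def')
    show "two_term_model ?S f {0} ?X ?D 0 \<zero>\<^bsub>?X 1\<^esub> ?v"
      unfolding two_term_model_def
    proof (intro conjI ballI allI impI)
      fix z g assume "?D 0 z = g \<odot>\<^bsub>?X (Suc 0)\<^esub> \<zero>\<^bsub>?X 1\<^esub> \<and> g \<otimes>\<^bsub>?S\<^esub> f \<in> {0}"
      then show "g \<in> {0}" using f0 by auto
    next
      fix z h assume z: "z \<in> carrier (?X (Suc 0))" and h: "h \<in> carrier ?S"
        and "?D (Suc 0) z = h \<odot>\<^bsub>?X (Suc (Suc 0))\<^esub> ?v"
      then have "h \<in> ?I" using eps_c_0[OF h] by simp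
      then obtain g where g: "g \<in> carrier ?S" "h = g * f" by (auto simp: cgenideal_def)
      then have "h \<ominus>\<^bsub>?S\<^esub> g \<otimes>\<^bsub>?S\<^esub> f \<in> {0}"
        using h by (simp add: bipoly_a_minus)
      then show "\<exists>g\<in>carrier ?S. \<exists>w\<in>carrier (?X 0).
          z = g \<odot>\<^bsub>?X (Suc 0)\<^esub> \<zero>\<^bsub>?X 1\<^esub> \<oplus>\<^bsub>?X (Suc 0)\<^esub> ?D 0 w \<and> h \<ominus>\<^bsub>?S\<^esub> g \<otimes>\<^bsub>?S\<^esub> f \<in> {0}"
        using g(1) z by (intro bexI[of _ g] bexI[of _ "\<zero>\<^bsub>E 0\<^esub>"]) auto
    next
      fix z assume "z \<in> carrier (?X (Suc (Suc 0)))"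
        and "?D (Suc (Suc 0)) z = \<zero>\<^bsub>?X (Suc (Suc (Suc 0)))\<^esub>"
      then have "z \<in> a_kernel (E 0) (E 1) (d 0)" by (simp add: a_kernel_def')
      then obtain h where h: "h \<in> carrier ?S" "z = \<epsilon> (?c h)"
        unfolding eps_img[symmetric] by (auto simp: carrier_quotient[OF modR I])
      then show "\<exists>h\<in>carrier ?S. \<exists>w\<in>carrier (?X (Suc 0)).
          z = h \<odot>\<^bsub>?X (Suc (Suc 0))\<^esub> ?v \<oplus>\<^bsub>?X (Suc (Suc 0))\<^esub> ?D (Suc 0) w"
        using eps_c[OF h(1)] v0 by (intro bexI[of _ h] bexI[of _ "\<zero>\<^bsub>E 0\<^esub>"]) auto
    next
      fix i z assume i: "Suc (Suc 0) \<le> i"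
        and z: "z \<in> carrier (?X (Suc i))" "?D (Suc i) z = \<zero>\<^bsub>?X (Suc (Suc i))\<^esub>"
      obtain j where j: "i = Suc (Suc j)" using i by (metis Suc_le_D Suc_le_mono)
      have "z \<in> d j ` carrier (E j)" unfolding ker using z by (simp add: j a_kernel_def')
      then show "\<exists>w\<in>carrier (?X i). z = ?D i w" by (auto simp: j)
    qed (use v0 fv dv in auto)
  qed
qed

theorem proposition3p3:
  fixes m n a b :: nat
    and f :: "'k::field bipoly"
    and E :: "nat \<Rightarrow> ('k bipoly, 'e) module"
    and d :: "nat \<Rightarrow> 'e \<Rightarrow> 'e"
    and \<epsilon> :: "'k bipoly set \<Rightarrow> 'e"
  assumes "n \<ge> 1"
    and "bihomogeneous_form m n (a, b) f"
    and "b \<ge> 1"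
    and "injective_resolution (bipoly_ring m n) (hypersurface_module m n f) E d \<epsilon>"
  shows "artinian_module (bipoly_ring m n)
           (local_cohomology (bipoly_ring m n) (ideal_y m n) E d (n - 1)) \<longleftrightarrow> m = 0"
proof -
  interpret divisible_complex m n "shifted_module E" "shifted_diff E d" f
      "\<epsilon> (PIdl\<^bsub>bipoly_ring m n\<^esub> f +>\<^bsub>regular_module (bipoly_ring m n)\<^esub> 1)"
    by (rule divisible_complex_resolution[OF assms(2-4)])
  have mod: "module S (E i)" for i
    using assms(4) by (simp add: injective_resolution_def injective_module_def)
  have tors: "torsion_part S (ideal_y m n) (E i) = T (Suc (Suc i))" for i
    using torsion_part_iff[OF mod assms(1)] by (auto simp: T_def)
  obtain l where l: "n = Suc l" using assms(1) by (cases n) auto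
  have Z_eq: "(E l)\<lparr>carrier := {x \<in> torsion_part S (ideal_y m n) (E l). d l x = \<zero>\<^bsub>E (Suc l)\<^esub>}\<rparr> = Z"
  proof -
    have "shifted_module E (Suc n) = E l" "shifted_module E (Suc (Suc n)) = E (Suc l)"
      "shifted_diff E d (Suc n) = d l"
      unfolding l by simp_all
    then show ?thesis unfolding Z_def tors l[symmetric] by simp
  qed
  have B_eq: "(case l of 0 \<Rightarrow> {\<zero>\<^bsub>E 0\<^esub>} | Suc j \<Rightarrow> d j ` torsion_part S (ideal_y m n) (E j)) = B"
  proof (cases l)
    case 0
    have "T 1 = {\<zero>\<^bsub>E 0\<^esub>}"
      using subgroup.one_closed[OF submodule.axioms(1)[OF submodule_T[of 1]]] by (auto simp: T_def)
    moreover have "n = 1" using l 0 by simp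
    ultimately have "shifted_diff E d n ` T n = {\<zero>\<^bsub>E 0\<^esub>}" by simp
    then show ?thesis unfolding B_def 0 by simp
  next
    case (Suc j)
    then have n: "n = Suc (Suc j)" using l by simp
    have "shifted_diff E d n = d j" unfolding n by simp
    then show ?thesis unfolding B_def Suc tors by (simp add: n[symmetric])
  qed
  have "local_cohomology S (ideal_y m n) E d (n - 1) = H"
  proof -
    have "n - 1 = l" using l by simp
    then show ?thesis unfolding local_cohomology_def H_def by (simp only: Z_eq B_eq)
  qed
  then show ?thesis using artinian_H not_artinian_H by auto
qed

end
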